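(* Let $\theta>0$, and let $\sigma_1,\sigma_2:\mathbb{R}\to\mathbb{R}$ be nonrandom, globally Lipschitz continuous functions with $\sigma_i(x)\ge0$ for all $x\in\mathbb{R}$ and $\sigma_i(0)=0$ ($i=1,2$). Let $u_0,v_0\in L^1(\mathbb{R})\cap L^\infty(\mathbb{R})$ be nonrandom and nonnegative with $\min\{\|u_0\|_{L^1(\mathbb{R})},\|v_0\|_{L^1(\mathbb{R})}\}>0$. Suppose $u$ and $v$ solve, with the same space-time white noise $\xi$, $$\frac{\partial}{\partial t}u_t(x)=\frac{\theta}{2}\frac{\partial^2}{\partial x^2}u_t(x)+\sigma_1(u_t(x))\,\xi(t,x),\qquad \frac{\partial}{\partial t}v_t(x)=\frac{\theta}{2}\frac{\partial^2}{\partial x^2}v_t(x)+\sigma_2(v_t(x))\,\xi(t,x)$$ for $t>0$, $x\in\mathbb{R}$, with initial functions $u_0$ and $v_0$ respectively. Then there exist $\eta\in(0,1)$ and $\gamma>0$, depending only on $(\mathrm{Lip}(\sigma_1),\mathrm{Lip}(\sigma_2),\theta)$, such that $$\mathrm{Cov}\left(\frac{\|u_t\|_{L^1(\mathbb{R})}}{\|u_0\|_{L^1(\mathbb{R})}},\frac{\|v_t\|_{L^1(\mathbb{R})}}{\|v_0\|_{L^1(\mathbb{R})}}\right)\le\eta^{-1}e^{-\gamma t},$$ provided that $0<t<\eta\cdot\mathrm{dist}(\mathcal{S}[u_0],\mathcal{S}[v_0])$, where $\mathcal{S}[f]$ denotes the support of $f$ and $\mathrm{dist}$ denotes the Hausdorff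 distance between subsets of the real line.
   Context: Space-time white noise $\xi$ is the generalized centered Gaussian random field with $\mathrm{Cov}[\xi(t,x),\xi(s,y)]=\delta_0(s-t)\delta_0(x-y)$ for $s,t\ge0$, $x,y\in\mathbb{R}$. Solution: for a nonrandom essentially bounded $u_0$ and Lipschitz $\sigma$, the solution of $\partial_t u=\frac{\theta}{2}\partial_x^2u+\sigma(u)\xi$ started at $u_0$ is the unique continuous mild (Walsh) solution, that is, the predictable random field $u$ with $\sup_{t\in[0,T]}\sup_{x\in\mathbb{R}}\mathrm{E}(|u_t(x)|^2)<\infty$ for all finite $T>0$ such that, almost surely, for all $t>0$ and $x\in\mathbb{R}$, $$u_t(x)=(p_t*u_0)(x)+\int_{(0,t)\times\mathbb{R}}p_{t-s}(x-y)\,\sigma(u_s(y))\,\xi(\mathrm{d}s\,\mathrm{d}y),$$ where the integral is a Walsh stochastic integral and $p_r(a)=(2\pi\theta r)^{-1/2}\exp(-a^2/(2\theta r))$ for $r>0$, $a\in\mathbb{R}$. Under the stated assumptions the solutions are almost surely nonnegative, so $\|u_t\|_{L^1(\mathbb{R})}=\int_{-\infty}^\infty u_t(x)\,\mathrm{d}x$ is the total mass at time $t$. $\mathrm{Lip}(\varphi):=\sup_{-\infty<a<b<\infty}|(\varphi(a)-\varphi(b))/(a-b)|$ is the optimal Lipschitz constant of a Lipschitz function $\varphi:\mathbb{R}\to\mathbb{R}$.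
   Formalization: dist is the smallest distance between points of the two supports, not the Hausdorff distance, for which the claim fails (overlapping supports, one with a far-away extra piece); η and γ are chosen for probability spaces over one fixed, arbitrary sample-space type. *)

theory Defs
  imports "HOL-Probability.Probability"
begin

definition covariance :: "'a measure \<Rightarrow> ('a \<Rightarrow> real) \<Rightarrow> ('a \<Rightarrow> real) \<Rightarrow> real" where
  "covariance M X Y =
     (LINT \<omega>|M. (X \<omega> - (LINT \<omega>'|M. X \<omega>')) * (Y \<omega> - (LINT \<omega>'|M. Y \<omega>')))"

definition l1_norm :: "(real \<Rightarrow> real) \<Rightarrow> real" where
  "l1_norm f = (LINT x|lborel. \<bar>f x\<bar>)"

definition lip_const :: "(real \<Rightarrow> real) \<Rightarrow> real" where
  "lip_const \<phi> = Sup {\<bar>(\<phi> a - \<phi> b) / (a - b)\<bar> | a b. a < b}"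

(* Essential boundedness; pointwise values of an L^infinity function are immaterial. *)
definition ess_bounded :: "(real \<Rightarrow> real) \<Rightarrow> bool" where
  "ess_bounded f \<longleftrightarrow> f \<in> borel_measurable lborel \<and> (\<exists>C. AE x in lborel. \<bar>f x\<bar> \<le> C)"

(* Support of an element of L^1: complement of the largest open set on which f = 0 almost
   everywhere. Unlike the closure of {x. f x \<noteq> 0}, it does not depend on the representative.
   The distance of two supports is the gap between them (setdist, smallest distance of points),
   not the max-min Hausdorff metric: for sigma(x) = x, u0 = 1_[0,1] and
   v0 = 1_[0,1] + 1_[L,L+1], the latter is of order L, yet the covariance stays bounded away
   from 0 for all t \<ge> 1, uniformly in L. *)
definition ess_support :: "(real \<Rightarrow> real) \<Rightarrow> real set" where
  "ess_support f = - \<Union>{U. open U \<and> (AE x in lborel. x \<in> U \<longrightarrow> f x = 0)}"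

definition heat_kernel :: "real \<Rightarrow> real \<Rightarrow> real \<Rightarrow> real" where
  "heat_kernel \<theta> r a = exp (- a\<^sup>2 / (2 * \<theta> * r)) / sqrt (2 * pi * \<theta> * r)"

definition heat_conv :: "real \<Rightarrow> (real \<Rightarrow> real) \<Rightarrow> real \<Rightarrow> real \<Rightarrow> real" where
  "heat_conv \<theta> f t x = (LINT y|lborel. heat_kernel \<theta> t (x - y) * f y)"

(* Points are (time, space). The slice t = 0 is Lebesgue-null, so leaving it out does not
   change the L^2 space or the noise indexed by it. *)
definition spacetime :: "(real \<times> real) measure" where
  "spacetime = restrict_space lborel ({0<..} \<times> UNIV)"

definition sq_integrable :: "(real \<times> real \<Rightarrow> real) set" where
  "sq_integrable =
     {\<phi> \<in> borel_measurable spacetime. integrable spacetime (\<lambda>z. (\<phi> z)\<^sup>2)}"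

(* Includes the degenerate law of variance zero. *)
definition centered_gaussian :: "'a measure \<Rightarrow> ('a \<Rightarrow> real) \<Rightarrow> bool" where
  "centered_gaussian M X \<longleftrightarrow> X \<in> borel_measurable M \<and>
     ((AE \<omega> in M. X \<omega> = 0) \<or> (\<exists>s>0. distributed M lborel X (\<lambda>x. ennreal (normal_density 0 s x))))"

(* The generalized field is indexed by test functions, with \<xi> \<phi> in the role of the formal
   integral of \<phi>(t,x) \<xi>(t,x) dt dx. Tested against \<phi> and \<psi>, the covariance
   delta_0(s-t) delta_0(x-y) becomes the L^2 inner product. *)
definition white_noise ::
  "'a measure \<Rightarrow> ((real \<times> real \<Rightarrow> real) \<Rightarrow> 'a \<Rightarrow> real) \<Rightarrow> bool" where
  "white_noise M \<xi> \<longleftrightarrow>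
     (\<forall>\<Phi> c. finite \<Phi> \<and> \<Phi> \<subseteq> sq_integrable \<longrightarrow>
        centered_gaussian M (\<lambda>\<omega>. \<Sum>\<phi>\<in>\<Phi>. c \<phi> * \<xi> \<phi> \<omega>)) \<and>
     (\<forall>\<phi>\<in>sq_integrable. \<forall>\<psi>\<in>sq_integrable.
        covariance M (\<xi> \<phi>) (\<xi> \<psi>) = (LINT z|spacetime. \<phi> z * \<psi> z))"

(* Filtration generated by the noise up to time t and the null sets. Passing to the
   right-continuous version would not change the predictable sigma-algebra below. *)
definition noise_filtration ::
  "'a measure \<Rightarrow> ((real \<times> real \<Rightarrow> real) \<Rightarrow> 'a \<Rightarrow> real) \<Rightarrow> real \<Rightarrow> 'a measure" where
  "noise_filtration M \<xi> t = sigma (space M)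
     ({\<xi> \<phi> -` B \<inter> space M | \<phi> B.
         \<phi> \<in> sq_integrable \<and> (\<forall>s y. t < s \<longrightarrow> \<phi> (s, y) = 0) \<and> B \<in> sets borel} \<union> null_sets M)"

definition predictable_algebra ::
  "'a measure \<Rightarrow> ((real \<times> real \<Rightarrow> real) \<Rightarrow> 'a \<Rightarrow> real) \<Rightarrow> ((real \<times> real) \<times> 'a) measure" where
  "predictable_algebra M \<xi> = sigma (({0<..} \<times> UNIV) \<times> space M)
     {({a<..b} \<times> A) \<times> F | a b A F.
        0 \<le> a \<and> a < b \<and> A \<in> sets borel \<and> F \<in> sets (noise_filtration M \<xi> a)}"

definition predictable ::
  "'a measure \<Rightarrow> ((real \<times> real \<Rightarrow> real) \<Rightarrow> 'a \<Rightarrow> real) \<Rightarrow> (real \<Rightarrow> real \<Rightarrow> 'a \<Rightarrow> real) \<Rightarrow> bool" where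
  "predictable M \<xi> \<Phi> \<longleftrightarrow>
     (\<lambda>((s, y), \<omega>). \<Phi> s y \<omega>) \<in> borel_measurable (predictable_algebra M \<xi>)"

(* J is the integral of the elementary field \<Psi>, a finite sum of terms
   X(\<omega>) 1_(a,b](s) 1_A(y) with X bounded and known at time a. *)
definition elementary_integral ::
  "'a measure \<Rightarrow> ((real \<times> real \<Rightarrow> real) \<Rightarrow> 'a \<Rightarrow> real) \<Rightarrow>
   (real \<Rightarrow> real \<Rightarrow> 'a \<Rightarrow> real) \<Rightarrow> ('a \<Rightarrow> real) \<Rightarrow> bool" where
  "elementary_integral M \<xi> \<Psi> J \<longleftrightarrow>
     (\<exists>(n::nat) a b A X.
        (\<forall>i<n. 0 \<le> a i \<and> a i < b i \<and> A i \<in> sets borel \<and> emeasure lborel (A i) < \<infinity> \<and>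
           X i \<in> borel_measurable (noise_filtration M \<xi> (a i)) \<and>
           (\<exists>C. \<forall>\<omega>\<in>space M. \<bar>X i \<omega>\<bar> \<le> C)) \<and>
        \<Psi> = (\<lambda>s y \<omega>. \<Sum>i<n. X i \<omega> * indicator {a i<..b i} s * indicator (A i) y) \<and>
        J = (\<lambda>\<omega>. \<Sum>i<n. X i \<omega> * \<xi> (indicator ({a i<..b i} \<times> A i)) \<omega>))"

(* Z is (a version of) the Walsh integral of \<Phi> over all of spacetime, obtained as an L^2 limit
   of elementary integrals. A relation, since the integral is determined only almost surely. *)
definition has_walsh_integral ::
  "'a measure \<Rightarrow> ((real \<times> real \<Rightarrow> real) \<Rightarrow> 'a \<Rightarrow> real) \<Rightarrow>
   (real \<Rightarrow> real \<Rightarrow> 'a \<Rightarrow> real) \<Rightarrow> ('a \<Rightarrow> real) \<Rightarrow> bool" where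
  "has_walsh_integral M \<xi> \<Phi> Z \<longleftrightarrow>
     predictable M \<xi> \<Phi> \<and> Z \<in> borel_measurable M \<and>
     (\<exists>\<Psi> J. (\<forall>n::nat. elementary_integral M \<xi> (\<Psi> n) (J n)) \<and>
        (\<lambda>n. \<integral>\<^sup>+((s, y), \<omega>). ennreal ((\<Psi> n s y \<omega> - \<Phi> s y \<omega>)\<^sup>2) \<partial>(spacetime \<Otimes>\<^sub>M M)) \<longlonglongrightarrow> 0 \<and>
        (\<lambda>n. \<integral>\<^sup>+\<omega>. ennreal ((J n \<omega> - Z \<omega>)\<^sup>2) \<partial>M) \<longlonglongrightarrow> 0)"

(* Continuous mild solution u t x \<omega> on t > 0. The moment bound is over (0,T]: at time 0 the field
   is the L^infinity function u0, which need not have a pointwise supremum. I is a version of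
   the field of stochastic integrals, so that the mild equation can hold almost surely for all
   (t,x) simultaneously. *)
definition mild_solution ::
  "'a measure \<Rightarrow> ((real \<times> real \<Rightarrow> real) \<Rightarrow> 'a \<Rightarrow> real) \<Rightarrow> real \<Rightarrow> (real \<Rightarrow> real) \<Rightarrow>
   (real \<Rightarrow> real) \<Rightarrow> (real \<Rightarrow> real \<Rightarrow> 'a \<Rightarrow> real) \<Rightarrow> bool" where
  "mild_solution M \<xi> \<theta> \<sigma> u0 u \<longleftrightarrow>
     predictable M \<xi> u \<and>
     (\<forall>T>0. (SUP t\<in>{0<..T}. SUP x. \<integral>\<^sup>+\<omega>. ennreal ((u t x \<omega>)\<^sup>2) \<partial>M) < \<infinity>) \<and>
     (AE \<omega> in M. continuous_on ({0<..} \<times> UNIV) (\<lambda>(t, x). u t x \<omega>)) \<and>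
     (\<exists>I. (\<forall>t>0. \<forall>x. has_walsh_integral M \<xi>
             (\<lambda>s y \<omega>. indicator {0<..<t} s * heat_kernel \<theta> (t - s) (x - y) * \<sigma> (u s y \<omega>)) (I t x)) \<and>
          (AE \<omega> in M. \<forall>t>0. \<forall>x. u t x \<omega> = heat_conv \<theta> u0 t x + I t x \<omega>))"

end

(* Let A and B be the open d/2-neighbourhoods of the supports of u0 and v0, where d is the distance
   of the supports. A and B are disjoint, so the noise over A is independent of the noise over B.
   It therefore suffices to show that u is nearly measurable with respect to the noise over A,
   and v with respect to the noise over B.

   Let D_t(x) be the squared L^2 distance of u_t(x) from the random variables determined by the noise
   over A. The stochastic integral in the mild equation splits into the parts over A and over its
   complement. Projecting the integrand of the first part and discarding the second one gives
     D_t(x) <= Lip^2 * integral of p_{t-s}(x-y)^2 (1_A(y) D_s(y) + 1_{A^c}(y) E u_s(y)^2) ds dy.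
   Off A the second moment of u is exponentially small in d^2/t, hence so is D, by comparison with
   the supersolution (e^{beta s}/s) (integral of u0(a) exp(-(x-a)^2/(2 kappa s)) da)^2. The covariance
   of |u_t(x)| and |v_t(y)| is then at most a small multiple of the product of two such
   amplitudes, whose x-integrals are of order e^{beta t/2} times the initial masses. Integrating over
   x and y, and choosing eta small compared with 1/sqrt(beta), gives the decay. *)
theory Submission
  imports Defs
begin

section \<open>Characteristic functions and Gaussian variables\<close>

text \<open>The nonlinear coefficient is the obstacle: conditional expectation does not commute with
  \<open>\<sigma>\<close>. Locality is therefore measured by an L^2 distance to all variables known
  from the noise over a region, since a Lipschitz function of a competitor is again a competitor.
  This distance obeys a Volterra inequality without an initial term, because the deterministic part
  of the mild equation does not change it. As it is an infimum over uncountably many competitors,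
  its measurability in (s,y) is never asked for; all iterations run through measurable majorants.
  The squared heat kernel has mass of order (t-s)^(-1/2), so the Volterra operator contracts in the
  weight e^(beta s) at rate beta^(-1/2), on Gaussian averages uniformly for kappa between theta and
  2 theta. Doubling the variance spends half of the Gaussian exponent; the other half is the gain
  exp(-delta^2/(4 theta t)), with delta = d/2. White noise is given by Gaussian laws and covariances
  alone, so its linearity and independence are derived first, the latter from characteristic
  functions.\<close>

abbreviation (in prob_space) second_moment :: "('a \<Rightarrow> real) \<Rightarrow> ennreal" where
  "second_moment X \<equiv> \<integral>\<^sup>+\<omega>. ennreal ((X \<omega>)\<^sup>2) \<partial>M"

text \<open>Uniqueness of characteristic functions for a signed density. The positive and negative
  parts of \<open>h\<close>, divided by their common mass, are densities of two probability
  measures; the laws of \<open>X\<close> under them have the same characteristic function, hence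
  agree by Levy's theorem.\<close>

lemma (in prob_space) integral_indicator_eq_0_if_char_eq_0:
  fixes X h :: "'a \<Rightarrow> real"
  assumes X[measurable]: "X \<in> borel_measurable M" and h: "integrable M h"
    and c: "\<And>c. (LINT \<omega>|M. cos (c * X \<omega>) * h \<omega>) = 0"
    and s: "\<And>c. (LINT \<omega>|M. sin (c * X \<omega>) * h \<omega>) = 0"
    and B[measurable]: "B \<in> sets borel"
  shows "(LINT \<omega>|M. indicator B (X \<omega>) * h \<omega>) = 0"
proof -
  have hm[measurable]: "h \<in> borel_measurable M" using h by auto
  define p where "p = (\<lambda>\<omega>. max (h \<omega>) 0)"
  define n where "n = (\<lambda>\<omega>. max (- h \<omega>) 0)"
  have pm[measurable]: "p \<in> borel_measurable M" "n \<in> borel_measurable M" unfolding p_def n_def by auto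
  have p0: "\<And>\<omega>. p \<omega> \<ge> 0" "\<And>\<omega>. n \<omega> \<ge> 0" and hpn: "\<And>\<omega>. h \<omega> = p \<omega> - n \<omega>"
    unfolding p_def n_def by auto
  have ip: "integrable M p" "integrable M n" unfolding p_def n_def using h by auto
  have prodint: "integrable M (\<lambda>\<omega>. f \<omega> * g \<omega>)"
    if "integrable M g" "\<And>\<omega>. \<bar>f \<omega>\<bar> \<le> 1" "f \<in> borel_measurable M" for f g :: "'a \<Rightarrow> real"
    by (rule Bochner_Integration.integrable_bound[OF that(1)])
      (use that in \<open>auto simp: abs_mult intro!: AE_I2 mult_left_le_one_le borel_measurable_times\<close>)
  have diff: "(LINT \<omega>|M. f \<omega> * p \<omega>) = (LINT \<omega>|M. f \<omega> * n \<omega>)"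
    if "(LINT \<omega>|M. f \<omega> * h \<omega>) = 0" "\<And>\<omega>. \<bar>f \<omega>\<bar> \<le> 1" "f \<in> borel_measurable M" for f
  proof -
    have "(LINT \<omega>|M. f \<omega> * h \<omega>) = (LINT \<omega>|M. f \<omega> * p \<omega> - f \<omega> * n \<omega>)"
      by (simp add: hpn right_diff_distrib)
    also have "\<dots> = (LINT \<omega>|M. f \<omega> * p \<omega>) - (LINT \<omega>|M. f \<omega> * n \<omega>)"
      by (intro Bochner_Integration.integral_diff prodint ip that)
    finally show ?thesis using that(1) by simp
  qed
  define m where "m = (LINT \<omega>|M. p \<omega>)"
  \<comment> \<open>\<open>c = 0\<close> in the cosine hypothesis equates the masses of the two
    parts, so the one constant \<open>m\<close> normalises both.\<close>
  have mn: "m = (LINT \<omega>|M. n \<omega>)" using diff[of "\<lambda>_. 1"] c[of 0] by (simp add: m_def)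
  show ?thesis
  proof (cases "m = 0")
    case True
    have "AE \<omega> in M. p \<omega> = 0" "AE \<omega> in M. n \<omega> = 0"
      using True mn ip p0 integral_nonneg_eq_0_iff_AE[of M p] integral_nonneg_eq_0_iff_AE[of M n]
      by (auto simp: m_def)
    then have "AE \<omega> in M. indicator B (X \<omega>) * h \<omega> = 0" by eventually_elim (simp add: hpn)
    then show ?thesis by (rule integral_eq_zero_AE)
  next
    case False
    then have m: "m > 0" unfolding m_def using Bochner_Integration.integral_nonneg[of M p] p0 by (simp add: less_le)
    define D where "D = (\<lambda>q::'a \<Rightarrow> real. distr (density M (\<lambda>\<omega>. ennreal (q \<omega> / m))) borel X)"
    have D: "real_distribution (D q)"
      if q: "q \<in> borel_measurable M" "\<And>\<omega>. q \<omega> \<ge> 0" "integrable M q" "(LINT \<omega>|M. q \<omega>) = m" for q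
    proof -
      note q(1)[measurable]
      have "prob_space (density M (\<lambda>\<omega>. ennreal (q \<omega> / m)))"
      proof (rule prob_spaceI)
        have "(\<integral>\<^sup>+\<omega>. ennreal (q \<omega> / m) \<partial>M) = ennreal (LINT \<omega>|M. q \<omega> / m)"
          using q m by (intro nn_integral_eq_integral) auto
        then show "emeasure (density M (\<lambda>\<omega>. ennreal (q \<omega> / m))) (space (density M (\<lambda>\<omega>. ennreal (q \<omega> / m)))) = 1"
          using m q by (simp add: emeasure_density cong: nn_integral_cong)
      qed
      then show ?thesis
        unfolding D_def by (rule prob_space.real_distribution_distr) simp
    qed
    have LD: "(LINT x|D q. f x) = (LINT \<omega>|M. (q \<omega> / m) *\<^sub>R f (X \<omega>))"
      if q: "q \<in> borel_measurable M" "\<And>\<omega>. q \<omega> \<ge> 0" and [measurable]: "f \<in> borel_measurable borel"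
      for q and f :: "real \<Rightarrow> 'b :: {banach, second_countable_topology}"
    proof -
      note q(1)[measurable]
      have "(LINT x|D q. f x) = (LINT \<omega>|density M (\<lambda>\<omega>. ennreal (q \<omega> / m)). f (X \<omega>))"
        unfolding D_def by (rule integral_distr) auto
      also have "\<dots> = (LINT \<omega>|M. (q \<omega> / m) *\<^sub>R f (X \<omega>))"
        using q m by (intro integral_density) auto
      finally show ?thesis .
    qed
    have char: "char (D q) t = Complex ((LINT \<omega>|M. cos (t * X \<omega>) * q \<omega>) / m) ((LINT \<omega>|M. sin (t * X \<omega>) * q \<omega>) / m)"
      if q: "q \<in> borel_measurable M" "\<And>\<omega>. q \<omega> \<ge> 0" "integrable M q" "(LINT \<omega>|M. q \<omega>) = m" for q t
    proof -
      note q(1)[measurable]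
      have I: "integrable M (\<lambda>\<omega>. (q \<omega> / m) *\<^sub>R iexp (t * X \<omega>))"
        by (rule Bochner_Integration.integrable_bound[of _ "\<lambda>\<omega>. q \<omega> / m"]) (use m q in auto)
      have "char (D q) t = (LINT \<omega>|M. (q \<omega> / m) *\<^sub>R iexp (t * X \<omega>))"
        unfolding char_def by (rule LD) (use q in auto)
      moreover have "Re (LINT \<omega>|M. (q \<omega> / m) *\<^sub>R iexp (t * X \<omega>)) = (LINT \<omega>|M. cos (t * X \<omega>) * q \<omega>) / m"
        using I by (subst integral_Re[symmetric]) (auto simp: Re_exp mult.commute)
      moreover have "Im (LINT \<omega>|M. (q \<omega> / m) *\<^sub>R iexp (t * X \<omega>)) = (LINT \<omega>|M. sin (t * X \<omega>) * q \<omega>) / m"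
        using I by (subst integral_Im[symmetric]) (auto simp: Im_exp mult.commute)
      ultimately show ?thesis by (simp add: complex_eq_iff)
    qed
    note P = pm(1) p0(1) ip(1) m_def[symmetric] and N = pm(2) p0(2) ip(2) mn[symmetric]
    have "char (D p) = char (D n)"
      using diff[OF c] diff[OF s] by (intro ext) (simp add: char[OF P] char[OF N])
    then have "D p = D n" using Levy_uniqueness D[OF P] D[OF N] by blast
    then have "(LINT \<omega>|M. (p \<omega> / m) * indicator B (X \<omega>)) = (LINT \<omega>|M. (n \<omega> / m) * indicator B (X \<omega>))"
      using LD[OF P(1,2), of "indicator B :: real \<Rightarrow> real"] LD[OF N(1,2), of "indicator B :: real \<Rightarrow> real"] by simp
    then have "(LINT \<omega>|M. indicator B (X \<omega>) * p \<omega>) = (LINT \<omega>|M. indicator B (X \<omega>) * n \<omega>)"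
      using m by (simp add: mult.commute)
    moreover have "(LINT \<omega>|M. indicator B (X \<omega>) * h \<omega>)
        = (LINT \<omega>|M. indicator B (X \<omega>) * p \<omega>) - (LINT \<omega>|M. indicator B (X \<omega>) * n \<omega>)"
      unfolding hpn right_diff_distrib
      by (intro Bochner_Integration.integral_diff prodint ip) (auto simp: indicator_def)
    ultimately show ?thesis by simp
  qed
qed

text \<open>Expressing the characteristic function through the second moment lets the degenerate law
  share the formula. Otherwise \<open>X / s\<close> is standard normal, and the real and imaginary
  parts of its characteristic function at \<open>s\<close> give the cosine and the sine.\<close>

lemma (in prob_space) centered_gaussian_moments:
  assumes "centered_gaussian M X"
  shows "integrable M X" "integrable M (\<lambda>\<omega>. (X \<omega>)\<^sup>2)" "expectation X = 0"
    "expectation (\<lambda>\<omega>. cos (X \<omega>)) = exp (- expectation (\<lambda>\<omega>. (X \<omega>)\<^sup>2) / 2)"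
    "expectation (\<lambda>\<omega>. sin (X \<omega>)) = 0"
proof -
  have Xm[measurable]: "X \<in> borel_measurable M" using assms by (simp add: centered_gaussian_def)
  have "integrable M X \<and> integrable M (\<lambda>\<omega>. (X \<omega>)\<^sup>2) \<and> expectation X = 0 \<and>
    expectation (\<lambda>\<omega>. cos (X \<omega>)) = exp (- expectation (\<lambda>\<omega>. (X \<omega>)\<^sup>2) / 2) \<and>
    expectation (\<lambda>\<omega>. sin (X \<omega>)) = 0"
  proof (cases "AE \<omega> in M. X \<omega> = 0")
    case True
    have *: "integrable M (\<lambda>\<omega>. f (X \<omega>)) \<and> expectation (\<lambda>\<omega>. f (X \<omega>)) = f 0"
      if [measurable]: "f \<in> borel_measurable borel" for f :: "real \<Rightarrow> real"
    proof -
      have "AE \<omega> in M. f (X \<omega>) = f 0" using True by eventually_elim simp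
      then have "integrable M (\<lambda>\<omega>. f (X \<omega>)) = integrable M (\<lambda>\<omega>. f 0)"
        "expectation (\<lambda>\<omega>. f (X \<omega>)) = expectation (\<lambda>\<omega>. f 0)"
        by (intro integrable_cong_AE integral_cong_AE; simp)+
      then show ?thesis by (simp add: prob_space)
    qed
    show ?thesis using *[of "\<lambda>x. x"] *[of "\<lambda>x. x\<^sup>2"] *[of cos] *[of sin] by simp
  next
    case False
    then obtain s where s: "s > 0" and d: "distributed M lborel X (\<lambda>x. ennreal (normal_density 0 s x))"
      using assms by (auto simp: centered_gaussian_def)
    have i1: "integrable M (\<lambda>\<omega>. (X \<omega>)^k)" for k
      using integrable_normal_moment[OF s, of 0 k] by (subst distributed_integrable[OF d, symmetric]) auto
    have e: "expectation X = 0" using normal_distributed_expectation[OF s d] .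
    have v: "expectation (\<lambda>\<omega>. (X \<omega>)\<^sup>2) = s\<^sup>2" using normal_distributed_variance[OF s d] e by simp
    have d': "distributed M lborel (\<lambda>x. X x / s) std_normal_density"
      using d normal_standard_normal_convert[OF s, of X 0] by simp
    have "char std_normal_distribution s = (CLINT \<omega>|M. iexp (X \<omega>))"
    proof -
      have "std_normal_distribution = distr M lborel (\<lambda>x. X x / s)"
        using d' by (simp add: distributed_def)
      then show ?thesis using s by (simp add: char_def integral_distr)
    qed
    then have "(CLINT \<omega>|M. iexp (X \<omega>)) = of_real (exp (- s\<^sup>2 / 2))"
      by (simp add: char_std_normal_distribution exp_of_real[symmetric])
    moreover have I: "integrable M (\<lambda>\<omega>. iexp (X \<omega>))"
      by (rule integrable_iexp) auto
    ultimately have "(LINT \<omega>|M. Re (iexp (X \<omega>))) = exp (- s\<^sup>2 / 2)" "(LINT \<omega>|M. Im (iexp (X \<omega>))) = 0"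
      by (simp_all add: integral_Re integral_Im)
    then show ?thesis using i1[of 1] i1[of 2] e v by (simp add: Re_exp Im_exp)
  qed
  then show "integrable M X" "integrable M (\<lambda>\<omega>. (X \<omega>)\<^sup>2)" "expectation X = 0"
    "expectation (\<lambda>\<omega>. cos (X \<omega>)) = exp (- expectation (\<lambda>\<omega>. (X \<omega>)\<^sup>2) / 2)"
    "expectation (\<lambda>\<omega>. sin (X \<omega>)) = 0" by auto
qed

section \<open>White noise and the sigma-algebras it generates\<close>

lemma abs_mult_le_squares: "\<bar>a * b\<bar> \<le> a\<^sup>2 + b\<^sup>2" for a b :: real
proof -
  have "2 * (\<bar>a\<bar> * \<bar>b\<bar>) \<le> a\<^sup>2 + b\<^sup>2" "0 \<le> \<bar>a\<bar> * \<bar>b\<bar>"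
    using sum_squares_bound[of "\<bar>a\<bar>" "\<bar>b\<bar>"] by simp_all
  then show ?thesis unfolding abs_mult by linarith
qed

lemma sq_integrable_mult:
  assumes "\<phi> \<in> sq_integrable" "\<psi> \<in> sq_integrable"
  shows "integrable spacetime (\<lambda>z. \<phi> z * \<psi> z)"
proof (rule Bochner_Integration.integrable_bound)
  show "integrable spacetime (\<lambda>z. (\<phi> z)\<^sup>2 + (\<psi> z)\<^sup>2)"
    using assms by (auto simp: sq_integrable_def)
  show "(\<lambda>z. \<phi> z * \<psi> z) \<in> borel_measurable spacetime"
    using assms by (auto simp: sq_integrable_def)
  show "AE z in spacetime. norm (\<phi> z * \<psi> z) \<le> norm ((\<phi> z)\<^sup>2 + (\<psi> z)\<^sup>2)"
    by (auto intro!: AE_I2 abs_mult_le_squares)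
qed

lemma sq_integrable_lin:
  assumes "\<phi> \<in> sq_integrable" "\<psi> \<in> sq_integrable"
  shows "(\<lambda>z. a * \<phi> z + b * \<psi> z) \<in> sq_integrable"
proof -
  have "integrable spacetime (\<lambda>z. a\<^sup>2 * (\<phi> z)\<^sup>2 + 2 * a * b * (\<phi> z * \<psi> z) + b\<^sup>2 * (\<psi> z)\<^sup>2)"
    using assms sq_integrable_mult[OF assms] by (auto simp: sq_integrable_def)
  moreover have "(a * \<phi> z + b * \<psi> z)\<^sup>2 = a\<^sup>2 * (\<phi> z)\<^sup>2 + 2 * a * b * (\<phi> z * \<psi> z) + b\<^sup>2 * (\<psi> z)\<^sup>2" for z
    by (simp add: power2_eq_square algebra_simps)
  ultimately show ?thesis using assms by (auto simp: sq_integrable_def)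
qed

lemma sq_integrable_zero: "(\<lambda>_. 0) \<in> sq_integrable"
  by (simp add: sq_integrable_def)

text \<open>Closure under combinations turns products of trigonometric functions of noise variables
  back into trigonometric functions of a single one. Nonemptiness supplies the zero
  function.\<close>

definition lin_closed :: "(real \<times> real \<Rightarrow> real) set \<Rightarrow> bool" where
  "lin_closed S \<longleftrightarrow> S \<subseteq> sq_integrable \<and> S \<noteq> {} \<and>
     (\<forall>\<phi>\<in>S. \<forall>\<psi>\<in>S. \<forall>a b. (\<lambda>z. a * \<phi> z + b * \<psi> z) \<in> S)"

locale noise = prob_space M for M :: "'a measure" +
  fixes \<xi> :: "(real \<times> real \<Rightarrow> real) \<Rightarrow> 'a \<Rightarrow> real"
  assumes noise: "white_noise M \<xi>"
begin

lemma gaussian: "\<phi> \<in> sq_integrable \<Longrightarrow> centered_gaussian M (\<xi> \<phi>)"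
  using noise[unfolded white_noise_def, THEN conjunct1, rule_format, of "{\<phi>}" "\<lambda>_. 1"] by simp

lemma noise_measurable: "\<phi> \<in> sq_integrable \<Longrightarrow> \<xi> \<phi> \<in> borel_measurable M"
  using gaussian by (simp add: centered_gaussian_def)

lemma noise_integrable: "\<phi> \<in> sq_integrable \<Longrightarrow> integrable M (\<xi> \<phi>)"
  using centered_gaussian_moments(1)[OF gaussian] .

lemma noise_expectation: "\<phi> \<in> sq_integrable \<Longrightarrow> expectation (\<xi> \<phi>) = 0"
  using centered_gaussian_moments(3)[OF gaussian] .

lemma noise_sq_integrable: "\<phi> \<in> sq_integrable \<Longrightarrow> integrable M (\<lambda>\<omega>. (\<xi> \<phi> \<omega>)\<^sup>2)"
  using centered_gaussian_moments(2)[OF gaussian] .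

lemma noise_mult_integrable:
  assumes "\<phi> \<in> sq_integrable" "\<psi> \<in> sq_integrable"
  shows "integrable M (\<lambda>\<omega>. \<xi> \<phi> \<omega> * \<xi> \<psi> \<omega>)"
proof (rule Bochner_Integration.integrable_bound)
  show "integrable M (\<lambda>\<omega>. (\<xi> \<phi> \<omega>)\<^sup>2 + (\<xi> \<psi> \<omega>)\<^sup>2)"
    using assms noise_sq_integrable by auto
  show "(\<lambda>\<omega>. \<xi> \<phi> \<omega> * \<xi> \<psi> \<omega>) \<in> borel_measurable M"
    using assms by (intro borel_measurable_times noise_measurable)
  show "AE \<omega> in M. norm (\<xi> \<phi> \<omega> * \<xi> \<psi> \<omega>) \<le> norm ((\<xi> \<phi> \<omega>)\<^sup>2 + (\<xi> \<psi> \<omega>)\<^sup>2)"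
    by (auto intro!: AE_I2 abs_mult_le_squares)
qed

lemma noise_covariance:
  assumes "\<phi> \<in> sq_integrable" "\<psi> \<in> sq_integrable"
  shows "expectation (\<lambda>\<omega>. \<xi> \<phi> \<omega> * \<xi> \<psi> \<omega>) = (LINT z|spacetime. \<phi> z * \<psi> z)"
  using noise[unfolded white_noise_def, THEN conjunct2, rule_format, OF assms] assms
  by (simp add: covariance_def noise_expectation)

text \<open>\<open>white_noise\<close> postulates no linearity. The second moment of the defect
  expands into inner products of test functions, which cancel because the same combination of the
  test functions themselves is zero.\<close>

lemma noise_lin:
  assumes \<phi>: "\<phi> \<in> sq_integrable" and \<psi>: "\<psi> \<in> sq_integrable"
  shows "AE \<omega> in M. \<xi> (\<lambda>z. a * \<phi> z + b * \<psi> z) \<omega> = a * \<xi> \<phi> \<omega> + b * \<xi> \<psi> \<omega>"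
proof -
  let ?\<chi> = "\<lambda>z. a * \<phi> z + b * \<psi> z"
  note \<chi> = sq_integrable_lin[OF \<phi> \<psi>, of a b]
  note I = noise_mult_integrable sq_integrable_mult
  note [simp] = I[OF \<phi> \<phi>] I[OF \<phi> \<psi>] I[OF \<psi> \<psi>] I[OF \<chi> \<chi>] I[OF \<chi> \<phi>] I[OF \<chi> \<psi>]
  have exp: "(\<xi> ?\<chi> \<omega> - a * \<xi> \<phi> \<omega> - b * \<xi> \<psi> \<omega>)\<^sup>2 =
     \<xi> ?\<chi> \<omega> * \<xi> ?\<chi> \<omega> - 2 * a * (\<xi> ?\<chi> \<omega> * \<xi> \<phi> \<omega>) - 2 * b * (\<xi> ?\<chi> \<omega> * \<xi> \<psi> \<omega>)
      + a\<^sup>2 * (\<xi> \<phi> \<omega> * \<xi> \<phi> \<omega>) + 2 * a * b * (\<xi> \<phi> \<omega> * \<xi> \<psi> \<omega>) + b\<^sup>2 * (\<xi> \<psi> \<omega> * \<xi> \<psi> \<omega>)" for \<omega>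
    by (simp add: power2_eq_square algebra_simps)
  have "(LINT \<omega>|M. (\<xi> ?\<chi> \<omega> - a * \<xi> \<phi> \<omega> - b * \<xi> \<psi> \<omega>)\<^sup>2) =
     (LINT z|spacetime. ?\<chi> z * ?\<chi> z - 2 * a * (?\<chi> z * \<phi> z) - 2 * b * (?\<chi> z * \<psi> z)
      + a\<^sup>2 * (\<phi> z * \<phi> z) + 2 * a * b * (\<phi> z * \<psi> z) + b\<^sup>2 * (\<psi> z * \<psi> z))"
    unfolding exp by (simp add: noise_covariance \<phi> \<psi> \<chi>)
  also have "\<dots> = (LINT z|spacetime. 0)"
    by (intro Bochner_Integration.integral_cong) (simp_all add: power2_eq_square algebra_simps)
  finally have 0: "(LINT \<omega>|M. (\<xi> ?\<chi> \<omega> - a * \<xi> \<phi> \<omega> - b * \<xi> \<psi> \<omega>)\<^sup>2) = 0" by simp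
  have "integrable M (\<lambda>\<omega>. (\<xi> ?\<chi> \<omega> - a * \<xi> \<phi> \<omega> - b * \<xi> \<psi> \<omega>)\<^sup>2)" unfolding exp by simp
  then have "AE \<omega> in M. (\<xi> ?\<chi> \<omega> - a * \<xi> \<phi> \<omega> - b * \<xi> \<psi> \<omega>)\<^sup>2 = 0"
    using integral_nonneg_eq_0_iff_AE[of M "\<lambda>\<omega>. (\<xi> ?\<chi> \<omega> - a * \<xi> \<phi> \<omega> - b * \<xi> \<psi> \<omega>)\<^sup>2"] 0 by auto
  then show ?thesis by eventually_elim simp
qed

lemma noise_char:
  assumes "\<phi> \<in> sq_integrable"
  shows "expectation (\<lambda>\<omega>. cos (\<xi> \<phi> \<omega>)) = exp (- (LINT z|spacetime. \<phi> z * \<phi> z) / 2)"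
    "expectation (\<lambda>\<omega>. sin (\<xi> \<phi> \<omega>)) = 0"
  using centered_gaussian_moments(4,5)[OF gaussian[OF assms]] noise_covariance[OF assms assms]
  by (simp_all add: power2_eq_square)

text \<open>Parametrised by a set of test functions, so that the filtration and the noise over a
  region are instances of one construction.\<close>

definition noise_alg :: "(real \<times> real \<Rightarrow> real) set \<Rightarrow> 'a measure" where
  "noise_alg S = sigma (space M) ({\<xi> \<phi> -` B \<inter> space M | \<phi> B. \<phi> \<in> S \<and> B \<in> sets borel} \<union> null_sets M)"

lemma noise_alg_gen_subset:
  assumes "S \<subseteq> sq_integrable"
  shows "{\<xi> \<phi> -` B \<inter> space M | \<phi> B. \<phi> \<in> S \<and> B \<in> sets borel} \<union> null_sets M \<subseteq> sets M"
  using assms by (auto intro!: measurable_sets[OF noise_measurable])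

lemma space_noise_alg[simp]: "space (noise_alg S) = space M"
  by (simp add: noise_alg_def space_measure_of_conv)

lemma sets_noise_alg:
  assumes "S \<subseteq> sq_integrable"
  shows "sets (noise_alg S) = sigma_sets (space M) ({\<xi> \<phi> -` B \<inter> space M | \<phi> B. \<phi> \<in> S \<and> B \<in> sets borel} \<union> null_sets M)"
  unfolding noise_alg_def
  using noise_alg_gen_subset[OF assms] sets.space_closed[of M] by (intro sets_measure_of) blast

lemma noise_alg_subset:
  assumes "S \<subseteq> sq_integrable"
  shows "sets (noise_alg S) \<subseteq> sets M"
  unfolding sets_noise_alg[OF assms] by (rule sets.sigma_sets_subset[OF noise_alg_gen_subset[OF assms]])

lemma subalgebra_noise_alg: "S \<subseteq> sq_integrable \<Longrightarrow> subalgebra M (noise_alg S)"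
  using noise_alg_subset by (simp add: subalgebra_def)

lemma noise_alg_mono:
  assumes "S \<subseteq> T" "T \<subseteq> sq_integrable"
  shows "sets (noise_alg S) \<subseteq> sets (noise_alg T)"
  using assms unfolding sets_noise_alg[OF assms(2)] sets_noise_alg[OF order_trans[OF assms]]
  by (intro sigma_sets_mono') blast

lemma noise_alg_measurable_mono:
  assumes "S \<subseteq> T" "T \<subseteq> sq_integrable" "f \<in> borel_measurable (noise_alg S)"
  shows "f \<in> borel_measurable (noise_alg T)"
  using assms noise_alg_mono[OF assms(1,2)] measurable_mono[of borel borel "noise_alg S" "noise_alg T"] by auto

lemma noise_alg_measurableD:
  assumes "S \<subseteq> sq_integrable" "f \<in> borel_measurable (noise_alg S)"
  shows "f \<in> borel_measurable M"
  using measurable_from_subalg[OF subalgebra_noise_alg[OF assms(1)] assms(2)] .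

lemma noise_measurable_noise_alg:
  assumes "S \<subseteq> sq_integrable" "\<phi> \<in> S"
  shows "\<xi> \<phi> \<in> borel_measurable (noise_alg S)"
proof (rule measurableI)
  fix B :: "real set" assume "B \<in> sets borel"
  then show "\<xi> \<phi> -` B \<inter> space (noise_alg S) \<in> sets (noise_alg S)"
    unfolding sets_noise_alg[OF assms(1)] using assms(2) by (auto intro!: sigma_sets.Basic)
qed simp

lemma noise_filtration_eq:
  "noise_filtration M \<xi> t = noise_alg {\<phi> \<in> sq_integrable. \<forall>s y. t < s \<longrightarrow> \<phi> (s, y) = 0}"
proof -
  have "{\<xi> \<phi> -` B \<inter> space M | \<phi> B. \<phi> \<in> sq_integrable \<and> (\<forall>s y. t < s \<longrightarrow> \<phi> (s, y) = 0) \<and> B \<in> sets borel}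
    = {\<xi> \<phi> -` B \<inter> space M | \<phi> B. \<phi> \<in> {\<phi> \<in> sq_integrable. \<forall>s y. t < s \<longrightarrow> \<phi> (s, y) = 0} \<and> B \<in> sets borel}"
    by auto
  then show ?thesis by (simp add: noise_filtration_def noise_alg_def)
qed

text \<open>The trigonometric factors are replaced by indicators one at a time: the one-dimensional statement
  is applied to \<^term>\<open>h\<close> times a trigonometric function of the remaining noise variables, and the product
  formulas for sine and cosine keep the hypothesis in the same form.\<close>
lemma integral_cylinder_eq_0:
  assumes S: "lin_closed S" and "finite F" "F \<subseteq> S" and B: "\<And>\<phi>. B \<phi> \<in> sets borel"
    and h: "integrable M h"
    and c: "\<And>\<phi>. \<phi> \<in> S \<Longrightarrow> (LINT \<omega>|M. cos (\<xi> \<phi> \<omega>) * h \<omega>) = 0"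
    and s: "\<And>\<phi>. \<phi> \<in> S \<Longrightarrow> (LINT \<omega>|M. sin (\<xi> \<phi> \<omega>) * h \<omega>) = 0"
  shows "(LINT \<omega>|M. (\<Prod>\<phi>\<in>F. indicator (B \<phi>) (\<xi> \<phi> \<omega>)) * h \<omega>) = 0"
  using assms(2,3) h c s
proof (induction F arbitrary: h rule: finite_induct)
  case empty
  \<comment> \<open>The noise of the zero function vanishes almost surely, so its cosine is 1 and
    the hypothesis says that \<open>h\<close> has mean 0.\<close>
  obtain \<phi> where \<phi>: "\<phi> \<in> S" using S by (auto simp: lin_closed_def)
  then have \<phi>': "\<phi> \<in> sq_integrable" and 0: "(\<lambda>z. 0 * \<phi> z + 0 * \<phi> z) \<in> S" using S unfolding lin_closed_def by blast+
  have m[measurable]: "\<xi> (\<lambda>z. 0 * \<phi> z + 0 * \<phi> z) \<in> borel_measurable M"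
    using 0 S by (intro noise_measurable) (auto simp: lin_closed_def)
  have "AE \<omega> in M. \<xi> (\<lambda>z. 0 * \<phi> z + 0 * \<phi> z) \<omega> = 0 * \<xi> \<phi> \<omega> + 0 * \<xi> \<phi> \<omega>" by (rule noise_lin[OF \<phi>' \<phi>'])
  then have "AE \<omega> in M. cos (\<xi> (\<lambda>z. 0 * \<phi> z + 0 * \<phi> z) \<omega>) * h \<omega> = h \<omega>" by eventually_elim simp
  then have "(LINT \<omega>|M. cos (\<xi> (\<lambda>z. 0 * \<phi> z + 0 * \<phi> z) \<omega>) * h \<omega>) = (LINT \<omega>|M. h \<omega>)"
    using m borel_measurable_integrable[OF empty(2)] by (intro integral_cong_AE) auto
  then show ?case using empty(3)[OF 0] by simp
next
  case (insert \<phi> F)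
  note hm = borel_measurable_integrable[OF insert.prems(2), measurable]
  have \<phi>S: "\<phi> \<in> S" and \<phi>: "\<phi> \<in> sq_integrable" using insert.prems S by (auto simp: lin_closed_def)
  note [measurable] = noise_measurable[OF \<phi>] B[of \<phi>]
  have prodint: "integrable M (\<lambda>\<omega>. f \<omega> * g \<omega>)"
    if "integrable M g" "\<And>\<omega>. \<bar>f \<omega>\<bar> \<le> 1" "f \<in> borel_measurable M" for f g :: "'a \<Rightarrow> real"
    by (rule Bochner_Integration.integrable_bound[OF that(1)])
      (use that in \<open>auto simp: abs_mult intro!: AE_I2 mult_left_le_one_le borel_measurable_times\<close>)
  \<comment> \<open>The indicator of the new variable moves into \<open>h\<close>; it remains to
    check that the trigonometric integrals of \<open>h'\<close> vanish too.\<close>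
  define h' where "h' = (\<lambda>\<omega>. indicator (B \<phi>) (\<xi> \<phi> \<omega>) * h \<omega>)"
  have h': "integrable M h'" unfolding h'_def
    by (intro prodint insert.prems) (auto simp: indicator_def)
  have main: "(LINT \<omega>|M. f (\<xi> \<psi> \<omega>) * h' \<omega>) = 0"
    if \<psi>S: "\<psi> \<in> S" and f: "f = cos \<or> f = sin" for \<psi> f
  proof -
    have \<psi>: "\<psi> \<in> sq_integrable" using \<psi>S S by (auto simp: lin_closed_def)
    note [measurable] = noise_measurable[OF \<psi>]
    have [measurable]: "f \<in> borel_measurable borel" using f by auto
    have f1: "\<bar>f x\<bar> \<le> 1" for x using f by auto
    have two: "(LINT \<omega>|M. cos (c * \<xi> \<phi> \<omega> + d * \<xi> \<psi> \<omega>) * h \<omega>) = 0"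
        "(LINT \<omega>|M. sin (c * \<xi> \<phi> \<omega> + d * \<xi> \<psi> \<omega>) * h \<omega>) = 0" for c d
    proof -
      \<comment> \<open>Linear closure keeps the combined argument within the hypotheses on single
        test functions.\<close>
      let ?\<chi> = "\<lambda>z. c * \<phi> z + d * \<psi> z"
      have \<chi>: "?\<chi> \<in> S" using S \<phi>S \<psi>S by (auto simp: lin_closed_def)
      note [measurable] = noise_measurable[OF sq_integrable_lin[OF \<phi> \<psi>], of c d]
      have ae: "AE \<omega> in M. \<xi> ?\<chi> \<omega> = c * \<xi> \<phi> \<omega> + d * \<xi> \<psi> \<omega>" by (rule noise_lin[OF \<phi> \<psi>])
      have "(LINT \<omega>|M. cos (c * \<xi> \<phi> \<omega> + d * \<xi> \<psi> \<omega>) * h \<omega>) = (LINT \<omega>|M. cos (\<xi> ?\<chi> \<omega>) * h \<omega>)"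
        "(LINT \<omega>|M. sin (c * \<xi> \<phi> \<omega> + d * \<xi> \<psi> \<omega>) * h \<omega>) = (LINT \<omega>|M. sin (\<xi> ?\<chi> \<omega>) * h \<omega>)"
        using ae by (intro integral_cong_AE; force)+
      then show "(LINT \<omega>|M. cos (c * \<xi> \<phi> \<omega> + d * \<xi> \<psi> \<omega>) * h \<omega>) = 0"
        "(LINT \<omega>|M. sin (c * \<xi> \<phi> \<omega> + d * \<xi> \<psi> \<omega>) * h \<omega>) = 0"
        using insert.prems(3,4)[OF \<chi>] by auto
    qed
    have int: "integrable M (\<lambda>\<omega>. cos (c * \<xi> \<phi> \<omega> + d * \<xi> \<psi> \<omega>) * h \<omega>)"
      "integrable M (\<lambda>\<omega>. sin (c * \<xi> \<phi> \<omega> + d * \<xi> \<psi> \<omega>) * h \<omega>)" for c d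
      by (intro prodint insert.prems; simp)+
    have z: "(LINT \<omega>|M. cos (c * \<xi> \<phi> \<omega>) * (f (\<xi> \<psi> \<omega>) * h \<omega>)) = 0 \<and> (LINT \<omega>|M. sin (c * \<xi> \<phi> \<omega>) * (f (\<xi> \<psi> \<omega>) * h \<omega>)) = 0" for c
      using f
    proof
      assume "f = cos"
      then have "cos (c * \<xi> \<phi> \<omega>) * (f (\<xi> \<psi> \<omega>) * h \<omega>) = (1/2) * (cos (c * \<xi> \<phi> \<omega> + 1 * \<xi> \<psi> \<omega>) * h \<omega>) + (1/2) * (cos (c * \<xi> \<phi> \<omega> + (-1) * \<xi> \<psi> \<omega>) * h \<omega>)"
        "sin (c * \<xi> \<phi> \<omega>) * (f (\<xi> \<psi> \<omega>) * h \<omega>) = (1/2) * (sin (c * \<xi> \<phi> \<omega> + 1 * \<xi> \<psi> \<omega>) * h \<omega>) + (1/2) * (sin (c * \<xi> \<phi> \<omega> + (-1) * \<xi> \<psi> \<omega>) * h \<omega>)" for \<omega>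
        by (simp_all add: cos_add cos_diff sin_add sin_diff algebra_simps)
      then show ?thesis by (simp only: Bochner_Integration.integral_add int integrable_mult_right integral_mult_right two)
        (use two[of c 1] two[of c "-1"] in simp)
    next
      assume "f = sin"
      then have "cos (c * \<xi> \<phi> \<omega>) * (f (\<xi> \<psi> \<omega>) * h \<omega>) = (1/2) * (sin (c * \<xi> \<phi> \<omega> + 1 * \<xi> \<psi> \<omega>) * h \<omega>) + (-1/2) * (sin (c * \<xi> \<phi> \<omega> + (-1) * \<xi> \<psi> \<omega>) * h \<omega>)"
        "sin (c * \<xi> \<phi> \<omega>) * (f (\<xi> \<psi> \<omega>) * h \<omega>) = (-1/2) * (cos (c * \<xi> \<phi> \<omega> + 1 * \<xi> \<psi> \<omega>) * h \<omega>) + (1/2) * (cos (c * \<xi> \<phi> \<omega> + (-1) * \<xi> \<psi> \<omega>) * h \<omega>)" for \<omega>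
        by (simp_all add: cos_add cos_diff sin_add sin_diff algebra_simps)
      then show ?thesis by (simp only: Bochner_Integration.integral_add int integrable_mult_right integral_mult_right two)
        (use two[of c 1] two[of c "-1"] in simp)
    qed
    have "(LINT \<omega>|M. indicator (B \<phi>) (\<xi> \<phi> \<omega>) * (f (\<xi> \<psi> \<omega>) * h \<omega>)) = 0"
      by (rule integral_indicator_eq_0_if_char_eq_0) (use z in \<open>auto intro!: prodint insert.prems f1\<close>)
    then show ?thesis by (simp add: h'_def mult.left_commute)
  qed
  have "(LINT \<omega>|M. (\<Prod>\<phi>\<in>F. indicator (B \<phi>) (\<xi> \<phi> \<omega>)) * h' \<omega>) = 0"
    using insert.prems main by (intro insert.IH h') auto
  then show ?case using insert.hyps by (simp add: h'_def mult_ac)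
qed

text \<open>The pi-lambda theorem extends the identity from cylinder sets to the generated
  sigma-algebra. This serves both to prove independence over disjoint regions and to identify
  conditional expectations, by testing against sines and cosines only.\<close>

lemma integral_noise_alg_eq_0:
  assumes S: "lin_closed S" and h: "integrable M h"
    and c: "\<And>\<phi>. \<phi> \<in> S \<Longrightarrow> (LINT \<omega>|M. cos (\<xi> \<phi> \<omega>) * h \<omega>) = 0"
    and s: "\<And>\<phi>. \<phi> \<in> S \<Longrightarrow> (LINT \<omega>|M. sin (\<xi> \<phi> \<omega>) * h \<omega>) = 0"
    and G: "G \<in> sets (noise_alg S)"
  shows "(LINT \<omega>|M. indicator G \<omega> * h \<omega>) = 0"
proof -
  have Ssq: "S \<subseteq> sq_integrable" using S by (simp add: lin_closed_def)
  note hm = borel_measurable_integrable[OF h, measurable]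
  have iint: "integrable M (\<lambda>\<omega>. indicator A \<omega> * h \<omega>)" if "A \<in> sets M" for A
    using integrable_mult_indicator[OF that h] by simp
  \<comment> \<open>Cylinder sets up to null sets, so that null sets themselves are included.\<close>
  define cyl_of where "cyl_of = (\<lambda>G F B. finite F \<and> F \<subseteq> S \<and> (\<forall>\<phi>. B \<phi> \<in> sets borel) \<and>
     (AE \<omega> in M. \<omega> \<in> G \<longleftrightarrow> (\<forall>\<phi>\<in>F. \<xi> \<phi> \<omega> \<in> B \<phi>)))"
  define cyl where "cyl = {G \<in> sets M. \<exists>F B. cyl_of G F B}"
  have "Int_stable cyl"
  proof (rule Int_stableI)
    fix G1 G2 assume G12: "G1 \<in> cyl" "G2 \<in> cyl"
    then obtain F1 B1 F2 B2 where 1: "cyl_of G1 F1 B1" and 2: "cyl_of G2 F2 B2"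
      unfolding cyl_def by auto
    \<comment> \<open>A test function that occurs in only one of the two families gets the void
      constraint \<open>UNIV\<close> from the other.\<close>
    define B where "B = (\<lambda>\<phi>. (if \<phi> \<in> F1 then B1 \<phi> else UNIV) \<inter> (if \<phi> \<in> F2 then B2 \<phi> else UNIV))"
    have ae: "AE \<omega> in M. \<omega> \<in> G1 \<longleftrightarrow> (\<forall>\<phi>\<in>F1. \<xi> \<phi> \<omega> \<in> B1 \<phi>)" "AE \<omega> in M. \<omega> \<in> G2 \<longleftrightarrow> (\<forall>\<phi>\<in>F2. \<xi> \<phi> \<omega> \<in> B2 \<phi>)"
      using 1 2 by (auto simp: cyl_of_def)
    have Beq: "(\<forall>\<phi>\<in>F1 \<union> F2. x \<phi> \<in> B \<phi>) \<longleftrightarrow> (\<forall>\<phi>\<in>F1. x \<phi> \<in> B1 \<phi>) \<and> (\<forall>\<phi>\<in>F2. x \<phi> \<in> B2 \<phi>)" for x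
      unfolding B_def by (auto split: if_split_asm)
    have "AE \<omega> in M. \<omega> \<in> G1 \<inter> G2 \<longleftrightarrow> (\<forall>\<phi>\<in>F1 \<union> F2. \<xi> \<phi> \<omega> \<in> B \<phi>)"
      unfolding Beq using ae by eventually_elim simp
    moreover have "\<forall>\<phi>. B \<phi> \<in> sets borel" using 1 2 by (auto simp: B_def cyl_of_def)
    ultimately have "cyl_of (G1 \<inter> G2) (F1 \<union> F2) B" using 1 2 by (simp add: cyl_of_def)
    then show "G1 \<inter> G2 \<in> cyl" using G12 by (auto simp: cyl_def)
  qed
  have cyl_sub: "cyl \<subseteq> sets M" by (auto simp: cyl_def)
  have cyl_zero: "(LINT \<omega>|M. indicator G \<omega> * h \<omega>) = 0" if Gcyl: "G \<in> cyl" for G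
  proof -
    obtain F B where G: "G \<in> sets M" "cyl_of G F B"
      using Gcyl unfolding cyl_def by auto
    then have 1: "G \<in> sets M" "finite F" "F \<subseteq> S" "\<And>\<phi>. B \<phi> \<in> sets borel"
        "AE \<omega> in M. \<omega> \<in> G \<longleftrightarrow> (\<forall>\<phi>\<in>F. \<xi> \<phi> \<omega> \<in> B \<phi>)"
      by (simp_all add: cyl_of_def)
    have m: "(\<lambda>\<omega>. \<Prod>\<phi>\<in>F. indicator (B \<phi>) (\<xi> \<phi> \<omega>) :: real) \<in> borel_measurable M"
    proof (rule borel_measurable_prod)
      fix \<phi> assume "\<phi> \<in> F"
      then have "\<xi> \<phi> \<in> borel_measurable M" using 1(3) Ssq by (intro noise_measurable) auto
      then show "(\<lambda>\<omega>. indicator (B \<phi>) (\<xi> \<phi> \<omega>) :: real) \<in> borel_measurable M"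
        by (rule measurable_compose[OF _ borel_measurable_indicator[OF 1(4)]])
    qed
    have "AE \<omega> in M. indicator G \<omega> * h \<omega> = (\<Prod>\<phi>\<in>F. indicator (B \<phi>) (\<xi> \<phi> \<omega>)) * h \<omega>"
      using 1(5) by eventually_elim (use 1(2) in \<open>auto simp: indicator_def prod_zero_iff split: if_splits\<close>)
    then have "(LINT \<omega>|M. indicator G \<omega> * h \<omega>) = (LINT \<omega>|M. (\<Prod>\<phi>\<in>F. indicator (B \<phi>) (\<xi> \<phi> \<omega>)) * h \<omega>)"
      using 1(1) m by (intro integral_cong_AE) auto
    then show ?thesis using integral_cylinder_eq_0[OF S 1(2,3,4) h c s] by simp
  qed
  \<comment> \<open>The empty family describes the whole space; the resulting mean 0 of
    \<open>h\<close> is what the complement step uses.\<close>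
  have "space M \<in> cyl" unfolding cyl_def cyl_of_def by (auto intro!: exI[of _ "{}"] exI[of _ "\<lambda>_. UNIV"])
  then have h0: "(LINT \<omega>|M. indicator (space M) \<omega> * h \<omega>) = 0" by (rule cyl_zero)
  have "{\<xi> \<phi> -` B \<inter> space M | \<phi> B. \<phi> \<in> S \<and> B \<in> sets borel} \<subseteq> cyl"
  proof safe
    fix \<phi> and B :: "real set" assume "\<phi> \<in> S" "B \<in> sets borel"
    then show "\<xi> \<phi> -` B \<inter> space M \<in> cyl"
      unfolding cyl_def cyl_of_def using Ssq
      by (auto intro!: exI[of _ "{\<phi>}"] exI[of _ "\<lambda>_. B"] measurable_sets[OF noise_measurable])
  qed
  moreover have "null_sets M \<subseteq> cyl"
  proof
    fix N assume N: "N \<in> null_sets M"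
    obtain \<phi> where "\<phi> \<in> S" using S by (auto simp: lin_closed_def)
    \<comment> \<open>The empty target makes the cylinder condition false, so a null set is a
      cylinder set in the almost sure sense.\<close>
    moreover have "AE \<omega> in M. \<omega> \<in> N \<longleftrightarrow> (\<forall>\<psi>\<in>{\<phi>}. \<xi> \<psi> \<omega> \<in> {})"
      using AE_not_in[OF N] by eventually_elim simp
    ultimately show "N \<in> cyl" unfolding cyl_def cyl_of_def using N by (auto intro!: exI[of _ "{\<phi>}"] exI[of _ "\<lambda>_. {}"])
  qed
  ultimately have "sets (noise_alg S) \<subseteq> sigma_sets (space M) cyl"
    unfolding sets_noise_alg[OF Ssq] by (intro sigma_sets_mono') blast
  then have Gs: "G \<in> sigma_sets (space M) cyl" using G by auto
  have sig: "sigma_sets (space M) cyl \<subseteq> sets M" by (rule sets.sigma_sets_subset[OF cyl_sub])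
  have Pow: "cyl \<subseteq> Pow (space M)" using cyl_sub sets.space_closed[of M] by blast
  show ?thesis using \<open>Int_stable cyl\<close> Pow Gs
  proof (induction rule: sigma_sets_induct_disjoint)
    case (basic A)
    then show ?case by (rule cyl_zero)
  next
    case empty
    show ?case by simp
  next
    case (compl A)
    then have A: "A \<in> sets M" using sig by auto
    have "indicator (space M - A) \<omega> * h \<omega> = indicator (space M) \<omega> * h \<omega> - indicator A \<omega> * h \<omega>" for \<omega>
      using sets.sets_into_space[OF A] by (auto simp: indicator_def)
    then show ?case using compl h0 iint[OF A] iint[OF sets.top] by simp
  next
    case (union A)
    then have A: "\<And>i. A i \<in> sets M" using sig by auto
    have "set_lebesgue_integral M (\<Union>i. A i) h = (\<Sum>i. set_lebesgue_integral M (A i) h)"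
      using union(1) A iint[of "\<Union>i. A i"]
      by (intro lebesgue_integral_countable_add) (auto simp: disjoint_family_on_def set_integrable_def)
    then show ?case using union(3) by (simp add: set_lebesgue_integral_def)
  qed
qed

end

section \<open>Independence of the noise over disjoint regions of space-time\<close>

definition supp_in :: "(real \<times> real) set \<Rightarrow> (real \<times> real \<Rightarrow> real) set" where
  "supp_in R = {\<phi> \<in> sq_integrable. \<forall>z. z \<notin> R \<longrightarrow> \<phi> z = 0}"

lemma supp_in_subset: "supp_in R \<subseteq> sq_integrable"
  by (auto simp: supp_in_def)

lemma supp_in_mono: "R \<subseteq> R' \<Longrightarrow> supp_in R \<subseteq> supp_in R'"
  by (auto simp: supp_in_def)

lemma lin_closed_supp_in: "lin_closed (supp_in R)"
  unfolding lin_closed_def supp_in_def using sq_integrable_zero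
  by (auto intro!: sq_integrable_lin)

lemma sq_integrable_restrict:
  assumes "\<phi> \<in> sq_integrable" "C \<in> sets borel"
  shows "(\<lambda>z. \<phi> z * indicator C z) \<in> sq_integrable"
proof -
  have [measurable]: "\<phi> \<in> borel_measurable spacetime" "C \<in> sets borel"
    using assms by (auto simp: sq_integrable_def)
  have [measurable]: "indicator C \<in> borel_measurable spacetime"
    unfolding spacetime_def by (intro measurable_restrict_space1) simp
  have "integrable spacetime (\<lambda>z. (\<phi> z * indicator C z)\<^sup>2)"
  proof (rule Bochner_Integration.integrable_bound)
    show "integrable spacetime (\<lambda>z. (\<phi> z)\<^sup>2)" using assms by (simp add: sq_integrable_def)
    show "(\<lambda>z. (\<phi> z * indicator C z)\<^sup>2) \<in> borel_measurable spacetime" by measurable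
  qed (auto simp: indicator_def intro!: AE_I2)
  then show ?thesis by (simp add: sq_integrable_def)
qed

lemma supp_in_restrict:
  assumes "\<phi> \<in> supp_in R" "C \<in> sets borel"
  shows "(\<lambda>z. \<phi> z * indicator C z) \<in> supp_in (R \<inter> C)"
  using assms sq_integrable_restrict[of \<phi> C] by (auto simp: supp_in_def)

lemma integral_supp_in_disjoint:
  assumes "\<phi> \<in> supp_in R" "\<psi> \<in> supp_in R'" "R \<inter> R' = {}"
  shows "(LINT z|spacetime. \<phi> z * \<psi> z) = 0"
proof -
  have "\<phi> z * \<psi> z = 0" for z
  proof (cases "z \<in> R")
    case True
    then have "z \<notin> R'" using assms(3) by auto
    with True show ?thesis using assms(2) by (auto simp: supp_in_def simp del: split_paired_All)
  next
    case False
    then show ?thesis using assms(1) False by (auto simp: supp_in_def simp del: split_paired_All)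
  qed
  then have "(\<lambda>z. \<phi> z * \<psi> z) = (\<lambda>_. 0)" by (intro ext)
  then show ?thesis by simp
qed

lemma halfplane_borel[simp]: "{..a::real} \<times> (UNIV :: real set) \<in> sets borel" "{a<..} \<times> (UNIV :: real set) \<in> sets borel"
  using borel_closed[OF closed_Times[OF closed_atMost[of a] closed_UNIV]]
    borel_open[OF open_Times[OF open_greaterThan[of a] open_UNIV]] by auto

context noise begin

abbreviation alg :: "(real \<times> real) set \<Rightarrow> 'a measure" where
  "alg R \<equiv> noise_alg (supp_in R)"

lemma noise_filtration_alg: "noise_filtration M \<xi> t = alg ({..t} \<times> UNIV)"
  unfolding noise_filtration_eq supp_in_def
  by (rule arg_cong[where f=noise_alg]) (auto simp: not_le)

lemma alg_measurable_mono: "R \<subseteq> R' \<Longrightarrow> f \<in> borel_measurable (alg R) \<Longrightarrow> f \<in> borel_measurable (alg R')"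
  by (rule noise_alg_measurable_mono[OF supp_in_mono supp_in_subset])

lemma alg_measurableD: "f \<in> borel_measurable (alg R) \<Longrightarrow> f \<in> borel_measurable M"
  by (rule noise_alg_measurableD[OF supp_in_subset])

lemma noise_measurable_alg: "\<phi> \<in> supp_in R \<Longrightarrow> \<xi> \<phi> \<in> borel_measurable (alg R)"
  by (rule noise_measurable_noise_alg[OF supp_in_subset])

lemma subalgebra_alg: "subalgebra M (alg R)"
  by (rule subalgebra_noise_alg[OF supp_in_subset])

lemma finite_measure_subalgebra_alg: "finite_measure_subalgebra M (alg R)"
  by (intro finite_measure_subalgebra.intro finite_measure_subalgebra_axioms.intro subalgebra_alg finite_measure_axioms)

text \<open>Disjoint regions make the test functions orthogonal, so with \<open>d\<close> of modulus
  1 the variances add and the Gaussian characteristic function factorises. Both signs of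
  \<open>d\<close> enter the product-to-sum formulas.\<close>

lemma noise_char_pair:
  assumes \<phi>: "\<phi> \<in> supp_in R" and \<psi>: "\<psi> \<in> supp_in R'" and R: "R \<inter> R' = {}" and d: "\<bar>d\<bar> = 1"
  shows "expectation (\<lambda>\<omega>. cos (\<xi> \<phi> \<omega> + d * \<xi> \<psi> \<omega>)) = expectation (\<lambda>\<omega>. cos (\<xi> \<phi> \<omega>)) * expectation (\<lambda>\<omega>. cos (\<xi> \<psi> \<omega>))"
    "expectation (\<lambda>\<omega>. sin (\<xi> \<phi> \<omega> + d * \<xi> \<psi> \<omega>)) = 0"
proof -
  have \<phi>': "\<phi> \<in> sq_integrable" and \<psi>': "\<psi> \<in> sq_integrable" using \<phi> \<psi> supp_in_subset by auto
  define \<rho> where "\<rho> = (\<lambda>z. 1 * \<phi> z + d * \<psi> z)"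
  have \<rho>: "\<rho> \<in> sq_integrable" unfolding \<rho>_def by (rule sq_integrable_lin[OF \<phi>' \<psi>'])
  note [measurable] = noise_measurable[OF \<rho>] noise_measurable[OF \<phi>'] noise_measurable[OF \<psi>']
  have ae: "AE \<omega> in M. \<xi> \<rho> \<omega> = \<xi> \<phi> \<omega> + d * \<xi> \<psi> \<omega>" using noise_lin[OF \<phi>' \<psi>', of 1 d] by (simp add: \<rho>_def)
  have "expectation (\<lambda>\<omega>. cos (\<xi> \<phi> \<omega> + d * \<xi> \<psi> \<omega>)) = expectation (\<lambda>\<omega>. cos (\<xi> \<rho> \<omega>))"
    "expectation (\<lambda>\<omega>. sin (\<xi> \<phi> \<omega> + d * \<xi> \<psi> \<omega>)) = expectation (\<lambda>\<omega>. sin (\<xi> \<rho> \<omega>))"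
    by (intro integral_cong_AE; use ae in force)+
  moreover have "(LINT z|spacetime. \<rho> z * \<rho> z) = (LINT z|spacetime. \<phi> z * \<phi> z) + (LINT z|spacetime. \<psi> z * \<psi> z)"
  proof -
    have d2: "d * d = 1" using d by (metis abs_mult_self_eq mult_1)
    have "(LINT z|spacetime. \<rho> z * \<rho> z) = (LINT z|spacetime. \<phi> z * \<phi> z + (2 * d) * (\<phi> z * \<psi> z) + (d * d) * (\<psi> z * \<psi> z))"
      by (intro Bochner_Integration.integral_cong) (simp_all add: \<rho>_def algebra_simps)
    also have "\<dots> = (LINT z|spacetime. \<phi> z * \<phi> z) + (LINT z|spacetime. \<psi> z * \<psi> z)"
      using sq_integrable_mult[OF \<phi>' \<phi>'] sq_integrable_mult[OF \<phi>' \<psi>'] sq_integrable_mult[OF \<psi>' \<psi>']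
        integral_supp_in_disjoint[OF \<phi> \<psi> R] d2 by simp
    finally show ?thesis .
  qed
  ultimately show "expectation (\<lambda>\<omega>. cos (\<xi> \<phi> \<omega> + d * \<xi> \<psi> \<omega>)) = expectation (\<lambda>\<omega>. cos (\<xi> \<phi> \<omega>)) * expectation (\<lambda>\<omega>. cos (\<xi> \<psi> \<omega>))"
    "expectation (\<lambda>\<omega>. sin (\<xi> \<phi> \<omega> + d * \<xi> \<psi> \<omega>)) = 0"
    using noise_char[OF \<phi>'] noise_char[OF \<psi>'] noise_char[OF \<rho>]
    by (simp_all add: exp_add[symmetric] add_divide_distrib)
qed

lemma integrable_bounded_mult:
  fixes f g :: "'a \<Rightarrow> real"
  assumes "AE \<omega> in M. \<bar>f \<omega>\<bar> \<le> C" "f \<in> borel_measurable M" "integrable M g"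
  shows "integrable M (\<lambda>\<omega>. f \<omega> * g \<omega>)"
proof (rule Bochner_Integration.integrable_bound)
  show "integrable M (\<lambda>\<omega>. C * g \<omega>)" using assms by simp
  show "(\<lambda>\<omega>. f \<omega> * g \<omega>) \<in> borel_measurable M" using assms by auto
  show "AE \<omega> in M. norm (f \<omega> * g \<omega>) \<le> norm (C * g \<omega>)"
    using assms(1) by eventually_elim (auto simp: abs_mult intro!: mult_right_mono)
qed

text \<open>Product-to-sum formulas reduce the claim to \<open>noise_char_pair\<close>. The second
  factor is centred so that the result can serve as a hypothesis of
  \<open>integral_noise_alg_eq_0\<close>.\<close>

lemma noise_trig_uncorrelated:
  assumes \<phi>: "\<phi> \<in> supp_in R" and \<psi>: "\<psi> \<in> supp_in R'" and R: "R \<inter> R' = {}"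
    and f: "f = cos \<or> f = sin" and g: "g = cos \<or> g = sin"
  shows "expectation (\<lambda>\<omega>. f (\<xi> \<phi> \<omega>) * (g (\<xi> \<psi> \<omega>) - expectation (\<lambda>\<omega>. g (\<xi> \<psi> \<omega>)))) = 0"
proof -
  have \<phi>': "\<phi> \<in> sq_integrable" and \<psi>': "\<psi> \<in> sq_integrable" using \<phi> \<psi> supp_in_subset by auto
  note [measurable] = noise_measurable[OF \<phi>'] noise_measurable[OF \<psi>']
  have [measurable]: "f \<in> borel_measurable borel" "g \<in> borel_measurable borel" using f g by auto
  have b: "\<bar>f x\<bar> \<le> 1" "\<bar>g x\<bar> \<le> 1" for x using f g by auto
  have int: "integrable M (\<lambda>\<omega>. cos (\<xi> \<phi> \<omega> + d * \<xi> \<psi> \<omega>))" "integrable M (\<lambda>\<omega>. sin (\<xi> \<phi> \<omega> + d * \<xi> \<psi> \<omega>))" for d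
    by (auto intro!: integrable_const_bound[where B=1])
  have if1: "integrable M (\<lambda>\<omega>. f (\<xi> \<phi> \<omega>))" "integrable M (\<lambda>\<omega>. g (\<xi> \<psi> \<omega>))"
    by (auto intro!: integrable_const_bound[where B=1] b)
  have ifg: "integrable M (\<lambda>\<omega>. f (\<xi> \<phi> \<omega>) * g (\<xi> \<psi> \<omega>))"
    by (rule integrable_bounded_mult[where C=1]) (auto intro!: if1 b)
  note two = noise_char_pair[OF \<phi> \<psi> R]
  have "expectation (\<lambda>\<omega>. f (\<xi> \<phi> \<omega>) * g (\<xi> \<psi> \<omega>)) = expectation (\<lambda>\<omega>. f (\<xi> \<phi> \<omega>)) * expectation (\<lambda>\<omega>. g (\<xi> \<psi> \<omega>))"
    using f g
  proof (elim disjE)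
    assume fg: "f = cos" "g = cos"
    have "f (\<xi> \<phi> \<omega>) * g (\<xi> \<psi> \<omega>) = (1/2) * cos (\<xi> \<phi> \<omega> + 1 * \<xi> \<psi> \<omega>) + (1/2) * cos (\<xi> \<phi> \<omega> + (-1) * \<xi> \<psi> \<omega>)" for \<omega>
      by (simp add: fg cos_add cos_diff algebra_simps)
    then show ?thesis
      by (simp only: Bochner_Integration.integral_add int integrable_mult_right integral_mult_right) (use fg two[of 1] two[of "-1"] in simp)
  next
    assume fg: "f = cos" "g = sin"
    have "f (\<xi> \<phi> \<omega>) * g (\<xi> \<psi> \<omega>) = (1/2) * sin (\<xi> \<phi> \<omega> + 1 * \<xi> \<psi> \<omega>) + (-1/2) * sin (\<xi> \<phi> \<omega> + (-1) * \<xi> \<psi> \<omega>)" for \<omega>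
      by (simp add: fg sin_add sin_diff algebra_simps)
    then show ?thesis
      by (simp only: Bochner_Integration.integral_add int integrable_mult_right integral_mult_right) (use fg two[of 1] two[of "-1"] noise_char(2)[OF \<psi>'] in simp)
  next
    assume fg: "f = sin" "g = cos"
    have "f (\<xi> \<phi> \<omega>) * g (\<xi> \<psi> \<omega>) = (1/2) * sin (\<xi> \<phi> \<omega> + 1 * \<xi> \<psi> \<omega>) + (1/2) * sin (\<xi> \<phi> \<omega> + (-1) * \<xi> \<psi> \<omega>)" for \<omega>
      by (simp add: fg sin_add sin_diff algebra_simps)
    then show ?thesis
      by (simp only: Bochner_Integration.integral_add int integrable_mult_right integral_mult_right) (use fg two[of 1] two[of "-1"] noise_char(2)[OF \<phi>'] in simp)
  next
    assume fg: "f = sin" "g = sin"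
    have "f (\<xi> \<phi> \<omega>) * g (\<xi> \<psi> \<omega>) = (-1/2) * cos (\<xi> \<phi> \<omega> + 1 * \<xi> \<psi> \<omega>) + (1/2) * cos (\<xi> \<phi> \<omega> + (-1) * \<xi> \<psi> \<omega>)" for \<omega>
      by (simp add: fg cos_add cos_diff algebra_simps)
    then show ?thesis
      by (simp only: Bochner_Integration.integral_add int integrable_mult_right integral_mult_right) (use fg two[of 1] two[of "-1"] noise_char(2)[OF \<phi>'] in simp)
  qed
  then show ?thesis using ifg if1 by (simp add: right_diff_distrib)
qed

text \<open>\<open>integral_noise_alg_eq_0\<close> is used twice: a centred trigonometric variable
  over \<open>R'\<close> is orthogonal to \<open>G\<close>, and therefore the centred indicator of
  \<open>G\<close> is orthogonal to \<open>H\<close>.\<close>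

lemma alg_indep_prob:
  assumes R: "R \<inter> R' = {}" and G: "G \<in> sets (alg R)" and H: "H \<in> sets (alg R')"
  shows "prob (G \<inter> H) = prob G * prob H"
proof -
  have [measurable]: "G \<in> sets M" "H \<in> sets M"
    using G H noise_alg_subset[OF supp_in_subset] by auto
  have iG: "integrable M (indicator G :: 'a \<Rightarrow> real)" "integrable M (\<lambda>\<omega>. indicator G \<omega> - prob G)"
    using emeasure_finite by (auto intro!: integrable_real_indicator simp: less_top[symmetric])
  have *: "expectation (\<lambda>\<omega>. g (\<xi> \<psi> \<omega>) * (indicator G \<omega> - prob G)) = 0"
    if \<psi>: "\<psi> \<in> supp_in R'" and g: "g = cos \<or> g = sin" for \<psi> g
  proof -
    have [measurable]: "g \<in> borel_measurable borel" using g by auto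
    have \<psi>': "\<psi> \<in> sq_integrable" using \<psi> supp_in_subset by auto
    note [measurable] = noise_measurable[OF \<psi>']
    have ig: "integrable M (\<lambda>\<omega>. g (\<xi> \<psi> \<omega>))" using g by (intro integrable_const_bound[where B=1]) auto
    have "expectation (\<lambda>\<omega>. indicator G \<omega> * (g (\<xi> \<psi> \<omega>) - expectation (\<lambda>\<omega>. g (\<xi> \<psi> \<omega>)))) = 0"
      using noise_trig_uncorrelated[OF _ \<psi> R _ g] ig
      by (intro integral_noise_alg_eq_0[OF lin_closed_supp_in _ _ _ G]) auto
    moreover have "integrable M (\<lambda>\<omega>. indicator G \<omega> * g (\<xi> \<psi> \<omega>))"
      by (rule integrable_bounded_mult[where C=1]) (auto intro!: ig)
    ultimately show ?thesis using ig iG by (simp add: right_diff_distrib mult.commute)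
  qed
  have "expectation (\<lambda>\<omega>. indicator H \<omega> * (indicator G \<omega> - prob G)) = 0"
    by (rule integral_noise_alg_eq_0[OF lin_closed_supp_in iG(2) _ _ H]) (auto intro!: *)
  moreover have "indicator H \<omega> * (indicator G \<omega> - prob G) = indicator (G \<inter> H) \<omega> - prob G * indicator H \<omega>" for \<omega>
    by (auto simp: indicator_def)
  moreover have "integrable M (indicator (G \<inter> H) :: 'a \<Rightarrow> real)" "integrable M (indicator H :: 'a \<Rightarrow> real)"
    using emeasure_finite by (auto intro!: integrable_real_indicator simp: less_top[symmetric])
  ultimately show ?thesis by simp
qed

lemma alg_indep:
  fixes X Y :: "'a \<Rightarrow> real"
  assumes R: "R \<inter> R' = {}" and X: "X \<in> borel_measurable (alg R)" "integrable M X"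
    and Y: "Y \<in> borel_measurable (alg R')" "integrable M Y"
  shows "integrable M (\<lambda>\<omega>. X \<omega> * Y \<omega>)" "expectation (\<lambda>\<omega>. X \<omega> * Y \<omega>) = expectation X * expectation Y"
proof -
  have sub: "sigma_sets (space M) {X -` A \<inter> space M |A. A \<in> sets borel} \<subseteq> sets (alg R)"
    "sigma_sets (space M) {Y -` A \<inter> space M |A. A \<in> sets borel} \<subseteq> sets (alg R')"
    using measurable_sets[OF X(1)] measurable_sets[OF Y(1)]
    by (auto intro!: sets.sigma_sets_subset[of _ "alg R", simplified] sets.sigma_sets_subset[of _ "alg R'", simplified])
  have "indep_var borel X borel Y"
    unfolding indep_var_eq
  proof (intro conjI indep_setI)
    show "random_variable borel X" "random_variable borel Y" using X Y alg_measurableD by auto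
    show "sigma_sets (space M) {X -` A \<inter> space M |A. A \<in> sets borel} \<subseteq> events"
      "sigma_sets (space M) {Y -` A \<inter> space M |A. A \<in> sets borel} \<subseteq> events"
      using sub noise_alg_subset[OF supp_in_subset] by blast+
    fix a b assume "a \<in> sigma_sets (space M) {X -` A \<inter> space M |A. A \<in> sets borel}"
      "b \<in> sigma_sets (space M) {Y -` A \<inter> space M |A. A \<in> sets borel}"
    then show "prob (a \<inter> b) = prob a * prob b" using sub by (intro alg_indep_prob[OF R]) auto
  qed
  then show "integrable M (\<lambda>\<omega>. X \<omega> * Y \<omega>)" "expectation (\<lambda>\<omega>. X \<omega> * Y \<omega>) = expectation X * expectation Y"
    using indep_var_integrable indep_var_lebesgue_integral X(2) Y(2) by auto
qed

lemma noise_split: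
  assumes "\<phi> \<in> sq_integrable" "C \<in> sets borel"
  shows "AE \<omega> in M. \<xi> \<phi> \<omega> = \<xi> (\<lambda>z. \<phi> z * indicator C z) \<omega> + \<xi> (\<lambda>z. \<phi> z * indicator (- C) z) \<omega>"
proof -
  have "- C \<in> sets borel" using assms(2) by (simp add: borel_comp)
  moreover have "(\<lambda>z. 1 * (\<phi> z * indicator C z) + 1 * (\<phi> z * indicator (- C) z)) = \<phi>"
    by (auto simp: indicator_def)
  ultimately show ?thesis
    using noise_lin[OF sq_integrable_restrict[OF assms] sq_integrable_restrict[OF assms(1)], of "- C" 1 1] by simp
qed

text \<open>Noise over \<open>A\<close> after time \<open>a\<close> is independent of everything up
  to \<open>a\<close>, so it adds no information on \<open>X\<close>. This keeps projected
  coefficients adapted, as the isometry requires. The proof tests \<open>X - Y\<close> against sines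
  and cosines of noise over \<open>A\<close>, split at time \<open>a\<close> by the addition
  theorems.\<close>

lemma cond_exp_past:
  assumes X: "X \<in> borel_measurable (alg ({..a} \<times> UNIV))" "integrable M X"
  shows "AE \<omega> in M. real_cond_exp M (alg (UNIV \<times> A)) X \<omega> = real_cond_exp M (alg ({..a} \<times> A)) X \<omega>"
proof -
  interpret past: finite_measure_subalgebra M "alg ({..a} \<times> A)" by (rule finite_measure_subalgebra_alg)
  interpret full: finite_measure_subalgebra M "alg (UNIV \<times> A)" by (rule finite_measure_subalgebra_alg)
  define Y where "Y = real_cond_exp M (alg ({..a} \<times> A)) X"
  have Ym: "Y \<in> borel_measurable (alg ({..a} \<times> A))" unfolding Y_def by simp
  have Yi: "integrable M Y" unfolding Y_def using X by (intro past.real_cond_exp_int)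
  have Ym': "Y \<in> borel_measurable (alg ({..a} \<times> UNIV))" "Y \<in> borel_measurable (alg (UNIV \<times> A))"
    by (rule alg_measurable_mono[OF _ Ym]; auto)+
  have XM[measurable]: "X \<in> borel_measurable M" "Y \<in> borel_measurable M" using X Yi by auto
  have main: "expectation (\<lambda>\<omega>. indicator G \<omega> * (X \<omega> - Y \<omega>)) = 0" if G: "G \<in> sets (alg (UNIV \<times> A))" for G
  proof (rule integral_noise_alg_eq_0[OF lin_closed_supp_in _ _ _ G])
    show i: "integrable M (\<lambda>\<omega>. X \<omega> - Y \<omega>)" using X Yi by auto
    have hm: "(\<lambda>\<omega>. X \<omega> - Y \<omega>) \<in> borel_measurable (alg ({..a} \<times> UNIV))" using X Ym' by auto
    fix \<phi> assume \<phi>: "\<phi> \<in> supp_in (UNIV \<times> A)"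
    then have \<phi>sq: "\<phi> \<in> sq_integrable" using supp_in_subset by auto
    define C where "C = {..a} \<times> (UNIV :: real set)"
    have C: "C \<in> sets borel" "- C \<in> sets borel" by (auto simp: C_def borel_comp)
    define p where "p = \<xi> (\<lambda>z. \<phi> z * indicator C z)"
    define q where "q = \<xi> (\<lambda>z. \<phi> z * indicator (- C) z)"
    have "(\<lambda>z. \<phi> z * indicator C z) \<in> supp_in ({..a} \<times> A)" "(\<lambda>z. \<phi> z * indicator C z) \<in> supp_in ({..a} \<times> UNIV)"
      "(\<lambda>z. \<phi> z * indicator (- C) z) \<in> supp_in ({a<..} \<times> UNIV)"
      using supp_in_restrict[OF \<phi> C(1)] supp_in_restrict[OF \<phi> C(2)] by (auto simp: supp_in_def C_def)
    then have pm: "p \<in> borel_measurable (alg ({..a} \<times> A))" "p \<in> borel_measurable (alg ({..a} \<times> UNIV))"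
      and qm: "q \<in> borel_measurable (alg ({a<..} \<times> UNIV))"
      by (auto simp: p_def q_def intro!: noise_measurable_alg)
    note [measurable] = alg_measurableD[OF pm(1)] alg_measurableD[OF qm] noise_measurable[OF \<phi>sq]
    have ae: "AE \<omega> in M. \<xi> \<phi> \<omega> = p \<omega> + q \<omega>" unfolding p_def q_def by (rule noise_split[OF \<phi>sq C(1)])
    have z: "expectation (\<lambda>\<omega>. f (p \<omega>) * (X \<omega> - Y \<omega>)) = 0"
       "integrable M (\<lambda>\<omega>. f (p \<omega>) * (X \<omega> - Y \<omega>))"
      if f: "f = cos \<or> f = sin" for f
    proof -
      have fm[measurable]: "f \<in> borel_measurable borel" using f by auto
      have int: "integrable M (\<lambda>\<omega>. f (p \<omega>) * X \<omega>)"  "integrable M (\<lambda>\<omega>. f (p \<omega>) * Y \<omega>)"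
        using f X Yi by (auto intro!: integrable_bounded_mult[where C=1])
      have "(\<lambda>\<omega>. f (p \<omega>)) \<in> borel_measurable (alg ({..a} \<times> A))"
        using measurable_compose[OF pm(1) fm] .
      then have "expectation (\<lambda>\<omega>. f (p \<omega>) * Y \<omega>) = expectation (\<lambda>\<omega>. f (p \<omega>) * X \<omega>)"
        unfolding Y_def by (intro past.real_cond_exp_intg int) auto
      then show "expectation (\<lambda>\<omega>. f (p \<omega>) * (X \<omega> - Y \<omega>)) = 0"
       "integrable M (\<lambda>\<omega>. f (p \<omega>) * (X \<omega> - Y \<omega>))" using int by (simp_all add: right_diff_distrib)
    qed
    \<comment> \<open>The first factor is known at time \<open>a\<close> and has mean 0 by the
      defining property of \<open>Y\<close>; the factor \<open>g (q \<omega>)\<close> depends on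
      later noise and is independent of it.\<close>
    have zz: "expectation (\<lambda>\<omega>. (f (p \<omega>) * (X \<omega> - Y \<omega>)) * g (q \<omega>)) = 0"
       "integrable M (\<lambda>\<omega>. (f (p \<omega>) * (X \<omega> - Y \<omega>)) * g (q \<omega>))"
      if f: "f = cos \<or> f = sin" and g: "g = cos \<or> g = sin" for f g
    proof -
      have fm: "f \<in> borel_measurable borel" and gm[measurable]: "g \<in> borel_measurable borel" using f g by auto
      have 1: "(\<lambda>\<omega>. f (p \<omega>) * (X \<omega> - Y \<omega>)) \<in> borel_measurable (alg ({..a} \<times> UNIV))"
        using measurable_compose[OF pm(2) fm] hm by auto
      have 2: "(\<lambda>\<omega>. g (q \<omega>)) \<in> borel_measurable (alg ({a<..} \<times> UNIV))" "integrable M (\<lambda>\<omega>. g (q \<omega>))"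
        using measurable_compose[OF qm gm] g by (auto intro!: integrable_const_bound[where B=1])
      have "({..a} \<times> (UNIV::real set)) \<inter> ({a<..} \<times> UNIV) = {}" by auto
      from alg_indep[OF this 1 z(2)[OF f] 2]
      show "expectation (\<lambda>\<omega>. (f (p \<omega>) * (X \<omega> - Y \<omega>)) * g (q \<omega>)) = 0"
       "integrable M (\<lambda>\<omega>. (f (p \<omega>) * (X \<omega> - Y \<omega>)) * g (q \<omega>))" using z(1)[OF f] by auto
    qed
    have "expectation (\<lambda>\<omega>. cos (\<xi> \<phi> \<omega>) * (X \<omega> - Y \<omega>)) = expectation (\<lambda>\<omega>.
       (cos (p \<omega>) * (X \<omega> - Y \<omega>)) * cos (q \<omega>) - (sin (p \<omega>) * (X \<omega> - Y \<omega>)) * sin (q \<omega>))"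
      using ae by (intro integral_cong_AE) (auto simp: cos_add algebra_simps)
    then show "expectation (\<lambda>\<omega>. cos (\<xi> \<phi> \<omega>) * (X \<omega> - Y \<omega>)) = 0"
      using zz[of cos cos] zz[of sin sin] by (simp del: Bochner_Integration.integral_mult_left)
    have "expectation (\<lambda>\<omega>. sin (\<xi> \<phi> \<omega>) * (X \<omega> - Y \<omega>)) = expectation (\<lambda>\<omega>.
       (sin (p \<omega>) * (X \<omega> - Y \<omega>)) * cos (q \<omega>) + (cos (p \<omega>) * (X \<omega> - Y \<omega>)) * sin (q \<omega>))"
      using ae by (intro integral_cong_AE) (auto simp: sin_add algebra_simps)
    then show "expectation (\<lambda>\<omega>. sin (\<xi> \<phi> \<omega>) * (X \<omega> - Y \<omega>)) = 0"
      using zz[of cos sin] zz[of sin cos] by simp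
  qed
  have "AE \<omega> in M. real_cond_exp M (alg (UNIV \<times> A)) X \<omega> = Y \<omega>"
  proof (rule full.real_cond_exp_charact)
    fix G assume G: "G \<in> sets (alg (UNIV \<times> A))"
    then have "G \<in> sets M" using noise_alg_subset[OF supp_in_subset] by auto
    then have "integrable M (\<lambda>\<omega>. indicator G \<omega> * X \<omega>)" "integrable M (\<lambda>\<omega>. indicator G \<omega> * Y \<omega>)"
      using integrable_mult_indicator[of G M X] integrable_mult_indicator[of G M Y] X Yi by auto
    then show "(\<integral>x\<in>G. X x \<partial>M) = (\<integral>x\<in>G. Y x \<partial>M)"
      using main[OF G] by (simp add: set_lebesgue_integral_def right_diff_distrib)
  qed (use X Yi Ym' in auto)
  then show ?thesis by (simp add: Y_def)
qed

text \<open>Cutting \<open>\<phi>\<close> at time \<open>a\<close> makes the isometry below a sum over pairs, without passing to a common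
  refinement of the rectangles of an elementary field.\<close>
lemma noise_pair_expectation:
  assumes V: "V \<in> borel_measurable (alg ({..a} \<times> UNIV))" "AE \<omega> in M. \<bar>V \<omega>\<bar> \<le> C"
    and \<phi>: "\<phi> \<in> sq_integrable" and \<psi>: "\<psi> \<in> supp_in ({a<..} \<times> UNIV)"
  shows "integrable M (\<lambda>\<omega>. V \<omega> * (\<xi> \<phi> \<omega> * \<xi> \<psi> \<omega>))"
    "expectation (\<lambda>\<omega>. V \<omega> * (\<xi> \<phi> \<omega> * \<xi> \<psi> \<omega>)) = expectation V * (LINT z|spacetime. \<phi> z * \<psi> z)"
proof -
  have \<psi>sq: "\<psi> \<in> sq_integrable" using \<psi> supp_in_subset by auto
  note [measurable] = alg_measurableD[OF V(1)]
  have iV: "integrable M V" using V(2) by (intro integrable_const_bound[where B=C]) auto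
  define D where "D = {..a} \<times> (UNIV :: real set)"
  have D: "D \<in> sets borel" "- D \<in> sets borel" by (auto simp: D_def borel_comp)
  define \<phi>1 where "\<phi>1 = (\<lambda>z. \<phi> z * indicator D z)"
  define \<phi>2 where "\<phi>2 = (\<lambda>z. \<phi> z * indicator (- D) z)"
  have s: "\<phi>1 \<in> sq_integrable" "\<phi>2 \<in> sq_integrable"
    using sq_integrable_restrict[OF \<phi>] D by (auto simp: \<phi>1_def \<phi>2_def)
  then have s': "\<phi>1 \<in> supp_in ({..a} \<times> UNIV)" "\<phi>2 \<in> supp_in ({a<..} \<times> UNIV)"
    by (auto simp: supp_in_def \<phi>1_def \<phi>2_def D_def)
  note [measurable] = noise_measurable[OF s(1)] noise_measurable[OF s(2)] noise_measurable[OF \<phi>] noise_measurable[OF \<psi>sq]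
  have ae: "AE \<omega> in M. \<xi> \<phi> \<omega> = \<xi> \<phi>1 \<omega> + \<xi> \<phi>2 \<omega>" unfolding \<phi>1_def \<phi>2_def by (rule noise_split[OF \<phi> D(1)])
  show int: "integrable M (\<lambda>\<omega>. V \<omega> * (\<xi> \<phi> \<omega> * \<xi> \<psi> \<omega>))"
    by (rule integrable_bounded_mult[OF V(2)]) (auto intro!: noise_mult_integrable \<phi> \<psi>sq)
  have disj: "({..a} \<times> (UNIV::real set)) \<inter> ({a<..} \<times> UNIV) = {}" by auto
  \<comment> \<open>The part of \<open>\<phi>\<close> before \<open>a\<close> drops out: together
    with \<open>V\<close> it is independent of the centred variable
    \<open>\<xi> \<psi>\<close>.\<close>
  have 1: "integrable M (\<lambda>\<omega>. (V \<omega> * \<xi> \<phi>1 \<omega>) * \<xi> \<psi> \<omega>)" "expectation (\<lambda>\<omega>. (V \<omega> * \<xi> \<phi>1 \<omega>) * \<xi> \<psi> \<omega>) = 0"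
  proof -
    have "integrable M (\<lambda>\<omega>. V \<omega> * \<xi> \<phi>1 \<omega>)"
      by (rule integrable_bounded_mult[OF V(2)]) (auto intro!: noise_integrable s)
    moreover have "(\<lambda>\<omega>. V \<omega> * \<xi> \<phi>1 \<omega>) \<in> borel_measurable (alg ({..a} \<times> UNIV))"
      using V(1) noise_measurable_alg[OF s'(1)] by auto
    ultimately show "integrable M (\<lambda>\<omega>. (V \<omega> * \<xi> \<phi>1 \<omega>) * \<xi> \<psi> \<omega>)" "expectation (\<lambda>\<omega>. (V \<omega> * \<xi> \<phi>1 \<omega>) * \<xi> \<psi> \<omega>) = 0"
      using alg_indep[OF disj _ _ noise_measurable_alg[OF \<psi>] noise_integrable[OF \<psi>sq]] noise_expectation[OF \<psi>sq]
      by auto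
  qed
  have 2: "integrable M (\<lambda>\<omega>. V \<omega> * (\<xi> \<phi>2 \<omega> * \<xi> \<psi> \<omega>))"
    "expectation (\<lambda>\<omega>. V \<omega> * (\<xi> \<phi>2 \<omega> * \<xi> \<psi> \<omega>)) = expectation V * (LINT z|spacetime. \<phi>2 z * \<psi> z)"
  proof -
    have "(\<lambda>\<omega>. \<xi> \<phi>2 \<omega> * \<xi> \<psi> \<omega>) \<in> borel_measurable (alg ({a<..} \<times> UNIV))"
      using noise_measurable_alg[OF s'(2)] noise_measurable_alg[OF \<psi>] by auto
    then show "integrable M (\<lambda>\<omega>. V \<omega> * (\<xi> \<phi>2 \<omega> * \<xi> \<psi> \<omega>))"
      "expectation (\<lambda>\<omega>. V \<omega> * (\<xi> \<phi>2 \<omega> * \<xi> \<psi> \<omega>)) = expectation V * (LINT z|spacetime. \<phi>2 z * \<psi> z)"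
      using alg_indep[OF disj V(1) iV _ noise_mult_integrable[OF s(2) \<psi>sq]] noise_covariance[OF s(2) \<psi>sq]
      by auto
  qed
  \<comment> \<open>\<open>\<psi>\<close> vanishes up to time \<open>a\<close>, so cutting
    \<open>\<phi>\<close> there does not change the inner product.\<close>
  have "(\<lambda>z. \<phi>2 z * \<psi> z) = (\<lambda>z. \<phi> z * \<psi> z)"
    using \<psi> by (intro ext) (auto simp: \<phi>2_def D_def supp_in_def indicator_def)
  moreover have "expectation (\<lambda>\<omega>. V \<omega> * (\<xi> \<phi> \<omega> * \<xi> \<psi> \<omega>)) =
      expectation (\<lambda>\<omega>. (V \<omega> * \<xi> \<phi>1 \<omega>) * \<xi> \<psi> \<omega> + V \<omega> * (\<xi> \<phi>2 \<omega> * \<xi> \<psi> \<omega>))"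
    using ae by (intro integral_cong_AE) (auto simp: algebra_simps)
  ultimately show "expectation (\<lambda>\<omega>. V \<omega> * (\<xi> \<phi> \<omega> * \<xi> \<psi> \<omega>)) = expectation V * (LINT z|spacetime. \<phi> z * \<psi> z)"
    using 1 2 by (simp del: mult_eq_0_iff mult_cancel_left mult_cancel_right)
qed

end

section \<open>Isometry and distance to the noise of a region\<close>

text \<open>Young's inequality. The leading constant \<open>1 + \<epsilon>\<close> can be sent to 1,
  so that L^2 limits pass without loss.\<close>

lemma square_sum_eps:
  fixes a b c \<epsilon> :: real
  assumes "\<epsilon> > 0"
  shows "(a - c)\<^sup>2 \<le> (1 + \<epsilon>) * (b - c)\<^sup>2 + (1 + 1 / \<epsilon>) * (a - b)\<^sup>2"
proof -
  have "0 \<le> (\<epsilon> * (b - c) - (a - b))\<^sup>2 / \<epsilon>" using assms by simp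
  also have "\<dots> = (1 + \<epsilon>) * (b - c)\<^sup>2 + (1 + 1 / \<epsilon>) * (a - b)\<^sup>2 - (a - c)\<^sup>2"
    using assms by (simp add: field_simps power2_eq_square)
  finally show ?thesis by simp
qed

context noise begin

text \<open>Squared \<open>L\<^sup>2\<close> distance to the variables determined by the noise over \<open>R\<close>. The competitors
  \<open>Z\<close> need not be square integrable; the integral is then infinite unless the difference is.\<close>
definition cond_dist :: "(real \<times> real) set \<Rightarrow> ('a \<Rightarrow> real) \<Rightarrow> ennreal" where
  "cond_dist R X = (INF Z\<in>borel_measurable (alg R). second_moment (\<lambda>\<omega>. X \<omega> - Z \<omega>))"

lemma cond_dist_le: "Z \<in> borel_measurable (alg R) \<Longrightarrow> cond_dist R X \<le> second_moment (\<lambda>\<omega>. X \<omega> - Z \<omega>)"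
  unfolding cond_dist_def by (rule INF_lower)

lemma cond_dist_le_second_moment: "cond_dist R X \<le> second_moment X"
  using cond_dist_le[of "\<lambda>_. 0" R X] by simp

lemma nn_integral_square_eps:
  assumes [measurable]: "X \<in> borel_measurable M" "X' \<in> borel_measurable M" "Z \<in> borel_measurable M" and \<epsilon>: "\<epsilon> > 0"
  shows "second_moment (\<lambda>\<omega>. X \<omega> - Z \<omega>) \<le>
    ennreal (1 + \<epsilon>) * second_moment (\<lambda>\<omega>. X' \<omega> - Z \<omega>) + ennreal (1 + 1 / \<epsilon>) * second_moment (\<lambda>\<omega>. X \<omega> - X' \<omega>)"
proof -
  have "second_moment (\<lambda>\<omega>. X \<omega> - Z \<omega>) \<le>
    (\<integral>\<^sup>+\<omega>. ennreal (1 + \<epsilon>) * ennreal ((X' \<omega> - Z \<omega>)\<^sup>2) + ennreal (1 + 1 / \<epsilon>) * ennreal ((X \<omega> - X' \<omega>)\<^sup>2) \<partial>M)"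
    using square_sum_eps[OF \<epsilon>] \<epsilon>
    by (intro nn_integral_mono) (simp add: ennreal_mult[symmetric] ennreal_plus[symmetric] del: ennreal_plus)
  also have "\<dots> = ennreal (1 + \<epsilon>) * second_moment (\<lambda>\<omega>. X' \<omega> - Z \<omega>) + ennreal (1 + 1 / \<epsilon>) * second_moment (\<lambda>\<omega>. X \<omega> - X' \<omega>)"
    by (simp add: nn_integral_add nn_integral_cmult)
  finally show ?thesis .
qed

text \<open>The infimum may not be attained, so a minimiser up to \<open>e / c\<close> is used. The
  case \<open>c = 0\<close> stands apart since 0 times an infinite distance is 0 in
  \<open>ennreal\<close>; there the competitor 0 suffices.\<close>

lemma le_cond_distI:
  assumes le: "\<And>Z. Z \<in> borel_measurable (alg R) \<Longrightarrow> d \<le> ennreal c * second_moment (\<lambda>\<omega>. X \<omega> - Z \<omega>) + K"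
    and c: "c \<ge> 0"
  shows "d \<le> ennreal c * cond_dist R X + K"
proof (cases "c = 0")
  case True
  then show ?thesis using le[of "\<lambda>_. 0"] by simp
next
  case c0: False
  then have c: "c > 0" using c by simp
  let ?f = "\<lambda>Z :: 'a \<Rightarrow> real. second_moment (\<lambda>\<omega>. X \<omega> - Z \<omega>)"
  show ?thesis
  proof (cases "cond_dist R X = \<top>")
    case True
    have "ennreal c * \<top> = \<top>" using c by (simp add: ennreal_mult_top)
    then show ?thesis unfolding True by simp
  next
    case False
    show ?thesis
    proof (rule ennreal_le_epsilon)
      fix e :: real assume e: "e > 0"
      define e' where "e' = e / c"
      have e': "e' > 0" "ennreal c * ennreal e' = ennreal e"
        using e c ennreal_mult[of c e'] by (simp_all add: e'_def del: ennreal_plus)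
      have "cond_dist R X < cond_dist R X + ennreal e'"
        using False e' by (simp add: ennreal_add_left_cancel_less[of _ 0, simplified] less_top)
      then obtain Z where Z: "Z \<in> borel_measurable (alg R)" "?f Z < cond_dist R X + ennreal e'"
        unfolding cond_dist_def INF_less_iff by blast
      have "d \<le> ennreal c * ?f Z + K" by (rule le[OF Z(1)])
      also have "\<dots> \<le> ennreal c * (cond_dist R X + ennreal e') + K"
        using Z(2) by (intro add_right_mono mult_left_mono) auto
      finally show "d \<le> ennreal c * cond_dist R X + K + ennreal e"
        by (simp add: distrib_left e' add_ac)
    qed
  qed
qed

text \<open>Continuity of the distance under L^2 convergence, in the form that
  \<open>walsh_bound\<close> asks for.\<close>

lemma cond_dist_eps:
  assumes X: "X \<in> borel_measurable M" "X' \<in> borel_measurable M" and \<epsilon>: "\<epsilon> > 0"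
  shows "cond_dist R X \<le> ennreal (1 + \<epsilon>) * cond_dist R X' + ennreal (1 + 1 / \<epsilon>) * second_moment (\<lambda>\<omega>. X \<omega> - X' \<omega>)"
proof (rule le_cond_distI)
  fix Z :: "'a \<Rightarrow> real" assume Z: "Z \<in> borel_measurable (alg R)"
  show "cond_dist R X \<le> ennreal (1 + \<epsilon>) * second_moment (\<lambda>\<omega>. X' \<omega> - Z \<omega>)
      + ennreal (1 + 1 / \<epsilon>) * second_moment (\<lambda>\<omega>. X \<omega> - X' \<omega>)"
    using cond_dist_le[OF Z, of X] nn_integral_square_eps[OF X alg_measurableD[OF Z] \<epsilon>] by (rule order_trans)
qed (use \<epsilon> in simp)

text \<open>The competitor \<open>f (Z \<omega>)\<close> is again known from the noise over
  \<open>R\<close>. This replaces a commutation of projection with a nonlinear map.\<close>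

lemma cond_dist_lipschitz:
  assumes f: "f \<in> borel_measurable borel" "\<And>x y. \<bar>f x - f y\<bar> \<le> L * \<bar>x - y\<bar>"
    and X: "X \<in> borel_measurable M"
  shows "cond_dist R (\<lambda>\<omega>. f (X \<omega>)) \<le> ennreal (L\<^sup>2) * cond_dist R X"
proof -
  have "cond_dist R (\<lambda>\<omega>. f (X \<omega>)) \<le> ennreal (L\<^sup>2) * cond_dist R X + 0"
  proof (rule le_cond_distI)
    fix Z :: "'a \<Rightarrow> real" assume Z: "Z \<in> borel_measurable (alg R)"
    note [measurable] = alg_measurableD[OF Z] X
    have "(\<lambda>\<omega>. f (Z \<omega>)) \<in> borel_measurable (alg R)" by (rule measurable_compose[OF Z f(1)])
    then have "cond_dist R (\<lambda>\<omega>. f (X \<omega>)) \<le> second_moment (\<lambda>\<omega>. f (X \<omega>) - f (Z \<omega>))"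
      by (rule cond_dist_le)
    also have "\<dots> \<le> (\<integral>\<^sup>+\<omega>. ennreal (L\<^sup>2) * ennreal ((X \<omega> - Z \<omega>)\<^sup>2) \<partial>M)"
    proof (rule nn_integral_mono)
      fix \<omega>
      have "\<bar>f (X \<omega>) - f (Z \<omega>)\<bar>\<^sup>2 \<le> (L * \<bar>X \<omega> - Z \<omega>\<bar>)\<^sup>2" by (intro power_mono f) simp
      then show "ennreal ((f (X \<omega>) - f (Z \<omega>))\<^sup>2) \<le> ennreal (L\<^sup>2) * ennreal ((X \<omega> - Z \<omega>)\<^sup>2)"
        by (simp add: ennreal_mult[symmetric] power_mult_distrib ennreal_leI)
    qed
    also have "\<dots> = ennreal (L\<^sup>2) * second_moment (\<lambda>\<omega>. X \<omega> - Z \<omega>)"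
      by (rule nn_integral_cmult) measurable
    finally show "cond_dist R (\<lambda>\<omega>. f (X \<omega>)) \<le> ennreal (L\<^sup>2) * second_moment (\<lambda>\<omega>. X \<omega> - Z \<omega>) + 0" by simp
  qed simp
  then show ?thesis by simp
qed

lemma cond_dist_cong_AE:
  assumes "AE \<omega> in M. X \<omega> = Y \<omega>"
  shows "cond_dist R X = cond_dist R Y"
  unfolding cond_dist_def
  by (intro INF_cong refl nn_integral_cong_AE) (use assms in auto)

text \<open>Ito isometry for coefficients known before their test functions begin. Overlapping
  supports are allowed, since the double sum is evaluated pair by pair; rectangles cut by a region
  are therefore covered as well.\<close>

lemma sum_isometry:
  fixes X :: "'i \<Rightarrow> 'a \<Rightarrow> real" and \<phi> :: "'i \<Rightarrow> real \<times> real \<Rightarrow> real"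
  assumes I: "finite I"
    and \<phi>: "\<And>i. i \<in> I \<Longrightarrow> \<phi> i \<in> supp_in ({a i<..} \<times> UNIV)"
    and X: "\<And>i. i \<in> I \<Longrightarrow> X i \<in> borel_measurable (alg ({..a i} \<times> UNIV))"
    and C: "\<And>i. i \<in> I \<Longrightarrow> AE \<omega> in M. \<bar>X i \<omega>\<bar> \<le> C i"
  shows "second_moment (\<lambda>\<omega>. \<Sum>i\<in>I. X i \<omega> * \<xi> (\<phi> i) \<omega>) =
    (\<integral>\<^sup>+z. second_moment (\<lambda>\<omega>. \<Sum>i\<in>I. X i \<omega> * \<phi> i z) \<partial>spacetime)"
proof -
  have \<phi>s: "\<phi> i \<in> sq_integrable" if "i \<in> I" for i using \<phi>[OF that] supp_in_subset by auto
  have Xm: "X i \<in> borel_measurable M" if "i \<in> I" for i using alg_measurableD[OF X[OF that]] .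
  have XX: "AE \<omega> in M. \<bar>X i \<omega> * X j \<omega>\<bar> \<le> C i * C j" if "i \<in> I" "j \<in> I" for i j
    using C[OF that(1)] C[OF that(2)] by eventually_elim (auto simp: abs_mult intro!: mult_mono)
  have iXX: "integrable M (\<lambda>\<omega>. X i \<omega> * X j \<omega>)" if "i \<in> I" "j \<in> I" for i j
    using XX[OF that] Xm that by (intro integrable_const_bound[where B="C i * C j"]) auto
  \<comment> \<open>Ordering the pair by starting times makes the product of the coefficients known
    at the later time \<open>a j\<close>, after which \<open>\<phi> j\<close> lives.\<close>
  have pair_le: "integrable M (\<lambda>\<omega>. (X i \<omega> * \<xi> (\<phi> i) \<omega>) * (X j \<omega> * \<xi> (\<phi> j) \<omega>)) \<and>
     expectation (\<lambda>\<omega>. (X i \<omega> * \<xi> (\<phi> i) \<omega>) * (X j \<omega> * \<xi> (\<phi> j) \<omega>)) =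
     expectation (\<lambda>\<omega>. X i \<omega> * X j \<omega>) * (LINT z|spacetime. \<phi> i z * \<phi> j z)"
    if ij: "i \<in> I" "j \<in> I" and le: "a i \<le> a j" for i j
  proof -
    have "X i \<in> borel_measurable (alg ({..a j} \<times> UNIV))"
      by (rule alg_measurable_mono[OF _ X[OF ij(1)]]) (use le in auto)
    then have V: "(\<lambda>\<omega>. X i \<omega> * X j \<omega>) \<in> borel_measurable (alg ({..a j} \<times> UNIV))"
      using X[OF ij(2)] by auto
    from noise_pair_expectation[OF V XX[OF ij] \<phi>s[OF ij(1)] \<phi>[OF ij(2)]]
    show ?thesis by (simp add: mult_ac)
  qed
  have pair: "integrable M (\<lambda>\<omega>. (X i \<omega> * \<xi> (\<phi> i) \<omega>) * (X j \<omega> * \<xi> (\<phi> j) \<omega>)) \<and>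
     expectation (\<lambda>\<omega>. (X i \<omega> * \<xi> (\<phi> i) \<omega>) * (X j \<omega> * \<xi> (\<phi> j) \<omega>)) =
     expectation (\<lambda>\<omega>. X i \<omega> * X j \<omega>) * (LINT z|spacetime. \<phi> i z * \<phi> j z)"
    if "i \<in> I" "j \<in> I" for i j
    using pair_le[OF that] pair_le[OF that(2,1)] by (cases "a i \<le> a j") (auto simp: mult.commute)
  define E where "E = (\<lambda>i j. expectation (\<lambda>\<omega>. X i \<omega> * X j \<omega>))"
  have sq: "(\<Sum>i\<in>I. f i)\<^sup>2 = (\<Sum>i\<in>I. \<Sum>j\<in>I. f i * f j)" for f :: "'i \<Rightarrow> real"
    by (simp add: power2_eq_square sum_product)
  have "second_moment (\<lambda>\<omega>. \<Sum>i\<in>I. X i \<omega> * \<xi> (\<phi> i) \<omega>) = ennreal (expectation (\<lambda>\<omega>. (\<Sum>i\<in>I. X i \<omega> * \<xi> (\<phi> i) \<omega>)\<^sup>2))"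
  proof (rule nn_integral_eq_integral)
    show "integrable M (\<lambda>\<omega>. (\<Sum>i\<in>I. X i \<omega> * \<xi> (\<phi> i) \<omega>)\<^sup>2)" unfolding sq using pair by auto
  qed simp
  also have "expectation (\<lambda>\<omega>. (\<Sum>i\<in>I. X i \<omega> * \<xi> (\<phi> i) \<omega>)\<^sup>2) = (\<Sum>i\<in>I. \<Sum>j\<in>I. E i j * (LINT z|spacetime. \<phi> i z * \<phi> j z))"
    unfolding sq E_def using pair by simp
  also have "\<dots> = (LINT z|spacetime. (\<Sum>i\<in>I. \<Sum>j\<in>I. E i j * (\<phi> i z * \<phi> j z)))"
    using sq_integrable_mult[OF \<phi>s \<phi>s] by simp
  also have inner: "second_moment (\<lambda>\<omega>. \<Sum>i\<in>I. X i \<omega> * \<phi> i z) = ennreal (\<Sum>i\<in>I. \<Sum>j\<in>I. E i j * (\<phi> i z * \<phi> j z))"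
    "0 \<le> (\<Sum>i\<in>I. \<Sum>j\<in>I. E i j * (\<phi> i z * \<phi> j z))" for z
  proof -
    have eq: "(\<Sum>i\<in>I. X i \<omega> * \<phi> i z)\<^sup>2 = (\<Sum>i\<in>I. \<Sum>j\<in>I. (X i \<omega> * X j \<omega>) * (\<phi> i z * \<phi> j z))" for \<omega>
      by (simp add: sq mult_ac)
    have e: "expectation (\<lambda>\<omega>. (\<Sum>i\<in>I. X i \<omega> * \<phi> i z)\<^sup>2) = (\<Sum>i\<in>I. \<Sum>j\<in>I. E i j * (\<phi> i z * \<phi> j z))"
      unfolding eq E_def using iXX by simp
    have "second_moment (\<lambda>\<omega>. \<Sum>i\<in>I. X i \<omega> * \<phi> i z) = ennreal (expectation (\<lambda>\<omega>. (\<Sum>i\<in>I. X i \<omega> * \<phi> i z)\<^sup>2))"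
    proof (rule nn_integral_eq_integral)
      show "integrable M (\<lambda>\<omega>. (\<Sum>i\<in>I. X i \<omega> * \<phi> i z)\<^sup>2)" unfolding eq using iXX by auto
    qed simp
    then show "second_moment (\<lambda>\<omega>. \<Sum>i\<in>I. X i \<omega> * \<phi> i z) = ennreal (\<Sum>i\<in>I. \<Sum>j\<in>I. E i j * (\<phi> i z * \<phi> j z))"
      by (simp add: e)
    show "0 \<le> (\<Sum>i\<in>I. \<Sum>j\<in>I. E i j * (\<phi> i z * \<phi> j z))"
      unfolding e[symmetric] by (rule Bochner_Integration.integral_nonneg) simp
  qed
  have "ennreal (LINT z|spacetime. (\<Sum>i\<in>I. \<Sum>j\<in>I. E i j * (\<phi> i z * \<phi> j z))) =
     (\<integral>\<^sup>+z. ennreal (\<Sum>i\<in>I. \<Sum>j\<in>I. E i j * (\<phi> i z * \<phi> j z)) \<partial>spacetime)"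
    by (rule nn_integral_eq_integral[symmetric]) (use sq_integrable_mult[OF \<phi>s \<phi>s] inner in auto)
  finally show ?thesis using inner by simp
qed

text \<open>Pythagoras: \<open>X - W\<close> is orthogonal to \<open>W - Z\<close> for the
  conditional expectation \<open>W\<close>. Boundedness of \<open>X\<close> carries over to
  \<open>W\<close> and makes the mixed products integrable; a competitor at infinite distance is
  trivial. \<open>Y\<close> is any version of \<open>W\<close>.\<close>

lemma cond_exp_best_approx:
  assumes X[measurable]: "X \<in> borel_measurable M" and C: "AE \<omega> in M. \<bar>X \<omega>\<bar> \<le> C"
    and Y: "Y \<in> borel_measurable M" "AE \<omega> in M. real_cond_exp M (alg R) X \<omega> = Y \<omega>"
  shows "second_moment (\<lambda>\<omega>. X \<omega> - Y \<omega>) \<le> cond_dist R X"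
  unfolding cond_dist_def
proof (rule INF_greatest)
  interpret F: finite_measure_subalgebra M "alg R" by (rule finite_measure_subalgebra_alg)
  fix Z :: "'a \<Rightarrow> real" assume Z: "Z \<in> borel_measurable (alg R)"
  define W where "W = real_cond_exp M (alg R) X"
  have Wm: "W \<in> borel_measurable (alg R)" by (simp add: W_def)
  note [measurable] = alg_measurableD[OF Z] alg_measurableD[OF Wm] Y(1)
  have iX: "integrable M X" using C by (intro integrable_const_bound[where B=C]) auto
  have "AE \<omega> in M. W \<omega> \<le> C" "AE \<omega> in M. W \<omega> \<ge> - C"
    unfolding W_def by (intro F.real_cond_exp_le_c F.real_cond_exp_ge_c iX; use C in auto)+
  then have CW: "AE \<omega> in M. \<bar>W \<omega>\<bar> \<le> C" by auto
  have eqY: "second_moment (\<lambda>\<omega>. X \<omega> - Y \<omega>) = second_moment (\<lambda>\<omega>. X \<omega> - W \<omega>)"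
    using Y(2) by (intro nn_integral_cong_AE) (auto simp: W_def)
  show "second_moment (\<lambda>\<omega>. X \<omega> - Y \<omega>) \<le> second_moment (\<lambda>\<omega>. X \<omega> - Z \<omega>)"
  proof (cases "second_moment (\<lambda>\<omega>. X \<omega> - Z \<omega>) = \<infinity>")
    case False
    then have i1: "integrable M (\<lambda>\<omega>. (X \<omega> - Z \<omega>)\<^sup>2)"
      by (intro integrableI_nonneg) (auto simp: less_top)
    have sqb: "integrable M (\<lambda>\<omega>. (f \<omega>)\<^sup>2)" if "AE \<omega> in M. \<bar>f \<omega>\<bar> \<le> D" "f \<in> borel_measurable M" for f :: "'a \<Rightarrow> real" and D
    proof (rule integrable_const_bound[where B="D\<^sup>2"])
      show "AE \<omega> in M. norm ((f \<omega>)\<^sup>2) \<le> D\<^sup>2"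
        using that(1) by eventually_elim (metis abs_ge_zero norm_power power_mono real_norm_def)
    qed (use that in auto)
    have XW: "AE \<omega> in M. \<bar>X \<omega> - W \<omega>\<bar> \<le> C + C" using C CW by eventually_elim auto
    have i2: "integrable M (\<lambda>\<omega>. (X \<omega> - W \<omega>)\<^sup>2)" by (rule sqb[OF XW]) auto
    have i3: "integrable M (\<lambda>\<omega>. (W \<omega> - Z \<omega>)\<^sup>2)"
    proof (rule Bochner_Integration.integrable_bound)
      show "integrable M (\<lambda>\<omega>. 2 * (X \<omega> - Z \<omega>)\<^sup>2 + 2 * (X \<omega> - W \<omega>)\<^sup>2)" using i1 i2 by auto
      have "(w - z)\<^sup>2 \<le> 2 * (x - z)\<^sup>2 + 2 * (x - w)\<^sup>2" for w x z :: real
        using square_sum_eps[of 1 w z x] by (simp add: power2_commute)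
      then show "AE \<omega> in M. norm ((W \<omega> - Z \<omega>)\<^sup>2) \<le> norm (2 * (X \<omega> - Z \<omega>)\<^sup>2 + 2 * (X \<omega> - W \<omega>)\<^sup>2)" by simp
    qed auto
    have i4: "integrable M (\<lambda>\<omega>. W \<omega> - Z \<omega>)"
      by (rule square_integrable_imp_integrable[OF _ i3]) auto
    have i5: "integrable M (\<lambda>\<omega>. (W \<omega> - Z \<omega>) * X \<omega>)" "integrable M (\<lambda>\<omega>. (W \<omega> - Z \<omega>) * W \<omega>)"
      using integrable_bounded_mult[OF C X i4] integrable_bounded_mult[OF CW _ i4] by (auto simp: mult.commute)
    have "(\<lambda>\<omega>. W \<omega> - Z \<omega>) \<in> borel_measurable (alg R)" using Wm Z by auto
    then have "expectation (\<lambda>\<omega>. (W \<omega> - Z \<omega>) * W \<omega>) = expectation (\<lambda>\<omega>. (W \<omega> - Z \<omega>) * X \<omega>)"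
      unfolding W_def by (intro F.real_cond_exp_intg i5[unfolded W_def]) auto
    moreover have "(X \<omega> - Z \<omega>)\<^sup>2 = (X \<omega> - W \<omega>)\<^sup>2 + (W \<omega> - Z \<omega>)\<^sup>2 + (2 * ((W \<omega> - Z \<omega>) * X \<omega>) - 2 * ((W \<omega> - Z \<omega>) * W \<omega>))" for \<omega>
      by (simp add: power2_eq_square algebra_simps)
    ultimately have "expectation (\<lambda>\<omega>. (X \<omega> - Z \<omega>)\<^sup>2) = expectation (\<lambda>\<omega>. (X \<omega> - W \<omega>)\<^sup>2) + expectation (\<lambda>\<omega>. (W \<omega> - Z \<omega>)\<^sup>2)"
      using i2 i3 i5 by simp
    moreover have "0 \<le> expectation (\<lambda>\<omega>. (W \<omega> - Z \<omega>)\<^sup>2)" by (rule Bochner_Integration.integral_nonneg) simp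
    ultimately have "expectation (\<lambda>\<omega>. (X \<omega> - W \<omega>)\<^sup>2) \<le> expectation (\<lambda>\<omega>. (X \<omega> - Z \<omega>)\<^sup>2)" by simp
    then show ?thesis unfolding eqY using i1 i2
      by (simp add: nn_integral_eq_integral ennreal_leI)
  qed simp
qed

text \<open>Recasts the definition with one indicator per rectangle and checks that it is an
  admissible test function. The left-open time interval puts its support strictly after
  \<open>a i\<close>, disjoint from the past region.\<close>

lemma elementary_integralE:
  assumes "elementary_integral M \<xi> \<Psi> J"
  obtains n :: nat and a b :: "nat \<Rightarrow> real" and A X C where
    "\<And>i. i < n \<Longrightarrow> 0 \<le> a i" "\<And>i. i < n \<Longrightarrow> A i \<in> sets borel"
    "\<And>i. i < n \<Longrightarrow> X i \<in> borel_measurable (alg ({..a i} \<times> UNIV))"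
    "\<And>i \<omega>. i < n \<Longrightarrow> \<omega> \<in> space M \<Longrightarrow> \<bar>X i \<omega>\<bar> \<le> C i"
    "\<And>i. i < n \<Longrightarrow> (indicator ({a i<..b i} \<times> A i) :: real \<times> real \<Rightarrow> real) \<in> supp_in ({a i<..} \<times> UNIV)"
    "\<Psi> = (\<lambda>s y \<omega>. \<Sum>i<n. X i \<omega> * indicator ({a i<..b i} \<times> A i) (s, y))"
    "J = (\<lambda>\<omega>. \<Sum>i<n. X i \<omega> * \<xi> (indicator ({a i<..b i} \<times> A i)) \<omega>)"
proof -
  show thesis
    using assms unfolding elementary_integral_def
  proof (elim exE conjE)
  fix n :: nat and a b :: "nat \<Rightarrow> real" and A X
  assume 1: "\<forall>i<n. 0 \<le> a i \<and> a i < b i \<and> A i \<in> sets borel \<and> emeasure lborel (A i) < \<infinity> \<and>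
           X i \<in> borel_measurable (noise_filtration M \<xi> (a i)) \<and>
           (\<exists>C. \<forall>\<omega>\<in>space M. \<bar>X i \<omega>\<bar> \<le> C)"
    and 2: "\<Psi> = (\<lambda>s y \<omega>. \<Sum>i<n. X i \<omega> * indicator {a i<..b i} s * indicator (A i) y)"
    and 3: "J = (\<lambda>\<omega>. \<Sum>i<n. X i \<omega> * \<xi> (indicator ({a i<..b i} \<times> A i)) \<omega>)"
  from 1 obtain C where C: "\<And>i \<omega>. i < n \<Longrightarrow> \<omega> \<in> space M \<Longrightarrow> \<bar>X i \<omega>\<bar> \<le> C i" by metis
  have ind: "(indicator ({a i<..b i} \<times> A i) :: real \<times> real \<Rightarrow> real) \<in> supp_in ({a i<..} \<times> UNIV)" if i: "i < n" for i
  proof -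
    let ?R = "{a i<..b i} \<times> A i"
    have A: "A i \<in> sets borel" "emeasure lborel (A i) < \<infinity>" "0 \<le> a i" "a i < b i" using 1 i by auto
    have Rm: "?R \<in> sets (borel \<Otimes>\<^sub>M borel)" using A by auto
    then have Rb: "?R \<in> sets borel" unfolding borel_prod .
    \<comment> \<open>With \<open>0 \<le> a i\<close> the left-open interval stays in positive
      times, so restriction to \<open>spacetime\<close> does not change the area of the
      rectangle.\<close>
    have sub: "?R \<subseteq> {0<..} \<times> UNIV" using A by auto
    have om: "{0<..} \<times> (UNIV :: real set) \<in> sets (lborel :: (real \<times> real) measure)" by simp
    have st: "?R \<in> sets spacetime" unfolding spacetime_def using sub Rb om by (simp add: sets_restrict_space_iff)
    have "emeasure spacetime ?R = emeasure lborel ?R"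
      unfolding spacetime_def using sub om by (intro emeasure_restrict_space) auto
    also have "\<dots> = emeasure (lborel \<Otimes>\<^sub>M lborel) ?R" by (simp add: lborel_prod)
    also have "\<dots> = emeasure lborel {a i<..b i} * emeasure lborel (A i)"
      using A by (intro lborel.emeasure_pair_measure_Times) auto
    also have "\<dots> < \<infinity>" using A by (simp add: ennreal_mult_less_top)
    finally have "integrable spacetime (indicator ?R :: real \<times> real \<Rightarrow> real)"
      using st by (intro integrable_real_indicator) auto
    moreover have "(indicator ?R z)\<^sup>2 = (indicator ?R z :: real)" for z by (auto simp: indicator_def)
    ultimately show ?thesis using st by (auto simp: supp_in_def sq_integrable_def)
  qed
  have X: "X i \<in> borel_measurable (alg ({..a i} \<times> UNIV))" if "i < n" for i
    using 1 that by (simp add: noise_filtration_alg)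
  have eq: "\<Psi> = (\<lambda>s y \<omega>. \<Sum>i<n. X i \<omega> * indicator ({a i<..b i} \<times> A i) (s, y))"
    unfolding 2 by (simp add: indicator_times mult.assoc)
  have "\<And>i. i < n \<Longrightarrow> 0 \<le> a i" "\<And>i. i < n \<Longrightarrow> A i \<in> sets borel" using 1 by auto
  from that[OF this X C ind eq 3] show thesis by blast
  qed
qed

lemma elementary_measurable:
  assumes "elementary_integral M \<xi> \<Psi> J"
  shows "J \<in> borel_measurable M" "(\<lambda>((s, y), \<omega>). \<Psi> s y \<omega>) \<in> borel_measurable (spacetime \<Otimes>\<^sub>M M)" "\<Psi> s y \<in> borel_measurable M"
proof -
  from assms obtain n :: nat and a b :: "nat \<Rightarrow> real" and A X C where
    1: "\<And>i. i < n \<Longrightarrow> X i \<in> borel_measurable (alg ({..a i} \<times> UNIV))"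
    "\<And>i. i < n \<Longrightarrow> (indicator ({a i<..b i} \<times> A i) :: real \<times> real \<Rightarrow> real) \<in> supp_in ({a i<..} \<times> UNIV)"
    "\<Psi> = (\<lambda>s y \<omega>. \<Sum>i<n. X i \<omega> * indicator ({a i<..b i} \<times> A i) (s, y))"
    "J = (\<lambda>\<omega>. \<Sum>i<n. X i \<omega> * \<xi> (indicator ({a i<..b i} \<times> A i)) \<omega>)"
    by (rule elementary_integralE) blast
  have X: "X i \<in> borel_measurable M" if "i < n" for i using alg_measurableD[OF 1(1)[OF that]] .
  have ind: "(indicator ({a i<..b i} \<times> A i) :: real \<times> real \<Rightarrow> real) \<in> sq_integrable" if "i < n" for i
    using 1(2)[OF that] supp_in_subset by auto
  show "J \<in> borel_measurable M" unfolding 1(4)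
    using X noise_measurable[OF ind] by (intro borel_measurable_sum borel_measurable_times) auto
  show "\<Psi> s y \<in> borel_measurable M" unfolding 1(3)
    using X by (intro borel_measurable_sum borel_measurable_times) auto
  have "(\<lambda>z. X i (snd z) * indicator ({a i<..b i} \<times> A i) (fst z)) \<in> borel_measurable (spacetime \<Otimes>\<^sub>M M)" if "i < n" for i
    using X[OF that] ind[OF that] unfolding sq_integrable_def
    by (intro borel_measurable_times measurable_compose[OF measurable_snd] measurable_compose[OF measurable_fst, where g="indicator _"]) auto
  then have "(\<lambda>z. \<Sum>i<n. X i (snd z) * indicator ({a i<..b i} \<times> A i) (fst z)) \<in> borel_measurable (spacetime \<Otimes>\<^sub>M M)"
    by (intro borel_measurable_sum) auto
  moreover have "(\<lambda>((s, y), \<omega>). \<Psi> s y \<omega>) = (\<lambda>z. \<Sum>i<n. X i (snd z) * indicator ({a i<..b i} \<times> A i) (fst z))"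
    unfolding 1(3) by (intro ext) (simp only: split_beta prod.collapse)
  ultimately show "(\<lambda>((s, y), \<omega>). \<Psi> s y \<omega>) \<in> borel_measurable (spacetime \<Otimes>\<^sub>M M)"
    by (simp only:)
qed

lemma elementary_isometry:
  assumes "elementary_integral M \<xi> \<Psi> J"
  shows "second_moment J = (\<integral>\<^sup>+z. second_moment (\<Psi> (fst z) (snd z)) \<partial>spacetime)"
proof -
  from assms obtain n :: nat and a b :: "nat \<Rightarrow> real" and A X C where
    1: "\<And>i. i < n \<Longrightarrow> X i \<in> borel_measurable (alg ({..a i} \<times> UNIV))"
    "\<And>i \<omega>. i < n \<Longrightarrow> \<omega> \<in> space M \<Longrightarrow> \<bar>X i \<omega>\<bar> \<le> C i"
    "\<And>i. i < n \<Longrightarrow> (indicator ({a i<..b i} \<times> A i) :: real \<times> real \<Rightarrow> real) \<in> supp_in ({a i<..} \<times> UNIV)"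
    "\<Psi> = (\<lambda>s y \<omega>. \<Sum>i<n. X i \<omega> * indicator ({a i<..b i} \<times> A i) (s, y))"
    "J = (\<lambda>\<omega>. \<Sum>i<n. X i \<omega> * \<xi> (indicator ({a i<..b i} \<times> A i)) \<omega>)"
    by (rule elementary_integralE) blast
  show ?thesis unfolding 1(4,5) prod.collapse
    by (rule sum_isometry[where a=a and C=C]) (use 1 in auto)
qed

text \<open>Each rectangle is cut at \<open>B\<close>, and over \<open>B\<close> the coefficient is
  replaced by its conditional expectation. The resulting sum is a competitor for \<open>J\<close>;
  the difference is again an adapted sum, and the isometry turns its second moment into a space-time
  integral of the projection error on \<open>B\<close> and of the full second moment
  elsewhere.\<close>

lemma elementary_cond_dist:
  assumes "elementary_integral M \<xi> \<Psi> J" and B: "B \<in> sets borel"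
  shows "cond_dist (UNIV \<times> B) J \<le> (\<integral>\<^sup>+z. (if snd z \<in> B then cond_dist (UNIV \<times> B) (\<Psi> (fst z) (snd z))
      else second_moment (\<Psi> (fst z) (snd z))) \<partial>spacetime)"
proof -
  from assms(1) obtain n :: nat and a b :: "nat \<Rightarrow> real" and A X C where
    X: "\<And>i. i < n \<Longrightarrow> X i \<in> borel_measurable (alg ({..a i} \<times> UNIV))"
    and C: "\<And>i \<omega>. i < n \<Longrightarrow> \<omega> \<in> space M \<Longrightarrow> \<bar>X i \<omega>\<bar> \<le> C i"
    and ind: "\<And>i. i < n \<Longrightarrow> (indicator ({a i<..b i} \<times> A i) :: real \<times> real \<Rightarrow> real) \<in> supp_in ({a i<..} \<times> UNIV)"
    and \<Psi>: "\<Psi> = (\<lambda>s y \<omega>. \<Sum>i<n. X i \<omega> * indicator ({a i<..b i} \<times> A i) (s, y))"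
    and J: "J = (\<lambda>\<omega>. \<Sum>i<n. X i \<omega> * \<xi> (indicator ({a i<..b i} \<times> A i)) \<omega>)"
    by (rule elementary_integralE) blast
  define r where "r = (\<lambda>i. indicator ({a i<..b i} \<times> A i) :: real \<times> real \<Rightarrow> real)"
  \<comment> \<open>Conditioning on the past of \<open>B\<close> only keeps \<open>Y i\<close> known
    at time \<open>a i\<close>. By \<open>cond_exp_past\<close> it is also the projection on the
    noise over \<open>B\<close> at all times, hence optimal for \<open>cond_dist\<close>.\<close>
  define Y where "Y = (\<lambda>i. real_cond_exp M (alg ({..a i} \<times> B)) (X i))"
  \<comment> \<open>The boolean tells to which side of \<open>B\<close> the rectangle is cut, so
    that both kinds of summand fit one application of \<open>sum_isometry\<close>.\<close>
  define \<phi> where "\<phi> = (\<lambda>(i, c) z. r i z * indicator (if c then UNIV \<times> B else - (UNIV \<times> B)) z)"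
  define V where "V = (\<lambda>(i, c) \<omega>. if c then X i \<omega> - Y i \<omega> else X i \<omega>)"
  have UB: "UNIV \<times> B \<in> sets (borel :: (real \<times> real) measure)"
    using B by (auto simp: borel_prod[symmetric])
  have Xm: "X i \<in> borel_measurable M" if "i < n" for i using alg_measurableD[OF X[OF that]] .
  have Xi: "integrable M (X i)" if "i < n" for i
    using C[OF that] Xm[OF that] by (intro integrable_const_bound[where B="C i"]) auto
  have Ym: "Y i \<in> borel_measurable (alg ({..a i} \<times> B))" for i by (simp add: Y_def)
  have Ym': "Y i \<in> borel_measurable (alg ({..a i} \<times> UNIV))" "Y i \<in> borel_measurable (alg (UNIV \<times> B))" "Y i \<in> borel_measurable M" for i
    by (rule alg_measurable_mono[OF _ Ym[of i]], force)+ (rule alg_measurableD[OF Ym[of i]])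
  have CY: "AE \<omega> in M. \<bar>Y i \<omega>\<bar> \<le> C i" if "i < n" for i
  proof -
    interpret F: finite_measure_subalgebra M "alg ({..a i} \<times> B)" by (rule finite_measure_subalgebra_alg)
    have "AE \<omega> in M. X i \<omega> \<le> C i" "AE \<omega> in M. X i \<omega> \<ge> - C i"
      using C[OF that] by (auto intro!: AE_I2 simp: abs_le_iff minus_le_iff)
    from F.real_cond_exp_le_c[OF Xi[OF that] this(1)] F.real_cond_exp_ge_c[OF Xi[OF that] this(2)]
    have "AE \<omega> in M. Y i \<omega> \<le> C i" "AE \<omega> in M. Y i \<omega> \<ge> - C i"
      unfolding Y_def .
    then show ?thesis by eventually_elim auto
  qed
  have rs: "r i \<in> supp_in ({a i<..} \<times> UNIV)" if "i < n" for i using ind[OF that] by (simp add: r_def)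
  have rsq: "r i \<in> sq_integrable" if "i < n" for i using rs[OF that] supp_in_subset by auto
  have \<phi>T: "\<phi> (i, True) \<in> supp_in (UNIV \<times> B)" "\<phi> (i, c) \<in> supp_in ({a i<..} \<times> UNIV)" "\<phi> (i, c) \<in> sq_integrable" if "i < n" for i c
  proof -
    define D :: "bool \<Rightarrow> (real \<times> real) set" where "D = (\<lambda>c. if c then UNIV \<times> B else - (UNIV \<times> B))"
    have D: "\<phi> (i, c) \<in> supp_in (({a i<..} \<times> UNIV) \<inter> D c)" for c
    proof -
      have "D c \<in> sets borel" using UB borel_comp[OF UB] by (auto simp only: D_def split: if_split)
      from supp_in_restrict[OF rs[OF that] this] show ?thesis by (simp add: \<phi>_def D_def)
    qed
    show "\<phi> (i, True) \<in> supp_in (UNIV \<times> B)"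
      by (rule subsetD[OF supp_in_mono D]) (simp add: D_def)
    show *: "\<phi> (i, c) \<in> supp_in ({a i<..} \<times> UNIV)"
      by (rule subsetD[OF supp_in_mono D]) simp
    show "\<phi> (i, c) \<in> sq_integrable"
      by (rule subsetD[OF supp_in_subset *])
  qed
  \<comment> \<open>Only the parts over \<open>B\<close> are kept, so \<open>Z\<close> is known from
    the noise over \<open>B\<close>.\<close>
  define Z where "Z = (\<lambda>\<omega>. \<Sum>i<n. Y i \<omega> * \<xi> (\<phi> (i, True)) \<omega>)"
  have Zm: "Z \<in> borel_measurable (alg (UNIV \<times> B))"
    unfolding Z_def using Ym' noise_measurable_alg[OF \<phi>T(1)] by (intro borel_measurable_sum borel_measurable_times) auto
  have sumI: "(\<Sum>p\<in>{..<n} \<times> UNIV. g p) = (\<Sum>i<n. g (i, True) + g (i, False))" for g :: "nat \<times> bool \<Rightarrow> real"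
    by (simp add: sum.cartesian_product' UNIV_bool add.commute)
  have Jr: "J = (\<lambda>\<omega>. \<Sum>i<n. X i \<omega> * \<xi> (r i) \<omega>)" by (simp add: J r_def)
  have "AE \<omega> in M. \<forall>i\<in>{..<n}. \<xi> (r i) \<omega> = \<xi> (\<phi> (i, True)) \<omega> + \<xi> (\<phi> (i, False)) \<omega>"
    unfolding \<phi>_def using noise_split[OF rsq UB] by (intro AE_finite_allI) auto
  then have JZ: "AE \<omega> in M. J \<omega> - Z \<omega> = (\<Sum>p\<in>{..<n} \<times> UNIV. V p \<omega> * \<xi> (\<phi> p) \<omega>)"
    by eventually_elim (simp add: Jr Z_def sumI V_def sum_subtractf[symmetric] algebra_simps)
  have "cond_dist (UNIV \<times> B) J \<le> second_moment (\<lambda>\<omega>. J \<omega> - Z \<omega>)"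
    by (rule cond_dist_le[OF Zm])
  also have "\<dots> = second_moment (\<lambda>\<omega>. \<Sum>p\<in>{..<n} \<times> UNIV. V p \<omega> * \<xi> (\<phi> p) \<omega>)"
    using JZ by (intro nn_integral_cong_AE) auto
  also have "\<dots> = (\<integral>\<^sup>+z. second_moment (\<lambda>\<omega>. \<Sum>p\<in>{..<n} \<times> UNIV. V p \<omega> * \<phi> p z) \<partial>spacetime)"
  proof (rule sum_isometry[where a="\<lambda>p. a (fst p)" and C="\<lambda>p. 2 * C (fst p)"])
    fix p :: "nat \<times> bool" assume p: "p \<in> {..<n} \<times> UNIV"
    then obtain i c where ic: "p = (i, c)" "i < n" by auto
    show "\<phi> p \<in> supp_in ({a (fst p)<..} \<times> UNIV)" using \<phi>T ic by simp
    show "V p \<in> borel_measurable (alg ({..a (fst p)} \<times> UNIV))"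
      using X[OF ic(2)] Ym'(1)[of i] by (cases c) (auto simp: V_def ic)
    show "AE \<omega> in M. \<bar>V p \<omega>\<bar> \<le> 2 * C (fst p)"
      using CY[OF ic(2)] AE_space by eventually_elim (use C[OF ic(2)] ic in \<open>force simp: V_def\<close>)
  qed simp
  also have "\<dots> \<le> (\<integral>\<^sup>+z. (if snd z \<in> B then cond_dist (UNIV \<times> B) (\<Psi> (fst z) (snd z))
      else second_moment (\<Psi> (fst z) (snd z))) \<partial>spacetime)"
  proof (rule nn_integral_mono)
    fix z :: "real \<times> real"
    have \<Psi>z: "\<Psi> (fst z) (snd z) = (\<lambda>\<omega>. \<Sum>i<n. X i \<omega> * r i z)"
      by (simp only: \<Psi> r_def prod.collapse)
    show "second_moment (\<lambda>\<omega>. \<Sum>p\<in>{..<n} \<times> UNIV. V p \<omega> * \<phi> p z) \<le>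
       (if snd z \<in> B then cond_dist (UNIV \<times> B) (\<Psi> (fst z) (snd z)) else second_moment (\<Psi> (fst z) (snd z)))"
    proof (cases "snd z \<in> B")
      case False
      then have "(\<Sum>p\<in>{..<n} \<times> UNIV. V p \<omega> * \<phi> p z) = \<Psi> (fst z) (snd z) \<omega>" for \<omega>
        unfolding sumI \<Psi>z by (cases z) (simp add: V_def \<phi>_def)
      then show ?thesis using False by simp
    next
      case True
      interpret F: finite_measure_subalgebra M "alg (UNIV \<times> B)" by (rule finite_measure_subalgebra_alg)
      have 1: "(\<Sum>p\<in>{..<n} \<times> UNIV. V p \<omega> * \<phi> p z) = (\<Sum>i<n. X i \<omega> * r i z) - (\<Sum>i<n. Y i \<omega> * r i z)" for \<omega>
        using True unfolding sumI by (cases z) (simp add: V_def \<phi>_def sum_subtractf[symmetric] algebra_simps)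
      \<comment> \<open>The guard \<open>i < n\<close> is there because the summation rule for
        conditional expectations asks for integrability at every index, not only at those
        summed.\<close>
      have "AE \<omega> in M. real_cond_exp M (alg (UNIV \<times> B)) (\<lambda>\<omega>. \<Sum>i\<in>{..<n}. if i < n then X i \<omega> * r i z else 0) \<omega> =
          (\<Sum>i\<in>{..<n}. real_cond_exp M (alg (UNIV \<times> B)) (\<lambda>\<omega>. if i < n then X i \<omega> * r i z else 0) \<omega>)"
      proof (rule F.real_cond_exp_sum)
        show "integrable M (\<lambda>\<omega>. if i < n then X i \<omega> * r i z else 0)" for i
          using Xi[of i] by (cases "i < n") simp_all
      qed
      moreover have "AE \<omega> in M. \<forall>i\<in>{..<n}. real_cond_exp M (alg (UNIV \<times> B)) (\<lambda>\<omega>. X i \<omega> * r i z) \<omega> = Y i \<omega> * r i z"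
      proof (rule AE_finite_allI)
        fix i assume i: "i \<in> {..<n}"
        then have "AE \<omega> in M. real_cond_exp M (alg (UNIV \<times> B)) (\<lambda>\<omega>. r i z * X i \<omega>) \<omega> = r i z * real_cond_exp M (alg (UNIV \<times> B)) (X i) \<omega>"
          using Xi by (intro F.real_cond_exp_cmult) auto
        moreover have "AE \<omega> in M. real_cond_exp M (alg (UNIV \<times> B)) (X i) \<omega> = Y i \<omega>"
          unfolding Y_def using i by (intro cond_exp_past X Xi) auto
        ultimately show "AE \<omega> in M. real_cond_exp M (alg (UNIV \<times> B)) (\<lambda>\<omega>. X i \<omega> * r i z) \<omega> = Y i \<omega> * r i z"
          by eventually_elim (simp add: mult.commute)
      qed simp
      ultimately have Y: "AE \<omega> in M. real_cond_exp M (alg (UNIV \<times> B)) (\<lambda>\<omega>. \<Sum>i<n. X i \<omega> * r i z) \<omega> = (\<Sum>i<n. Y i \<omega> * r i z)"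
        by eventually_elim simp
      have "AE \<omega> in M. \<bar>\<Sum>i<n. X i \<omega> * r i z\<bar> \<le> (\<Sum>i<n. C i * \<bar>r i z\<bar>)"
        using C by (intro AE_I2 order_trans[OF sum_abs] sum_mono) (auto simp: abs_mult intro!: mult_right_mono)
      from cond_exp_best_approx[OF _ this _ Y] True Xm Ym' show ?thesis
        unfolding 1 \<Psi>z by (auto intro!: borel_measurable_sum borel_measurable_times)
    qed
  qed
  finally show ?thesis .
qed

end

section \<open>Gaussian kernels and the Volterra comparison\<close>

abbreviation heat_sq :: "real \<Rightarrow> real \<Rightarrow> real \<Rightarrow> real \<Rightarrow> real \<Rightarrow> ennreal" where
  "heat_sq \<theta> t x s y \<equiv> indicator {0<..<t} s * ennreal ((heat_kernel \<theta> (t - s) (x - y))\<^sup>2)"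

text \<open>The Volterra operator produced by the isometry. Values in \<open>ennreal\<close> let it
  act on bounds not yet known to be finite.\<close>

definition heat_square_integral :: "real \<Rightarrow> real \<Rightarrow> real \<Rightarrow> (real \<Rightarrow> real \<Rightarrow> ennreal) \<Rightarrow> ennreal" where
  "heat_square_integral \<theta> t x F =
     (\<integral>\<^sup>+s. \<integral>\<^sup>+y. heat_sq \<theta> t x s y * F s y \<partial>lborel \<partial>lborel)"

lemma heat_kernel_measurable[measurable]:
  "(\<lambda>z. heat_kernel \<theta> (f z) (g z)) \<in> borel_measurable N" if "f \<in> borel_measurable N" "g \<in> borel_measurable N"
  using that unfolding heat_kernel_def by measurable

text \<open>Convolution of two centred normal densities of variances \<open>A / 2\<close> and
  \<open>B / 2\<close>, after a shift by \<open>m\<close>.\<close>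

lemma nn_integral_gaussian_product:
  fixes A B x m :: real
  assumes A: "A > 0" and B: "B > 0"
  shows "(\<integral>\<^sup>+y. ennreal (exp (- (x - y)\<^sup>2 / A) * exp (- (y - m)\<^sup>2 / B)) \<partial>lborel)
    = ennreal (sqrt (pi * A * B / (A + B)) * exp (- (x - m)\<^sup>2 / (A + B)))"
proof -
  define \<sigma> \<tau> where "\<sigma> = sqrt (A / 2)" and "\<tau> = sqrt (B / 2)"
  have s: "\<sigma> > 0" "\<tau> > 0" "\<sigma>\<^sup>2 = A / 2" "\<tau>\<^sup>2 = B / 2" using A B by (simp_all add: \<sigma>_def \<tau>_def)
  have nA: "normal_density 0 \<sigma> z = exp (- z\<^sup>2 / A) / sqrt (pi * A)" for z
    using A s by (simp add: normal_density_def mult_ac)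
  have nB: "normal_density 0 \<tau> z = exp (- z\<^sup>2 / B) / sqrt (pi * B)" for z
    using B s by (simp add: normal_density_def mult_ac)
  have nAB: "normal_density 0 (sqrt (\<sigma>\<^sup>2 + \<tau>\<^sup>2)) z = exp (- z\<^sup>2 / (A + B)) / sqrt (pi * (A + B))" for z
  proof -
    have "2 * (sqrt (\<sigma>\<^sup>2 + \<tau>\<^sup>2))\<^sup>2 = A + B" using A B s by simp
    then show ?thesis by (simp add: normal_density_def mult.assoc mult.left_commute[of 2 pi])
  qed
  have c: "sqrt (pi * A) * sqrt (pi * B) / sqrt (pi * (A + B)) = sqrt (pi * A * B / (A + B))"
  proof -
    have "sqrt (pi * A) * sqrt (pi * B) / sqrt (pi * (A + B)) = sqrt (pi * A * (pi * B) / (pi * (A + B)))"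
      by (simp only: real_sqrt_mult real_sqrt_divide)
    also have "pi * A * (pi * B) / (pi * (A + B)) = pi * A * B / (A + B)"
      by (simp add: mult_ac)
    finally show ?thesis .
  qed
  have "(\<integral>\<^sup>+y. ennreal (exp (- (x - y)\<^sup>2 / A) * exp (- (y - m)\<^sup>2 / B)) \<partial>lborel)
     = (\<integral>\<^sup>+y. ennreal (exp (- (x - (m + y))\<^sup>2 / A) * exp (- y\<^sup>2 / B)) \<partial>lborel)"
    by (subst nn_integral_real_affine[where c=1 and t=m]) auto
  also have "\<dots> = (\<integral>\<^sup>+y. ennreal (sqrt (pi * A) * sqrt (pi * B)) * ennreal (normal_density 0 \<sigma> ((x - m) - y) * normal_density 0 \<tau> y) \<partial>lborel)"
    using A B by (intro nn_integral_cong) (simp add: nA nB ennreal_mult[symmetric] diff_diff_eq)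
  also have "\<dots> = ennreal (sqrt (pi * A) * sqrt (pi * B)) * (\<integral>\<^sup>+y. ennreal (normal_density 0 \<sigma> ((x - m) - y) * normal_density 0 \<tau> y) \<partial>lborel)"
    by (rule nn_integral_cmult) simp
  also have "(\<integral>\<^sup>+y. ennreal (normal_density 0 \<sigma> ((x - m) - y) * normal_density 0 \<tau> y) \<partial>lborel) = ennreal (normal_density 0 (sqrt (\<sigma>\<^sup>2 + \<tau>\<^sup>2)) (x - m))"
    using fun_cong[OF conv_normal_density_zero_mean[OF s(1,2)], of "x - m"] by simp
  also have "ennreal (sqrt (pi * A) * sqrt (pi * B)) * ennreal (normal_density 0 (sqrt (\<sigma>\<^sup>2 + \<tau>\<^sup>2)) (x - m))
     = ennreal (sqrt (pi * A * B / (A + B)) * exp (- (x - m)\<^sup>2 / (A + B)))"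
    using A B unfolding nAB c[symmetric] by (simp add: ennreal_mult[symmetric])
  finally show ?thesis .
qed

lemma nn_integral_gaussian:
  assumes A: "(A::real) > 0"
  shows "(\<integral>\<^sup>+x. ennreal (exp (- (x - a)\<^sup>2 / A)) \<partial>lborel) = ennreal (sqrt (pi * A))"
proof -
  define \<sigma> where "\<sigma> = sqrt (A / 2)"
  have s: "\<sigma> > 0" "\<sigma>\<^sup>2 = A / 2" using A by (simp_all add: \<sigma>_def)
  have nA: "exp (- (x - a)\<^sup>2 / A) = sqrt (pi * A) * normal_density a \<sigma> x" for x
    using A s by (simp add: normal_density_def mult_ac)
  have "(\<integral>\<^sup>+x. ennreal (exp (- (x - a)\<^sup>2 / A)) \<partial>lborel) = (\<integral>\<^sup>+x. ennreal (sqrt (pi * A)) * ennreal (normal_density a \<sigma> x) \<partial>lborel)"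
    unfolding nA using A by (simp add: ennreal_mult)
  also have "\<dots> = ennreal (sqrt (pi * A)) * (\<integral>\<^sup>+x. ennreal (normal_density a \<sigma> x) \<partial>lborel)"
    by (rule nn_integral_cmult) simp
  also have "(\<integral>\<^sup>+x. ennreal (normal_density a \<sigma> x) \<partial>lborel) = 1"
    using s by (subst nn_integral_eq_integral) auto
  finally show ?thesis by simp
qed

text \<open>For nonnegative \<open>f\<close> this is sqrt (2 pi kappa t) times the heat flow of
  diffusivity kappa. Omitting the normalisation makes it increase with \<open>\<kappa>\<close>;
  \<open>ennreal\<close> cuts off negative values of \<open>f\<close>.\<close>

definition gauss_avg :: "real \<Rightarrow> (real \<Rightarrow> real) \<Rightarrow> real \<Rightarrow> real \<Rightarrow> ennreal" where
  "gauss_avg \<kappa> f t x = (\<integral>\<^sup>+a. ennreal (f a) * ennreal (exp (- (x - a)\<^sup>2 / (2 * \<kappa> * t))) \<partial>lborel)"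

lemma gauss_avg_measurable:
  assumes [measurable]: "f \<in> borel_measurable borel" "g \<in> borel_measurable N" "h \<in> borel_measurable N"
  shows "(\<lambda>z. gauss_avg \<kappa> f (g z) (h z)) \<in> borel_measurable N"
  unfolding gauss_avg_def by measurable

lemma heat_kernel_square:
  assumes "\<theta> > 0" "r > 0"
  shows "(heat_kernel \<theta> r z)\<^sup>2 = exp (- z\<^sup>2 / (\<theta> * r)) / (2 * pi * \<theta> * r)"
  using assms by (simp add: heat_kernel_def power_divide exp_double[symmetric])

text \<open>Gaussians with sources \<open>a\<close> and \<open>b\<close> multiply to a Gaussian
  around the midpoint times a function of \<open>a - b\<close>. Convolving with the squared kernel
  and undoing the split at time \<open>t\<close> restores the original form.\<close>

lemma heat_square_pair:
  assumes \<theta>: "\<theta> > 0" and \<kappa>: "\<theta> \<le> \<kappa>" and s: "0 < s" "s < t"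
  shows "(\<integral>\<^sup>+y. ennreal ((heat_kernel \<theta> (t - s) (x - y))\<^sup>2 * (exp (- (y - a)\<^sup>2 / (2 * \<kappa> * s)) * exp (- (y - b)\<^sup>2 / (2 * \<kappa> * s)))) \<partial>lborel)
    \<le> ennreal (sqrt (\<kappa> * s / (\<theta> * t)) / sqrt (4 * pi * \<theta> * (t - s)) * (exp (- (x - a)\<^sup>2 / (2 * \<kappa> * t)) * exp (- (x - b)\<^sup>2 / (2 * \<kappa> * t))))"
proof -
  define A B m where "A = \<theta> * (t - s)" and "B = \<kappa> * s" and "m = (a + b) / 2"
  have \<kappa>0: "\<kappa> > 0" using \<theta> \<kappa> by simp
  have A: "A > 0" and B: "B > 0" using \<theta> \<kappa>0 s by (simp_all add: A_def B_def)
  \<comment> \<open>The sum \<open>A + B\<close> lies between theta t and kappa t: the lower bound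
    serves the prefactor, the upper one the exponent.\<close>
  have AB1: "\<theta> * t \<le> A + B" using \<kappa> s by (simp add: A_def B_def right_diff_distrib mult_right_mono)
  have "\<theta> * (t - s) \<le> \<kappa> * (t - s)" using \<kappa> s by (intro mult_right_mono) auto
  then have AB2: "A + B \<le> \<kappa> * t" by (simp add: A_def B_def right_diff_distrib)
  have t: "t > 0" using s by simp
  have split: "exp (- (y - a)\<^sup>2 / (2 * \<kappa> * r)) * exp (- (y - b)\<^sup>2 / (2 * \<kappa> * r))
     = exp (- (y - m)\<^sup>2 / (\<kappa> * r)) * exp (- (a - b)\<^sup>2 / (4 * (\<kappa> * r)))" if "r > 0" for y r
  proof -
    have "\<kappa> * r > 0" using \<kappa>0 that by simp
    then have "- (y - a)\<^sup>2 / (2 * \<kappa> * r) + - (y - b)\<^sup>2 / (2 * \<kappa> * r) = - (y - m)\<^sup>2 / (\<kappa> * r) + - (a - b)\<^sup>2 / (4 * (\<kappa> * r))"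
      using \<kappa>0 that by (simp add: m_def field_simps power2_eq_square)
    then show ?thesis by (simp only: exp_add[symmetric])
  qed
  define c where "c = exp (- (a - b)\<^sup>2 / (4 * (\<kappa> * s))) / (2 * pi * A)"
  have c: "c \<ge> 0" using A by (simp add: c_def)
  have "(\<integral>\<^sup>+y. ennreal ((heat_kernel \<theta> (t - s) (x - y))\<^sup>2 * (exp (- (y - a)\<^sup>2 / (2 * \<kappa> * s)) * exp (- (y - b)\<^sup>2 / (2 * \<kappa> * s)))) \<partial>lborel)
     = (\<integral>\<^sup>+y. ennreal c * ennreal (exp (- (x - y)\<^sup>2 / A) * exp (- (y - m)\<^sup>2 / B)) \<partial>lborel)"
  proof (rule nn_integral_cong)
    fix y
    have "(heat_kernel \<theta> (t - s) (x - y))\<^sup>2 = exp (- (x - y)\<^sup>2 / A) / (2 * pi * A)"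
      using \<theta> s by (simp add: heat_kernel_square A_def mult.assoc)
    then have "(heat_kernel \<theta> (t - s) (x - y))\<^sup>2 * (exp (- (y - a)\<^sup>2 / (2 * \<kappa> * s)) * exp (- (y - b)\<^sup>2 / (2 * \<kappa> * s)))
      = c * (exp (- (x - y)\<^sup>2 / A) * exp (- (y - m)\<^sup>2 / B))"
      unfolding split[OF s(1)] B_def[symmetric] by (simp only: c_def B_def) simp
    then show "ennreal ((heat_kernel \<theta> (t - s) (x - y))\<^sup>2 * (exp (- (y - a)\<^sup>2 / (2 * \<kappa> * s)) * exp (- (y - b)\<^sup>2 / (2 * \<kappa> * s))))
      = ennreal c * ennreal (exp (- (x - y)\<^sup>2 / A) * exp (- (y - m)\<^sup>2 / B))"
      using c by (simp only: ennreal_mult'[symmetric])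
  qed
  also have "\<dots> = ennreal c * ennreal (sqrt (pi * A * B / (A + B)) * exp (- (x - m)\<^sup>2 / (A + B)))"
    by (subst nn_integral_cmult) (simp_all only: nn_integral_gaussian_product[OF A B], simp)
  also have "\<dots> = ennreal (sqrt (pi * A * B / (A + B)) / (2 * pi * A) * (exp (- (x - m)\<^sup>2 / (A + B)) * exp (- (a - b)\<^sup>2 / (4 * (\<kappa> * s)))))"
    using c A B by (simp add: c_def ennreal_mult[symmetric] mult_ac)
  also have "\<dots> \<le> ennreal (sqrt (\<kappa> * s / (\<theta> * t)) / sqrt (4 * pi * \<theta> * (t - s)) * (exp (- (x - m)\<^sup>2 / (\<kappa> * t)) * exp (- (a - b)\<^sup>2 / (4 * (\<kappa> * t)))))"
  proof (intro ennreal_leI mult_mono)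
    have "sqrt (pi * A * B / (A + B)) / (2 * pi * A) = sqrt (pi * A * B / (A + B)) / sqrt ((2 * pi * A)\<^sup>2)"
      using A by simp
    also have "\<dots> = sqrt ((pi * A * B / (A + B)) / (2 * pi * A)\<^sup>2)" by (simp only: real_sqrt_divide)
    also have "(pi * A * B / D) / (2 * pi * A)\<^sup>2 = B / D / (4 * pi * A)" for D
      using A by (simp add: power2_eq_square)
    also have "sqrt (B / (A + B) / (4 * pi * A)) \<le> sqrt (B / (\<theta> * t) / (4 * pi * A))"
      using A B AB1 \<theta> t by (intro real_sqrt_le_mono divide_right_mono divide_left_mono mult_pos_pos) auto
    also have "\<dots> = sqrt (\<kappa> * s / (\<theta> * t)) / sqrt (4 * pi * \<theta> * (t - s))"
      by (simp only: real_sqrt_divide A_def B_def mult.assoc)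
    finally show "sqrt (pi * A * B / (A + B)) / (2 * pi * A) \<le> sqrt (\<kappa> * s / (\<theta> * t)) / sqrt (4 * pi * \<theta> * (t - s))" .
    have "(x - m)\<^sup>2 / (\<kappa> * t) \<le> (x - m)\<^sup>2 / (A + B)"
      using AB2 A B \<kappa>0 t by (intro divide_left_mono mult_pos_pos) auto
    then show "exp (- (x - m)\<^sup>2 / (A + B)) \<le> exp (- (x - m)\<^sup>2 / (\<kappa> * t))" by simp
    have "(a - b)\<^sup>2 / (4 * (\<kappa> * t)) \<le> (a - b)\<^sup>2 / (4 * (\<kappa> * s))"
      using s \<kappa>0 t by (intro divide_left_mono mult_left_mono mult_pos_pos) auto
    then show "exp (- (a - b)\<^sup>2 / (4 * (\<kappa> * s))) \<le> exp (- (a - b)\<^sup>2 / (4 * (\<kappa> * t)))" by simp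
  qed (use s \<theta> \<kappa>0 in auto)
  finally show ?thesis unfolding split[OF t] .
qed

text \<open>The square of the average is a double integral over pairs of sources, and after Tonelli
  \<open>heat_square_pair\<close> applies to each pair.\<close>

lemma heat_square_gauss_avg:
  assumes \<theta>: "\<theta> > 0" and \<kappa>: "\<theta> \<le> \<kappa>" and s: "0 < s" "s < t" and f[measurable]: "f \<in> borel_measurable borel"
  shows "(\<integral>\<^sup>+y. ennreal ((heat_kernel \<theta> (t - s) (x - y))\<^sup>2) * (gauss_avg \<kappa> f s y)\<^sup>2 \<partial>lborel)
    \<le> ennreal (sqrt (\<kappa> * s / (\<theta> * t)) / sqrt (4 * pi * \<theta> * (t - s))) * (gauss_avg \<kappa> f t x)\<^sup>2"
proof -
  define e where "e = (\<lambda>r y a::real. exp (- (y - a)\<^sup>2 / (2 * \<kappa> * r)))"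
  have e0: "e r y a \<ge> 0" for r y a by (simp add: e_def)
  have em[measurable]: "(\<lambda>z. e r (g z) (h z)) \<in> borel_measurable N"
    if [measurable]: "g \<in> borel_measurable N" "h \<in> borel_measurable N" for r g h and N :: "'c measure"
    unfolding e_def by measurable
  have sq: "(gauss_avg \<kappa> f r y)\<^sup>2 = (\<integral>\<^sup>+a. \<integral>\<^sup>+b. ennreal (f a) * ennreal (f b) * ennreal (e r y a * e r y b) \<partial>lborel \<partial>lborel)" for r y
  proof -
    have "(gauss_avg \<kappa> f r y)\<^sup>2 = (\<integral>\<^sup>+a. ennreal (f a) * ennreal (e r y a) * (\<integral>\<^sup>+b. ennreal (f b) * ennreal (e r y b) \<partial>lborel) \<partial>lborel)"
      by (simp add: gauss_avg_def power2_eq_square e_def nn_integral_multc)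
    also have "\<dots> = (\<integral>\<^sup>+a. \<integral>\<^sup>+b. (ennreal (f a) * ennreal (e r y a)) * (ennreal (f b) * ennreal (e r y b)) \<partial>lborel \<partial>lborel)"
      by (simp add: nn_integral_cmult)
    finally show ?thesis by (simp add: ennreal_mult e0 mult_ac)
  qed
  let ?k = "\<lambda>y. (heat_kernel \<theta> (t - s) (x - y))\<^sup>2"
  define c where "c = sqrt (\<kappa> * s / (\<theta> * t)) / sqrt (4 * pi * \<theta> * (t - s))"
  have c0: "c \<ge> 0" using \<theta> \<kappa> s by (simp add: c_def)
  have "(\<integral>\<^sup>+y. ennreal (?k y) * (gauss_avg \<kappa> f s y)\<^sup>2 \<partial>lborel) =
     (\<integral>\<^sup>+y. \<integral>\<^sup>+a. \<integral>\<^sup>+b. ennreal (?k y) * (ennreal (f a) * ennreal (f b) * ennreal (e s y a * e s y b)) \<partial>lborel \<partial>lborel \<partial>lborel)"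
    unfolding sq by (intro nn_integral_cong) (simp add: nn_integral_cmult)
  also have "\<dots> = (\<integral>\<^sup>+a. \<integral>\<^sup>+y. \<integral>\<^sup>+b. ennreal (?k y) * (ennreal (f a) * ennreal (f b) * ennreal (e s y a * e s y b)) \<partial>lborel \<partial>lborel \<partial>lborel)"
    by (rule lborel_pair.Fubini') (simp add: split_beta')
  also have "\<dots> = (\<integral>\<^sup>+a. \<integral>\<^sup>+b. \<integral>\<^sup>+y. ennreal (?k y) * (ennreal (f a) * ennreal (f b) * ennreal (e s y a * e s y b)) \<partial>lborel \<partial>lborel \<partial>lborel)"
    by (intro nn_integral_cong lborel_pair.Fubini') (simp add: split_beta')
  also have "\<dots> = (\<integral>\<^sup>+a. \<integral>\<^sup>+b. ennreal (f a) * ennreal (f b) * (\<integral>\<^sup>+y. ennreal (?k y * (e s y a * e s y b)) \<partial>lborel) \<partial>lborel \<partial>lborel)"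
    by (intro nn_integral_cong, subst nn_integral_cmult[symmetric]) (simp_all add: ennreal_mult e0 mult_ac)
  also have "\<dots> \<le> (\<integral>\<^sup>+a. \<integral>\<^sup>+b. ennreal (f a) * ennreal (f b) * ennreal (c * (e t x a * e t x b)) \<partial>lborel \<partial>lborel)"
    by (intro nn_integral_mono mult_left_mono) (simp_all only: e_def c_def heat_square_pair[OF \<theta> \<kappa> s] zero_le)
  also have "\<dots> = (\<integral>\<^sup>+a. \<integral>\<^sup>+b. ennreal c * (ennreal (f a) * ennreal (f b) * ennreal (e t x a * e t x b)) \<partial>lborel \<partial>lborel)"
    using c0 by (intro nn_integral_cong) (simp add: ennreal_mult e0 mult_ac)
  also have "\<dots> = ennreal c * (gauss_avg \<kappa> f t x)\<^sup>2"
    unfolding sq by (simp add: nn_integral_cmult)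
  finally show ?thesis unfolding c_def .
qed

text \<open>The squared kernel is a normal density of variance theta r / 2 divided by sqrt (4 pi
  theta r); the power -1/2 of \<open>r\<close> is integrable at 0.\<close>

lemma heat_square_mass:
  assumes \<theta>: "\<theta> > 0" and r: "r > 0"
  shows "(\<integral>\<^sup>+y. ennreal ((heat_kernel \<theta> r (x - y))\<^sup>2) \<partial>lborel) = ennreal (1 / sqrt (4 * pi * \<theta> * r))"
proof -
  have A: "\<theta> * r > 0" using assms by simp
  have "(\<integral>\<^sup>+y. ennreal ((heat_kernel \<theta> r (x - y))\<^sup>2) \<partial>lborel) = (\<integral>\<^sup>+y. ennreal (1 / (2 * pi * (\<theta> * r))) * ennreal (exp (- (y - x)\<^sup>2 / (\<theta> * r))) \<partial>lborel)"
    using A by (intro nn_integral_cong) (simp add: heat_kernel_square[OF assms] ennreal_mult[symmetric] power2_commute mult_ac)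
  also have "\<dots> = ennreal (1 / (2 * pi * (\<theta> * r))) * ennreal (sqrt (pi * (\<theta> * r)))"
    by (subst nn_integral_cmult) (simp_all only: nn_integral_gaussian[OF A], simp)
  also have "\<dots> = ennreal (sqrt (pi * (\<theta> * r)) / (2 * pi * (\<theta> * r)))"
    using A by (simp add: ennreal_mult[symmetric])
  also have "sqrt (pi * (\<theta> * r)) / (2 * pi * (\<theta> * r)) = 1 / sqrt (4 * pi * \<theta> * r)"
  proof -
    have "pi * (\<theta> * r) > 0" using A by simp
    then have "sqrt (pi * (\<theta> * r)) / (pi * (\<theta> * r)) = 1 / sqrt (pi * (\<theta> * r))"
      by (metis (no_types) less_eq_real_def real_div_sqrt divide_divide_eq_right divide_self_if inverse_eq_divide order_less_irrefl real_sqrt_gt_0_iff sqrt_divide_self_eq)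
    moreover have "sqrt (4 * pi * \<theta> * r) = 2 * sqrt (pi * (\<theta> * r))"
      by (simp add: real_sqrt_mult mult.assoc)
    ultimately show ?thesis by simp
  qed
  finally show ?thesis .
qed

section \<open>Time integrals with exponential weights and square-root singularities\<close>

lemma nn_integral_inverse_sqrt:
  assumes "\<epsilon> > 0"
  shows "(\<integral>\<^sup>+s. indicator {0<..<\<epsilon>} s * ennreal (1 / sqrt s) \<partial>lborel) \<le> ennreal (2 * sqrt \<epsilon>)"
proof -
  have "(\<integral>\<^sup>+s. indicator {0<..<\<epsilon>} s * ennreal (1 / sqrt s) \<partial>lborel) \<le> (\<integral>\<^sup>+s. ennreal (indicator {0..\<epsilon>} s * s powr (-1/2)) \<partial>lborel)"
  proof (rule nn_integral_mono)
    fix s :: real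
    show "indicator {0<..<\<epsilon>} s * ennreal (1 / sqrt s) \<le> ennreal (indicator {0..\<epsilon>} s * s powr (-1/2))"
      by (auto simp: indicator_def powr_minus powr_half_sqrt inverse_eq_divide)
  qed
  also have "\<dots> = ennreal (\<epsilon> powr (-1/2 + 1) / (-1/2 + 1))"
    by (rule nn_integral_has_integral_lebesgue[OF _ has_integral_powr_from_0]) (use assms in auto)
  also have "\<epsilon> powr (-1/2 + 1) / (-1/2 + 1) = 2 * sqrt \<epsilon>"
    using assms by (simp add: powr_half_sqrt)
  finally show ?thesis .
qed

lemma nn_integral_exp_window:
  fixes \<beta> t :: real
  assumes "\<beta> > 0" "t > 0"
  shows "(\<integral>\<^sup>+s. indicator {0<..<t} s * ennreal (exp (- \<beta> * (t - s))) \<partial>lborel) \<le> ennreal (1 / \<beta>)"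
proof -
  have "(\<integral>\<^sup>+s. indicator {0<..<t} s * ennreal (exp (- \<beta> * (t - s))) \<partial>lborel) \<le> (\<integral>\<^sup>+s. ennreal (exp (- \<beta> * (t - s))) * indicator {0..t} s \<partial>lborel)"
    by (intro nn_integral_mono) (auto simp: indicator_def)
  also have "\<dots> = ennreal (exp (- \<beta> * (t - t)) / \<beta> - exp (- \<beta> * (t - 0)) / \<beta>)"
    by (rule nn_integral_FTC_Icc[where F="\<lambda>s. exp (- \<beta> * (t - s)) / \<beta>"])
      (use assms in \<open>auto intro!: derivative_eq_intros\<close>)
  also have "\<dots> \<le> ennreal (1 / \<beta>)" using assms by (intro ennreal_leI) simp
  finally show ?thesis .
qed

text \<open>The two choices of \<open>h\<close> cover the singularity of the kernel at s = t and
  that of the weight at s = 0. The bound is uniform in \<open>t\<close>; its 3 is 1 from the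
  exponential window plus 2 from the singular stretch of length 1 / beta.\<close>

lemma nn_integral_exp_singular:
  fixes \<beta> t :: real and h :: "real \<Rightarrow> real"
  assumes \<beta>: "\<beta> > 0" and t: "t > 0" and h: "h = (\<lambda>s. s) \<or> h = (\<lambda>s. t - s)"
  shows "(\<integral>\<^sup>+s. indicator {0<..<t} s * ennreal (exp (- \<beta> * (t - s)) / sqrt (h s)) \<partial>lborel) \<le> ennreal (3 / sqrt \<beta>)"
proof -
  have hm[measurable]: "h \<in> borel_measurable borel" using h by auto
  have h0: "h s > 0" if "0 < s" "s < t" for s using h that by auto
  have "(\<integral>\<^sup>+s. indicator {0<..<1 / \<beta>} (h s) * ennreal (1 / sqrt (h s)) \<partial>lborel) = (\<integral>\<^sup>+s. indicator {0<..<1 / \<beta>} s * ennreal (1 / sqrt s) \<partial>lborel)"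
    using h
  proof
    assume "h = (\<lambda>s. t - s)"
    then show ?thesis
      using nn_integral_real_affine[of "\<lambda>s. indicator {0<..<1 / \<beta>} s * ennreal (1 / sqrt s)" "-1" t] by simp
  qed simp
  then have I2: "(\<integral>\<^sup>+s. indicator {0<..<1 / \<beta>} (h s) * ennreal (1 / sqrt (h s)) \<partial>lborel) \<le> ennreal (2 * sqrt (1 / \<beta>))"
    using nn_integral_inverse_sqrt[of "1 / \<beta>"] \<beta> by simp
  \<comment> \<open>The singular factor is at most \<open>sqrt \<beta>\<close> where \<open>h s \<ge> 1 / \<beta>\<close>, and elsewhere the exponential is at most 1.\<close>
  have "(\<integral>\<^sup>+s. indicator {0<..<t} s * ennreal (exp (- \<beta> * (t - s)) / sqrt (h s)) \<partial>lborel)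
     \<le> (\<integral>\<^sup>+s. ennreal (sqrt \<beta>) * (indicator {0<..<t} s * ennreal (exp (- \<beta> * (t - s)))) + indicator {0<..<1 / \<beta>} (h s) * ennreal (1 / sqrt (h s)) \<partial>lborel)"
  proof (rule nn_integral_mono)
    fix s :: real
    show "indicator {0<..<t} s * ennreal (exp (- \<beta> * (t - s)) / sqrt (h s)) \<le>
       ennreal (sqrt \<beta>) * (indicator {0<..<t} s * ennreal (exp (- \<beta> * (t - s)))) + indicator {0<..<1 / \<beta>} (h s) * ennreal (1 / sqrt (h s))"
    proof (cases "0 < s \<and> s < t")
      case True
      then have hs: "h s > 0" using h0 by auto
      show ?thesis
      proof (cases "h s < 1 / \<beta>")
        case c: True
        have "exp (- \<beta> * (t - s)) \<le> 1" using \<beta> True by simp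
        then have "ennreal (exp (- \<beta> * (t - s)) / sqrt (h s)) \<le> ennreal (1 / sqrt (h s))"
          using hs by (intro ennreal_leI divide_right_mono) auto
        also have "\<dots> \<le> ennreal (sqrt \<beta>) * ennreal (exp (- \<beta> * (t - s))) + ennreal (1 / sqrt (h s))" by simp
        finally show ?thesis using True c hs by simp
      next
        case False
        then have "1 / h s \<le> \<beta>" using hs \<beta> by (simp add: field_simps)
        then have "1 / sqrt (h s) \<le> sqrt \<beta>" using real_sqrt_le_mono[of "1 / h s" \<beta>] by (simp add: real_sqrt_divide)
        then have "exp (- \<beta> * (t - s)) * (1 / sqrt (h s)) \<le> exp (- \<beta> * (t - s)) * sqrt \<beta>" by (intro mult_left_mono) auto
        then have "ennreal (exp (- \<beta> * (t - s)) / sqrt (h s)) \<le> ennreal (sqrt \<beta>) * ennreal (exp (- \<beta> * (t - s)))"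
          using \<beta> by (simp add: ennreal_mult[symmetric] ennreal_leI mult.commute)
        then show ?thesis using True False by simp
      qed
    qed simp
  qed
  also have "\<dots> = ennreal (sqrt \<beta>) * (\<integral>\<^sup>+s. indicator {0<..<t} s * ennreal (exp (- \<beta> * (t - s))) \<partial>lborel)
      + (\<integral>\<^sup>+s. indicator {0<..<1 / \<beta>} (h s) * ennreal (1 / sqrt (h s)) \<partial>lborel)"
    by (subst nn_integral_add) (simp_all add: nn_integral_cmult)
  also have "\<dots> \<le> ennreal (sqrt \<beta>) * ennreal (1 / \<beta>) + ennreal (2 * sqrt (1 / \<beta>))"
    by (intro add_mono mult_left_mono nn_integral_exp_window I2 \<beta> t) simp
  also have "\<dots> = ennreal (sqrt \<beta> * (1 / \<beta>) + 2 * sqrt (1 / \<beta>))"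
    using \<beta> by (simp add: ennreal_mult[symmetric])
  also have "sqrt \<beta> * (1 / \<beta>) + 2 * sqrt (1 / \<beta>) = 3 / sqrt \<beta>"
  proof -
    have "sqrt \<beta> * (1 / \<beta>) = 1 / sqrt \<beta>" using \<beta> by (simp add: field_simps)
    then show ?thesis by (simp add: real_sqrt_divide)
  qed
  finally show ?thesis .
qed

section \<open>The Volterra operator on exponential and Gaussian weights\<close>

lemma case_prod_borel_measurable:
  "case_prod F \<in> borel_measurable borel \<longleftrightarrow> (\<lambda>z. F (fst z) (snd z)) \<in> borel_measurable (borel \<Otimes>\<^sub>M borel)"
  for F :: "real \<Rightarrow> real \<Rightarrow> ennreal"
  unfolding borel_prod by (simp add: split_beta')

lemma case_prod_borel_section:
  "case_prod F \<in> borel_measurable borel \<Longrightarrow> F s \<in> borel_measurable borel"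
  for F :: "real \<Rightarrow> real \<Rightarrow> ennreal"
  unfolding case_prod_borel_measurable
  using measurable_compose[OF measurable_Pair1'[of s borel borel], of "\<lambda>z. F (fst z) (snd z)" borel] by simp

lemma heat_square_integral_measurable:
  assumes "case_prod F \<in> borel_measurable borel"
  shows "(\<lambda>s. \<integral>\<^sup>+y. heat_sq \<theta> t x s y * F s y \<partial>lborel) \<in> borel_measurable borel"
proof -
  note [measurable] = assms[unfolded case_prod_borel_measurable]
  have "(\<lambda>s. \<integral>\<^sup>+y. heat_sq \<theta> t x s y * F s y \<partial>lborel) \<in> borel_measurable lborel"
    by (rule lborel.borel_measurable_nn_integral) (simp add: split_beta', measurable)
  then show ?thesis by simp
qed

lemma heat_square_integral_add:
  assumes F: "case_prod F \<in> borel_measurable borel" and G: "case_prod G \<in> borel_measurable borel"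
  shows "heat_square_integral \<theta> t x (\<lambda>s y. F s y + G s y) = heat_square_integral \<theta> t x F + heat_square_integral \<theta> t x G"
proof -
  note [measurable] = case_prod_borel_section[OF F] case_prod_borel_section[OF G]
    heat_square_integral_measurable[OF F] heat_square_integral_measurable[OF G]
  show ?thesis unfolding heat_square_integral_def
    by (simp add: distrib_left nn_integral_add)
qed

lemma heat_square_integral_cmult:
  assumes F: "case_prod F \<in> borel_measurable borel"
  shows "heat_square_integral \<theta> t x (\<lambda>s y. c * F s y) = c * heat_square_integral \<theta> t x F"
proof -
  note [measurable] = case_prod_borel_section[OF F] heat_square_integral_measurable[OF F]
  have "heat_square_integral \<theta> t x (\<lambda>s y. c * F s y) =
    (\<integral>\<^sup>+s. \<integral>\<^sup>+y. c * (heat_sq \<theta> t x s y * F s y) \<partial>lborel \<partial>lborel)"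
    unfolding heat_square_integral_def by (intro nn_integral_cong) (simp add: mult_ac)
  then show ?thesis unfolding heat_square_integral_def by (simp add: nn_integral_cmult)
qed

text \<open>Writing e^(beta s) as e^(beta t) e^(-beta (t - s)) leaves a time integral singular at s
  = t only. The factor beta^(-1/2) makes the operator small for large beta.\<close>

lemma heat_square_integral_exp:
  assumes \<theta>: "\<theta> > 0" and \<beta>: "\<beta> > 0" and t: "t > 0"
  shows "heat_square_integral \<theta> t x (\<lambda>s y. ennreal (exp (\<beta> * s))) \<le> ennreal (3 / (sqrt (4 * pi * \<theta>) * sqrt \<beta>)) * ennreal (exp (\<beta> * t))"
proof -
  define c where "c = exp (\<beta> * t) / sqrt (4 * pi * \<theta>)"
  have c: "c \<ge> 0" using \<theta> by (simp add: c_def)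
  have "heat_square_integral \<theta> t x (\<lambda>s y. ennreal (exp (\<beta> * s)))
    = (\<integral>\<^sup>+s. ennreal c * (indicator {0<..<t} s * ennreal (exp (- \<beta> * (t - s)) / sqrt (t - s))) \<partial>lborel)"
    unfolding heat_square_integral_def
  proof (rule nn_integral_cong)
    fix s :: real
    have "(\<integral>\<^sup>+y. heat_sq \<theta> t x s y * ennreal (exp (\<beta> * s)) \<partial>lborel)
      = indicator {0<..<t} s * ennreal (exp (\<beta> * s)) * (\<integral>\<^sup>+y. ennreal ((heat_kernel \<theta> (t - s) (x - y))\<^sup>2) \<partial>lborel)"
      by (subst nn_integral_cmult[symmetric]) (simp_all add: mult_ac)
    also have "\<dots> = ennreal c * (indicator {0<..<t} s * ennreal (exp (- \<beta> * (t - s)) / sqrt (t - s)))"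
    proof (cases "s \<in> {0<..<t}")
      case True
      have "exp (\<beta> * s) = exp (\<beta> * t) * exp (- \<beta> * (t - s))" by (simp add: exp_add[symmetric] algebra_simps)
      then have "exp (\<beta> * s) * (1 / sqrt (4 * pi * \<theta> * (t - s))) = c * (exp (- \<beta> * (t - s)) / sqrt (t - s))"
        by (simp add: c_def real_sqrt_mult)
      then have "ennreal (exp (\<beta> * s)) * ennreal (1 / sqrt (4 * pi * \<theta> * (t - s))) = ennreal c * ennreal (exp (- \<beta> * (t - s)) / sqrt (t - s))"
        using c by (simp only: ennreal_mult'[symmetric] exp_ge_zero)
      then show ?thesis using True heat_square_mass[OF \<theta>, of "t - s" x] by simp
    qed simp
    finally show "(\<integral>\<^sup>+y. heat_sq \<theta> t x s y * ennreal (exp (\<beta> * s)) \<partial>lborel)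
       = ennreal c * (indicator {0<..<t} s * ennreal (exp (- \<beta> * (t - s)) / sqrt (t - s)))" .
  qed
  also have "\<dots> = ennreal c * (\<integral>\<^sup>+s. indicator {0<..<t} s * ennreal (exp (- \<beta> * (t - s)) / sqrt (t - s)) \<partial>lborel)"
    by (rule nn_integral_cmult) simp
  also have "\<dots> \<le> ennreal c * ennreal (3 / sqrt \<beta>)"
    using nn_integral_exp_singular[OF \<beta> t, of "\<lambda>s. t - s"] by (intro mult_left_mono) auto
  also have "\<dots> = ennreal (3 / (sqrt (4 * pi * \<theta>) * sqrt \<beta>)) * ennreal (exp (\<beta> * t))"
    using \<theta> \<beta> c by (simp add: ennreal_mult[symmetric] c_def mult_ac)
  finally show ?thesis .
qed

text \<open>The factor 1 / s stems from the squared normalisation of the heat kernel in the initial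
  term. The parameter \<open>\<kappa>\<close> is \<open>\<theta>\<close> for second moments and
  \<open>2 * \<theta>\<close> for distances.\<close>

definition gauss_weight :: "real \<Rightarrow> real \<Rightarrow> (real \<Rightarrow> real) \<Rightarrow> real \<Rightarrow> real \<Rightarrow> ennreal" where
  "gauss_weight \<beta> \<kappa> f s y = ennreal (exp (\<beta> * s) / s) * (gauss_avg \<kappa> f s y)\<^sup>2"

lemma gauss_weight_measurable:
  assumes "f \<in> borel_measurable borel"
  shows "case_prod (gauss_weight \<beta> \<kappa> f) \<in> borel_measurable borel"
  unfolding case_prod_borel_measurable gauss_weight_def
  using gauss_avg_measurable[OF assms, of fst "borel \<Otimes>\<^sub>M borel" snd \<kappa>] by measurable

text \<open>\<open>heat_square_gauss_avg\<close> leaves, up to constants, the time factor e^(beta s)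
  / (sqrt t sqrt s sqrt (t - s)). The singularities at the two ends cost 3 / sqrt beta each, hence
  the 6.\<close>

lemma heat_square_integral_gauss_weight:
  assumes \<theta>: "\<theta> > 0" and \<kappa>: "\<theta> \<le> \<kappa>" and \<beta>: "\<beta> > 0" and t: "t > 0" and f: "f \<in> borel_measurable borel"
  shows "heat_square_integral \<theta> t x (gauss_weight \<beta> \<kappa> f) \<le>
    ennreal (6 * sqrt (\<kappa> / \<theta>) / (sqrt (4 * pi * \<theta>) * sqrt \<beta>)) * gauss_weight \<beta> \<kappa> f t x"
proof -
  define c where "c = sqrt (\<kappa> / \<theta>) / sqrt (4 * pi * \<theta>) * (exp (\<beta> * t) / t)"
  have c: "c \<ge> 0" using \<theta> \<kappa> t by (simp add: c_def)
  let ?E = "(gauss_avg \<kappa> f t x)\<^sup>2"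
  let ?T = "\<lambda>h s. indicator {0<..<t} s * ennreal (exp (- \<beta> * (t - s)) / sqrt (h s))"
  have "heat_square_integral \<theta> t x (gauss_weight \<beta> \<kappa> f) \<le> (\<integral>\<^sup>+s. (ennreal c * ?E) * (?T (\<lambda>s. s) s + ?T (\<lambda>s. t - s) s) \<partial>lborel)"
    unfolding heat_square_integral_def
  proof (rule nn_integral_mono)
    fix s :: real
    have [measurable]: "(\<lambda>y. gauss_avg \<kappa> f s y) \<in> borel_measurable borel" by (rule gauss_avg_measurable) (use f in auto)
    have "(\<integral>\<^sup>+y. heat_sq \<theta> t x s y * gauss_weight \<beta> \<kappa> f s y \<partial>lborel)
      = indicator {0<..<t} s * ennreal (exp (\<beta> * s) / s) * (\<integral>\<^sup>+y. ennreal ((heat_kernel \<theta> (t - s) (x - y))\<^sup>2) * (gauss_avg \<kappa> f s y)\<^sup>2 \<partial>lborel)"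
      by (subst nn_integral_cmult[symmetric]) (simp_all add: gauss_weight_def mult_ac)
    also have "\<dots> \<le> (ennreal c * ?E) * (?T (\<lambda>s. s) s + ?T (\<lambda>s. t - s) s)"
    proof (cases "0 < s \<and> s < t")
      case True
      then have s: "0 < s" "s < t" by auto
      let ?r = "t - s"
      \<comment> \<open>Division by sqrt t sqrt s sqrt (t - s) splits the doubly singular factor
        into two terms with one endpoint singularity each.\<close>
      have "sqrt t \<le> sqrt s + sqrt ?r" using sqrt_add_le_add_sqrt[of s ?r] s by simp
      then have "1 / (sqrt s * sqrt ?r) \<le> (1 / sqrt t) * (1 / sqrt s + 1 / sqrt ?r)"
        using s t by (simp add: field_simps)
      moreover have "sqrt s / s = 1 / sqrt s" using s by (simp add: field_simps)
      moreover have "exp (\<beta> * s) = exp (\<beta> * t) * exp (- \<beta> * ?r)" by (simp add: exp_add[symmetric] algebra_simps)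
      ultimately have "exp (\<beta> * s) / s * (sqrt (\<kappa> * s / (\<theta> * t)) / sqrt (4 * pi * \<theta> * ?r)) \<le>
         c * (exp (- \<beta> * ?r) / sqrt s + exp (- \<beta> * ?r) / sqrt ?r)"
      proof -
        assume a: "1 / (sqrt s * sqrt ?r) \<le> (1 / sqrt t) * (1 / sqrt s + 1 / sqrt ?r)"
          and b: "sqrt s / s = 1 / sqrt s" and e: "exp (\<beta> * s) = exp (\<beta> * t) * exp (- \<beta> * ?r)"
        define D where "D = sqrt (\<kappa> / \<theta>) / sqrt (4 * pi * \<theta>) * exp (\<beta> * t) * exp (- \<beta> * ?r) * (1 / sqrt t)"
        have coeff: "sqrt (\<kappa> * s / (\<theta> * t)) / sqrt (4 * pi * \<theta> * r) = sqrt (\<kappa> / \<theta>) / sqrt (4 * pi * \<theta>) * (1 / sqrt t) * (sqrt s / sqrt r)" for r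
          by (simp add: real_sqrt_mult real_sqrt_divide)
        have D: "D \<ge> 0" using \<theta> \<kappa> t by (simp add: D_def)
        have "exp (\<beta> * s) / s * (sqrt (\<kappa> * s / (\<theta> * t)) / sqrt (4 * pi * \<theta> * ?r)) = D * ((sqrt s / s) / sqrt ?r)"
          unfolding D_def e coeff by (simp add: divide_inverse mult_ac)
        also have "\<dots> = D * (1 / (sqrt s * sqrt ?r))" by (simp add: b)
        also have "\<dots> \<le> D * ((1 / sqrt t) * (1 / sqrt s + 1 / sqrt ?r))" by (intro mult_left_mono a D)
        also have "\<dots> = sqrt (\<kappa> / \<theta>) / sqrt (4 * pi * \<theta>) * exp (\<beta> * t) * ((1 / sqrt t) * (1 / sqrt t)) * (exp (- \<beta> * ?r) / sqrt s + exp (- \<beta> * ?r) / sqrt ?r)"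
        proof -
          have *: "exp (- \<beta> * ?r) / sqrt s + exp (- \<beta> * ?r) / sqrt ?r = exp (- \<beta> * ?r) * (1 / sqrt s + 1 / sqrt ?r)"
            by (simp add: distrib_left)
          show ?thesis unfolding * D_def by (simp only: mult_ac)
        qed
        also have "(1 / sqrt t) * (1 / sqrt t) = 1 / t" using t by simp
        finally show ?thesis by (simp add: c_def)
      qed
      then have le: "ennreal (exp (\<beta> * s) / s) * ennreal (sqrt (\<kappa> * s / (\<theta> * t)) / sqrt (4 * pi * \<theta> * ?r)) \<le>
         ennreal c * (ennreal (exp (- \<beta> * ?r) / sqrt s) + ennreal (exp (- \<beta> * ?r) / sqrt ?r))"
        using s c \<theta> \<kappa> t by (simp add: ennreal_mult[symmetric] ennreal_plus[symmetric] ennreal_leI del: ennreal_plus)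
      have "indicator {0<..<t} s * ennreal (exp (\<beta> * s) / s) * (\<integral>\<^sup>+y. ennreal ((heat_kernel \<theta> (t - s) (x - y))\<^sup>2) * (gauss_avg \<kappa> f s y)\<^sup>2 \<partial>lborel)
        \<le> ennreal (exp (\<beta> * s) / s) * (ennreal (sqrt (\<kappa> * s / (\<theta> * t)) / sqrt (4 * pi * \<theta> * ?r)) * ?E)"
        using True heat_square_gauss_avg[OF \<theta> \<kappa> s f, of x] by (simp add: mult_left_mono)
      also have "\<dots> \<le> (ennreal c * (ennreal (exp (- \<beta> * ?r) / sqrt s) + ennreal (exp (- \<beta> * ?r) / sqrt ?r))) * ?E"
        using mult_right_mono[OF le, of ?E] by (simp add: mult.assoc)
      finally show ?thesis using True by (simp add: mult_ac)
    qed simp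
    finally show "(\<integral>\<^sup>+y. heat_sq \<theta> t x s y * gauss_weight \<beta> \<kappa> f s y \<partial>lborel)
      \<le> (ennreal c * ?E) * (?T (\<lambda>s. s) s + ?T (\<lambda>s. t - s) s)" .
  qed
  also have "\<dots> = (ennreal c * ?E) * ((\<integral>\<^sup>+s. ?T (\<lambda>s. s) s \<partial>lborel) + (\<integral>\<^sup>+s. ?T (\<lambda>s. t - s) s \<partial>lborel))"
    by (subst nn_integral_cmult) (simp_all add: nn_integral_add)
  also have "\<dots> \<le> (ennreal c * ?E) * (ennreal (3 / sqrt \<beta>) + ennreal (3 / sqrt \<beta>))"
    using nn_integral_exp_singular[OF \<beta> t, of "\<lambda>s. t - s"] nn_integral_exp_singular[OF \<beta> t, of "\<lambda>s. s"]
    by (intro mult_left_mono add_mono) auto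
  also have "\<dots> = (ennreal c * ennreal (6 / sqrt \<beta>)) * ?E"
    using \<beta> by (simp add: ennreal_plus[symmetric] mult_ac del: ennreal_plus)
  also have "ennreal c * ennreal (6 / sqrt \<beta>) = ennreal (6 * sqrt (\<kappa> / \<theta>) / (sqrt (4 * pi * \<theta>) * sqrt \<beta>)) * ennreal (exp (\<beta> * t) / t)"
    using \<theta> \<kappa> \<beta> t c by (simp add: ennreal_mult[symmetric] c_def mult_ac)
  finally show ?thesis by (simp only: gauss_weight_def[of \<beta> \<kappa> f t x] mult.assoc)
qed

text \<open>A Gronwall argument by iteration: starting from the uniform bound \<open>B\<close>,
  every application of \<open>step\<close> halves the excess over the supersolution
  \<open>G\<close>, measured in the weight e^(beta s). Measurability enters through the majorants
  \<open>F\<close> only, so that an infimum such as \<open>cond_dist\<close> can serve as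
  \<open>n\<close>.\<close>

lemma heat_square_comparison:
  fixes n S G :: "real \<Rightarrow> real \<Rightarrow> ennreal"
  assumes bound: "\<And>s y. 0 < s \<Longrightarrow> s \<le> T \<Longrightarrow> n s y \<le> ennreal B" and \<beta>: "\<beta> \<ge> 0" and B: "B \<ge> 0"
    and step: "\<And>F t x. case_prod F \<in> borel_measurable borel \<Longrightarrow> 0 < t \<Longrightarrow> t \<le> T \<Longrightarrow>
      (\<And>s y. 0 < s \<Longrightarrow> s < t \<Longrightarrow> n s y \<le> F s y) \<Longrightarrow> n t x \<le> S t x + k * heat_square_integral \<theta> t x F"
    and G: "case_prod G \<in> borel_measurable borel"
    and super: "\<And>t x. 0 < t \<Longrightarrow> t \<le> T \<Longrightarrow> S t x + k * heat_square_integral \<theta> t x G \<le> G t x"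
    and contr: "\<And>t x. 0 < t \<Longrightarrow> t \<le> T \<Longrightarrow> k * heat_square_integral \<theta> t x (\<lambda>s y. ennreal (exp (\<beta> * s))) \<le> ennreal (1 / 2) * ennreal (exp (\<beta> * t))"
    and t: "0 < t" "t \<le> T"
  shows "n t x \<le> G t x"
proof -
  have em: "case_prod (\<lambda>s (y::real). ennreal (exp (\<beta> * s))) \<in> borel_measurable borel"
    unfolding case_prod_borel_measurable by measurable
  have iter: "n t x \<le> G t x + ennreal (B * (1/2)^m) * ennreal (exp (\<beta> * t))" if "0 < t" "t \<le> T" for m t x
    using that
  proof (induction m arbitrary: t x)
    case 0
    have "1 \<le> exp (\<beta> * t)" using \<beta> 0 by simp
    then have "ennreal B \<le> ennreal (B * exp (\<beta> * t))" using B by (intro ennreal_leI) (simp add: mult_le_cancel_left1)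
    also have "\<dots> \<le> G t x + ennreal (B * exp (\<beta> * t))" by simp
    finally show ?case using bound[OF 0, of x] B by (simp add: ennreal_mult)
  next
    case (Suc m)
    let ?c = "ennreal (B * (1/2)^m)"
    \<comment> \<open>The induction hypothesis is itself a measurable majorant. Linearity splits it
      into the supersolution, reproduced by \<open>super\<close>, and the excess, halved by
      \<open>contr\<close>.\<close>
    define F where "F = (\<lambda>s y. G s y + ?c * ennreal (exp (\<beta> * s)))"
    have cm: "case_prod (\<lambda>s (y::real). ?c * ennreal (exp (\<beta> * s))) \<in> borel_measurable borel"
      unfolding case_prod_borel_measurable by measurable
    have Fm: "case_prod F \<in> borel_measurable borel"
      using G cm unfolding F_def case_prod_borel_measurable by (rule borel_measurable_add)
    have "n t x \<le> S t x + k * heat_square_integral \<theta> t x F"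
      using Suc by (intro step[OF Fm]) (auto simp: F_def)
    also have "heat_square_integral \<theta> t x F = heat_square_integral \<theta> t x G + ?c * heat_square_integral \<theta> t x (\<lambda>s y. ennreal (exp (\<beta> * s)))"
      unfolding F_def by (simp only: heat_square_integral_add[OF G cm] heat_square_integral_cmult[OF em])
    also have "S t x + k * \<dots> = (S t x + k * heat_square_integral \<theta> t x G) + ?c * (k * heat_square_integral \<theta> t x (\<lambda>s y. ennreal (exp (\<beta> * s))))"
      by (simp add: distrib_left mult_ac add_ac)
    also have "\<dots> \<le> G t x + ?c * (ennreal (1 / 2) * ennreal (exp (\<beta> * t)))"
      using Suc by (intro add_mono mult_left_mono super contr) auto
    also have "?c * (ennreal (1 / 2) * ennreal (exp (\<beta> * t))) = ennreal (B * (1/2)^Suc m) * ennreal (exp (\<beta> * t))"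
    proof -
      have "ennreal p * (ennreal q * ennreal r) = ennreal (p * q) * ennreal r" if "p \<ge> 0" "q \<ge> 0" for p q r
        using that by (simp add: ennreal_mult mult.assoc)
      from this[of "B * (1/2)^m" "1/2" "exp (\<beta> * t)"] B show ?thesis by (simp add: mult_ac)
    qed
    finally show ?case .
  qed
  have "(\<lambda>m. G t x + ennreal (B * (1/2)^m) * ennreal (exp (\<beta> * t))) \<longlonglongrightarrow> G t x + ennreal (B * 0) * ennreal (exp (\<beta> * t))"
  proof (intro tendsto_add tendsto_const)
    have "(\<lambda>m. ennreal (B * (1/2)^m * exp (\<beta> * t))) \<longlonglongrightarrow> ennreal (B * 0 * exp (\<beta> * t))"
      by (intro tendsto_ennrealI tendsto_mult tendsto_const LIMSEQ_realpow_zero) auto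
    then show "(\<lambda>m. ennreal (B * (1/2)^m) * ennreal (exp (\<beta> * t))) \<longlonglongrightarrow> ennreal (B * 0) * ennreal (exp (\<beta> * t))"
      using B by (simp add: ennreal_mult)
  qed
  from LIMSEQ_le_const[OF this, of "n t x"] iter[OF t] show ?thesis by auto
qed

section \<open>Walsh integrals and mild solutions\<close>

lemma space_spacetime: "space spacetime = {0<..} \<times> UNIV"
  by (simp add: spacetime_def space_restrict_space)

lemma borel_measurable_spacetimeI: "f \<in> borel_measurable borel \<Longrightarrow> f \<in> borel_measurable spacetime"
  unfolding spacetime_def by (intro measurable_restrict_space1) simp

lemma nn_integral_spacetime:
  assumes F: "case_prod F \<in> borel_measurable borel"
  shows "(\<integral>\<^sup>+z. case_prod F z \<partial>spacetime) = (\<integral>\<^sup>+s. \<integral>\<^sup>+y. indicator {0<..} s * F s y \<partial>lborel \<partial>lborel)"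
proof -
  have F': "case_prod F \<in> borel_measurable (lborel \<Otimes>\<^sub>M lborel)" using F by (simp add: lborel_prod)
  have [measurable]: "(\<lambda>z. F (fst z) (snd z)) \<in> borel_measurable (lborel \<Otimes>\<^sub>M lborel)" using F' by (simp add: split_beta')
  have "(\<integral>\<^sup>+z. case_prod F z \<partial>spacetime) = (\<integral>\<^sup>+z. case_prod F z * indicator ({0<..} \<times> UNIV) z \<partial>lborel)"
    unfolding spacetime_def by (rule nn_integral_restrict_space) simp
  also have "\<dots> = (\<integral>\<^sup>+z. indicator {0<..} (fst z) * F (fst z) (snd z) \<partial>(lborel \<Otimes>\<^sub>M lborel))"
    by (simp add: lborel_prod) (auto intro!: nn_integral_cong simp: indicator_def)
  also have "\<dots> = (\<integral>\<^sup>+s. \<integral>\<^sup>+y. indicator {0<..} s * F s y \<partial>lborel \<partial>lborel)"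
    by (subst lborel.nn_integral_fst[symmetric]) simp_all
  finally show ?thesis .
qed

context noise begin

lemma space_predictable_algebra: "space (predictable_algebra M \<xi>) = space (spacetime \<Otimes>\<^sub>M M)"
  by (simp add: predictable_algebra_def space_measure_of_conv space_pair_measure space_spacetime)

lemma sets_predictable_algebra: "sets (predictable_algebra M \<xi>) \<subseteq> sets (spacetime \<Otimes>\<^sub>M M)"
proof -
  let ?G = "{({a<..b} \<times> A) \<times> F | a b A F.
        0 \<le> a \<and> a < b \<and> A \<in> sets borel \<and> F \<in> sets (noise_filtration M \<xi> a)}"
  have G: "?G \<subseteq> sets (spacetime \<Otimes>\<^sub>M M)"
  proof safe
    fix a b :: real and A :: "real set" and F
    assume ab: "0 \<le> a" "a < b" and A: "A \<in> sets borel" and F: "F \<in> sets (noise_filtration M \<xi> a)"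
    have "F \<in> sets M" using F noise_alg_subset[OF supp_in_subset] by (auto simp: noise_filtration_alg)
    moreover have "{a<..b} \<times> A \<in> sets spacetime"
    proof -
      have "{a<..b} \<times> A \<in> sets (borel \<Otimes>\<^sub>M borel)" using A by auto
      then have "{a<..b} \<times> A \<in> sets borel" unfolding borel_prod .
      then show ?thesis unfolding spacetime_def using ab by (subst sets_restrict_space_iff) auto
    qed
    ultimately show "({a<..b} \<times> A) \<times> F \<in> sets (spacetime \<Otimes>\<^sub>M M)" by auto
  qed
  have sp: "({0<..} \<times> UNIV) \<times> space M = space (spacetime \<Otimes>\<^sub>M M)"
    by (simp add: space_pair_measure space_spacetime)
  have "?G \<subseteq> Pow (space (spacetime \<Otimes>\<^sub>M M))" using G sets.space_closed by blast
  then have "sets (predictable_algebra M \<xi>) = sigma_sets (space (spacetime \<Otimes>\<^sub>M M)) ?G"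
    unfolding predictable_algebra_def sp by (rule sets_measure_of)
  then show ?thesis using sets.sigma_sets_subset[OF G] by simp
qed

lemma predictable_measurable:
  assumes "predictable M \<xi> \<Phi>"
  shows "(\<lambda>((s, y), \<omega>). \<Phi> s y \<omega>) \<in> borel_measurable (spacetime \<Otimes>\<^sub>M M)"
  using assms measurable_mono[OF order_refl refl sets_predictable_algebra space_predictable_algebra, of borel]
  unfolding predictable_def by auto

lemma predictable_section:
  assumes "predictable M \<xi> \<Phi>" "s > 0"
  shows "\<Phi> s y \<in> borel_measurable M"
proof -
  have "(\<lambda>\<omega>. ((s, y), \<omega>)) \<in> M \<rightarrow>\<^sub>M spacetime \<Otimes>\<^sub>M M"
    using assms(2) by (intro measurable_Pair1') (simp add: space_spacetime)
  from measurable_compose[OF this predictable_measurable[OF assms(1)]] show ?thesis by simp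
qed

text \<open>Below, \<open>d\<close> and \<open>r z\<close> are either the second moment or the distance to the noise over a region.\<close>
lemma walsh_bound:
  fixes d :: "('a \<Rightarrow> real) \<Rightarrow> ennreal" and r :: "real \<times> real \<Rightarrow> ('a \<Rightarrow> real) \<Rightarrow> ennreal"
  assumes Z: "has_walsh_integral M \<xi> \<Phi> Z"
    and d: "\<And>X X' \<epsilon>. X \<in> borel_measurable M \<Longrightarrow> X' \<in> borel_measurable M \<Longrightarrow> \<epsilon> > 0 \<Longrightarrow>
       d X \<le> ennreal (1 + \<epsilon>) * d X' + ennreal (1 + 1 / \<epsilon>) * second_moment (\<lambda>\<omega>. X \<omega> - X' \<omega>)"
    and r: "\<And>z X X' \<epsilon>. X \<in> borel_measurable M \<Longrightarrow> X' \<in> borel_measurable M \<Longrightarrow> \<epsilon> > 0 \<Longrightarrow>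
       r z X \<le> ennreal (1 + \<epsilon>) * r z X' + ennreal (1 + 1 / \<epsilon>) * second_moment (\<lambda>\<omega>. X \<omega> - X' \<omega>)"
    and elem: "\<And>\<Psi> J. elementary_integral M \<xi> \<Psi> J \<Longrightarrow> d J \<le> (\<integral>\<^sup>+z. r z (\<Psi> (fst z) (snd z)) \<partial>spacetime)"
    and f: "f \<in> borel_measurable spacetime" "\<And>s y. s > 0 \<Longrightarrow> r (s, y) (\<Phi> s y) \<le> f (s, y)"
  shows "d Z \<le> (\<integral>\<^sup>+z. f z \<partial>spacetime)"
proof -
  have \<Phi>: "predictable M \<xi> \<Phi>" and Zm: "Z \<in> borel_measurable M" using Z by (auto simp: has_walsh_integral_def)
  from Z obtain \<Psi> J where el: "\<And>n::nat. elementary_integral M \<xi> (\<Psi> n) (J n)"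
    and q0: "(\<lambda>n. \<integral>\<^sup>+((s, y), \<omega>). ennreal ((\<Psi> n s y \<omega> - \<Phi> s y \<omega>)\<^sup>2) \<partial>(spacetime \<Otimes>\<^sub>M M)) \<longlonglongrightarrow> 0"
    and j0: "(\<lambda>n. second_moment (\<lambda>\<omega>. J n \<omega> - Z \<omega>)) \<longlonglongrightarrow> 0"
    unfolding has_walsh_integral_def by auto
  define q where "q = (\<lambda>n z. second_moment (\<lambda>\<omega>. \<Psi> n (fst z) (snd z) \<omega> - \<Phi> (fst z) (snd z) \<omega>))"
  define j where "j = (\<lambda>n. second_moment (\<lambda>\<omega>. Z \<omega> - J n \<omega>))"
  have j0': "j \<longlonglongrightarrow> 0" using j0 by (simp add: j_def power2_commute)
  have meas: "(\<lambda>p. ennreal ((\<Psi> n (fst (fst p)) (snd (fst p)) (snd p) - \<Phi> (fst (fst p)) (snd (fst p)) (snd p))\<^sup>2))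
     \<in> borel_measurable (spacetime \<Otimes>\<^sub>M M)" for n
    using elementary_measurable(2)[OF el[of n]] predictable_measurable[OF \<Phi>] by (simp add: split_beta')
  have qm: "q n \<in> borel_measurable spacetime" for n
    unfolding q_def using borel_measurable_nn_integral_fst[OF meas[of n]] by simp
  have qI: "(\<integral>\<^sup>+((s, y), \<omega>). ennreal ((\<Psi> n s y \<omega> - \<Phi> s y \<omega>)\<^sup>2) \<partial>(spacetime \<Otimes>\<^sub>M M)) = (\<integral>\<^sup>+z. q n z \<partial>spacetime)" for n
    unfolding q_def using nn_integral_fst[OF meas[of n]] by (simp add: split_beta')
  have q0': "(\<lambda>n. \<integral>\<^sup>+z. q n z \<partial>spacetime) \<longlonglongrightarrow> 0" using q0 unfolding qI .
  define F where "F = (\<integral>\<^sup>+z. f z \<partial>spacetime)"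
  \<comment> \<open>One factor \<open>1 + \<epsilon>\<close> is lost in passing from
    \<open>\<Phi>\<close> to \<open>\<Psi> n\<close> at each point, another in passing from
    \<open>J n\<close> to \<open>Z\<close>. With \<open>\<epsilon>\<close> fixed the error terms
    vanish as n grows; afterwards \<open>\<epsilon>\<close> tends to 0.\<close>
  have main: "d Z \<le> ennreal (1 + \<epsilon>) * (ennreal (1 + \<epsilon>) * F)" if \<epsilon>: "\<epsilon> > 0" for \<epsilon>
  proof -
    have le: "d Z \<le> ennreal (1 + \<epsilon>) * (ennreal (1 + \<epsilon>) * F + ennreal (1 + 1 / \<epsilon>) * (\<integral>\<^sup>+z. q n z \<partial>spacetime))
       + ennreal (1 + 1 / \<epsilon>) * j n" for n
    proof -
      have "d (J n) \<le> (\<integral>\<^sup>+z. r z (\<Psi> n (fst z) (snd z)) \<partial>spacetime)" by (rule elem[OF el])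
      \<comment> \<open>\<open>r z\<close> is only compared pointwise; the integral is split after
        passing to the measurable functions \<open>f\<close> and \<open>q n\<close>.\<close>
      also have "\<dots> \<le> (\<integral>\<^sup>+z. ennreal (1 + \<epsilon>) * f z + ennreal (1 + 1 / \<epsilon>) * q n z \<partial>spacetime)"
      proof (rule nn_integral_mono)
        fix z assume z: "z \<in> space spacetime"
        then have s: "fst z > 0" by (auto simp: space_spacetime)
        have "r z (\<Psi> n (fst z) (snd z)) \<le> ennreal (1 + \<epsilon>) * r z (\<Phi> (fst z) (snd z)) + ennreal (1 + 1 / \<epsilon>) * q n z"
          unfolding q_def by (intro r \<epsilon> elementary_measurable(3)[OF el] predictable_section[OF \<Phi> s])
        also have "\<dots> \<le> ennreal (1 + \<epsilon>) * f z + ennreal (1 + 1 / \<epsilon>) * q n z"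
          using f(2)[OF s, of "snd z"] by (intro add_right_mono mult_left_mono) auto
        finally show "r z (\<Psi> n (fst z) (snd z)) \<le> ennreal (1 + \<epsilon>) * f z + ennreal (1 + 1 / \<epsilon>) * q n z" .
      qed
      also have "\<dots> = ennreal (1 + \<epsilon>) * F + ennreal (1 + 1 / \<epsilon>) * (\<integral>\<^sup>+z. q n z \<partial>spacetime)"
        unfolding F_def using f(1) qm by (simp add: nn_integral_add nn_integral_cmult del: ennreal_plus)
      finally have "d (J n) \<le> ennreal (1 + \<epsilon>) * F + ennreal (1 + 1 / \<epsilon>) * (\<integral>\<^sup>+z. q n z \<partial>spacetime)" .
      moreover have "d Z \<le> ennreal (1 + \<epsilon>) * d (J n) + ennreal (1 + 1 / \<epsilon>) * j n"
        unfolding j_def by (intro d \<epsilon> Zm elementary_measurable(1)[OF el])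
      ultimately show ?thesis
        by (meson add_right_mono mult_left_mono order_trans zero_le)
    qed
    have "(\<lambda>n. ennreal (1 + \<epsilon>) * (ennreal (1 + \<epsilon>) * F + ennreal (1 + 1 / \<epsilon>) * (\<integral>\<^sup>+z. q n z \<partial>spacetime)) + ennreal (1 + 1 / \<epsilon>) * j n)
       \<longlonglongrightarrow> ennreal (1 + \<epsilon>) * (ennreal (1 + \<epsilon>) * F + ennreal (1 + 1 / \<epsilon>) * 0) + ennreal (1 + 1 / \<epsilon>) * 0"
      by (intro tendsto_add ennreal_tendsto_cmult tendsto_const q0' j0') (simp_all del: ennreal_plus)
    from LIMSEQ_le_const[OF this, of "d Z"] le show ?thesis by auto
  qed
  show ?thesis
  proof (cases "F = \<top>")
    case False
    then obtain c where c: "F = ennreal c" "c \<ge> 0" by (cases F) auto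
    have "d Z \<le> ennreal ((1 + 1 / real (Suc n)) * ((1 + 1 / real (Suc n)) * c))" for n
      using main[of "1 / real (Suc n)"] c by (simp add: ennreal_mult[symmetric] del: ennreal_plus)
    moreover have "(\<lambda>n. ennreal ((1 + 1 / real (Suc n)) * ((1 + 1 / real (Suc n)) * c))) \<longlonglongrightarrow> ennreal ((1 + 0) * ((1 + 0) * c))"
      by (intro tendsto_ennrealI tendsto_mult tendsto_add tendsto_const LIMSEQ_Suc lim_1_over_n)
    ultimately show ?thesis using LIMSEQ_le_const c F_def by fastforce
  qed (simp add: F_def[symmetric])
qed

lemma walsh_second_moment:
  assumes Z: "has_walsh_integral M \<xi> \<Phi> Z"
    and f: "f \<in> borel_measurable spacetime" "\<And>s y. s > 0 \<Longrightarrow> second_moment (\<Phi> s y) \<le> f (s, y)"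
  shows "second_moment Z \<le> (\<integral>\<^sup>+z. f z \<partial>spacetime)"
proof (rule walsh_bound[where d="\<lambda>X. second_moment X" and r="\<lambda>_ X. second_moment X", OF Z _ _ _ f])
  fix \<Psi> J assume "elementary_integral M \<xi> \<Psi> J"
  then show "second_moment J \<le> (\<integral>\<^sup>+z. second_moment (\<Psi> (fst z) (snd z)) \<partial>spacetime)"
    by (simp add: elementary_isometry)
qed (use nn_integral_square_eps[of _ _ "\<lambda>_. 0"] in \<open>simp_all del: ennreal_plus\<close>)

text \<open>Here \<open>r z\<close> switches with the region as in
  \<open>elementary_cond_dist\<close>. Distance and second moment both satisfy the inequality with
  \<open>1 + \<epsilon>\<close>, so the bound survives the L^2 limit.\<close>

lemma walsh_cond_dist:
  assumes Z: "has_walsh_integral M \<xi> \<Phi> Z" and B: "B \<in> sets borel"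
    and f: "f \<in> borel_measurable spacetime"
      "\<And>s y. s > 0 \<Longrightarrow> y \<in> B \<Longrightarrow> cond_dist (UNIV \<times> B) (\<Phi> s y) \<le> f (s, y)"
      "\<And>s y. s > 0 \<Longrightarrow> y \<notin> B \<Longrightarrow> second_moment (\<Phi> s y) \<le> f (s, y)"
  shows "cond_dist (UNIV \<times> B) Z \<le> (\<integral>\<^sup>+z. f z \<partial>spacetime)"
proof (rule walsh_bound[where d="cond_dist (UNIV \<times> B)" and
      r="\<lambda>z X. if snd z \<in> B then cond_dist (UNIV \<times> B) X else second_moment X", OF Z _ _ _ f(1)])
  show "(if snd (s, y) \<in> B then cond_dist (UNIV \<times> B) (\<Phi> s y) else second_moment (\<Phi> s y)) \<le> f (s, y)" if "s > 0" for s y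
    using f(2,3)[OF that, of y] by simp
next
  fix z :: "real \<times> real" and X X' :: "'a \<Rightarrow> real" and \<epsilon> :: real
  assume a: "X \<in> borel_measurable M" "X' \<in> borel_measurable M" "\<epsilon> > 0"
  show "(if snd z \<in> B then cond_dist (UNIV \<times> B) X else second_moment X) \<le>
    ennreal (1 + \<epsilon>) * (if snd z \<in> B then cond_dist (UNIV \<times> B) X' else second_moment X')
     + ennreal (1 + 1 / \<epsilon>) * second_moment (\<lambda>\<omega>. X \<omega> - X' \<omega>)"
    using cond_dist_eps[OF a, of "UNIV \<times> B"] nn_integral_square_eps[OF a(1,2) _ a(3), of "\<lambda>_. 0"]
    by (simp del: ennreal_plus)
qed (use cond_dist_eps elementary_cond_dist[OF _ B] in auto)

end

lemma heat_square_integral_spacetime: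
  assumes F[measurable]: "case_prod F \<in> borel_measurable borel" and c: "c \<ge> 0"
  shows "(\<lambda>(s, y). ennreal c * (heat_sq \<theta> t x s y * F s y)) \<in> borel_measurable spacetime"
    "(\<integral>\<^sup>+z. (case z of (s, y) \<Rightarrow> ennreal c * (heat_sq \<theta> t x s y * F s y)) \<partial>spacetime)
      = ennreal c * heat_square_integral \<theta> t x F"
proof -
  let ?G = "\<lambda>s y. ennreal c * (heat_sq \<theta> t x s y * F s y)"
  have F'[measurable]: "(\<lambda>z. F (fst z) (snd z)) \<in> borel_measurable (borel \<Otimes>\<^sub>M borel)"
    using F unfolding borel_prod by (simp add: split_beta')
  have "(\<lambda>z. ?G (fst z) (snd z)) \<in> borel_measurable (borel \<Otimes>\<^sub>M borel)" by measurable
  then have G: "case_prod ?G \<in> borel_measurable borel" unfolding borel_prod by (simp add: split_beta')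
  then show "case_prod ?G \<in> borel_measurable spacetime" by (rule borel_measurable_spacetimeI)
  have [measurable]: "F s \<in> borel_measurable borel" for s
    using measurable_compose[OF measurable_Pair1'[of s borel borel] F'] by simp
  have [measurable]: "(\<lambda>s. \<integral>\<^sup>+y. heat_sq \<theta> t x s y * F s y \<partial>lborel) \<in> borel_measurable lborel"
    by (rule lborel.borel_measurable_nn_integral) (simp add: split_beta', measurable)
  have "(\<integral>\<^sup>+z. case_prod ?G z \<partial>spacetime) = (\<integral>\<^sup>+s. \<integral>\<^sup>+y. indicator {0<..} s * ?G s y \<partial>lborel \<partial>lborel)"
    by (rule nn_integral_spacetime[OF G])
  also have "\<dots> = (\<integral>\<^sup>+s. \<integral>\<^sup>+y. ?G s y \<partial>lborel \<partial>lborel)"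
    by (intro nn_integral_cong) (auto simp: indicator_def)
  also have "\<dots> = ennreal c * heat_square_integral \<theta> t x F"
    by (simp add: heat_square_integral_def nn_integral_cmult)
  finally show "(\<integral>\<^sup>+z. case_prod ?G z \<partial>spacetime) = ennreal c * heat_square_integral \<theta> t x F" .
qed

context noise begin

text \<open>\<open>\<sigma> 0 = 0\<close> turns the Lipschitz bound into linear growth without a
  constant term, which would destroy spatial decay.\<close>

lemma second_moment_integrand_le:
  assumes \<sigma>: "\<sigma> \<in> borel_measurable borel" "\<And>x y. \<bar>\<sigma> x - \<sigma> y\<bar> \<le> L * \<bar>x - y\<bar>" "\<sigma> 0 = 0"
    and X[measurable]: "X \<in> borel_measurable M" and le: "s \<in> {0<..<t} \<Longrightarrow> second_moment X \<le> F s y"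
  shows "second_moment (\<lambda>\<omega>. indicator {0<..<t} s * heat_kernel \<theta> (t - s) (x - y) * \<sigma> (X \<omega>))
    \<le> ennreal (L\<^sup>2) * (heat_sq \<theta> t x s y * F s y)"
proof (cases "s \<in> {0<..<t}")
  case True
  let ?k = "heat_kernel \<theta> (t - s) (x - y)"
  have "second_moment (\<lambda>\<omega>. indicator {0<..<t} s * ?k * \<sigma> (X \<omega>)) \<le>
    (\<integral>\<^sup>+\<omega>. ennreal (L\<^sup>2) * (ennreal (?k\<^sup>2) * ennreal ((X \<omega>)\<^sup>2)) \<partial>M)"
  proof (rule nn_integral_mono)
    fix \<omega>
    have "\<bar>\<sigma> (X \<omega>)\<bar>\<^sup>2 \<le> (L * \<bar>X \<omega>\<bar>)\<^sup>2" using \<sigma>(2)[of "X \<omega>" 0] \<sigma>(3) by (intro power_mono) auto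
    then have "?k\<^sup>2 * (\<sigma> (X \<omega>))\<^sup>2 \<le> ?k\<^sup>2 * (L\<^sup>2 * (X \<omega>)\<^sup>2)"
      by (intro mult_left_mono) (simp_all add: power_mult_distrib)
    then show "ennreal ((indicator {0<..<t} s * ?k * \<sigma> (X \<omega>))\<^sup>2) \<le> ennreal (L\<^sup>2) * (ennreal (?k\<^sup>2) * ennreal ((X \<omega>)\<^sup>2))"
      using True by (simp add: ennreal_mult[symmetric] power_mult_distrib ennreal_leI mult_ac)
  qed
  also have "\<dots> = ennreal (L\<^sup>2) * (ennreal (?k\<^sup>2) * second_moment X)"
    by (simp add: nn_integral_cmult)
  also have "\<dots> \<le> ennreal (L\<^sup>2) * (ennreal (?k\<^sup>2) * F s y)"
    by (intro mult_left_mono le True) auto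
  finally show ?thesis using True by simp
qed simp

lemma mild_solutionE:
  assumes mild: "mild_solution M \<xi> \<theta> \<sigma> u0 u" and t: "t > 0"
  obtains Z where
    "has_walsh_integral M \<xi> (\<lambda>s y \<omega>. indicator {0<..<t} s * heat_kernel \<theta> (t - s) (x - y) * \<sigma> (u s y \<omega>)) Z"
    "AE \<omega> in M. u t x \<omega> = heat_conv \<theta> u0 t x + Z \<omega>"
proof -
  from mild obtain I where
    I: "has_walsh_integral M \<xi> (\<lambda>s y \<omega>. indicator {0<..<t} s * heat_kernel \<theta> (t - s) (x - y) * \<sigma> (u s y \<omega>)) (I t x)"
    and eq: "AE \<omega> in M. \<forall>t>0. \<forall>x. u t x \<omega> = heat_conv \<theta> u0 t x + I t x \<omega>"
    using t unfolding mild_solution_def by blast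
  have "AE \<omega> in M. u t x \<omega> = heat_conv \<theta> u0 t x + I t x \<omega>" using eq by eventually_elim (use t in auto)
  with I show thesis by (rule that)
qed

text \<open>Separating the deterministic part by (a + b)^2 \<le> 2 a^2 + 2 b^2 doubles the Volterra
  coefficient. An arbitrary measurable majorant \<open>F\<close> is the form that
  \<open>heat_square_comparison\<close> consumes.\<close>

lemma second_moment_step:
  assumes mild: "mild_solution M \<xi> \<theta> \<sigma> u0 u"
    and \<sigma>: "\<sigma> \<in> borel_measurable borel" "\<And>x y. \<bar>\<sigma> x - \<sigma> y\<bar> \<le> L * \<bar>x - y\<bar>" "\<sigma> 0 = 0"
    and F: "case_prod F \<in> borel_measurable borel" and t: "t > 0"
    and le: "\<And>s y. 0 < s \<Longrightarrow> s < t \<Longrightarrow> second_moment (u s y) \<le> F s y"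
  shows "second_moment (u t x) \<le>
    ennreal (2 * (heat_conv \<theta> u0 t x)\<^sup>2) + ennreal (2 * L\<^sup>2) * heat_square_integral \<theta> t x F"
proof -
  from mild have pu: "predictable M \<xi> u" by (simp add: mild_solution_def)
  obtain Z where
    Z: "has_walsh_integral M \<xi> (\<lambda>s y \<omega>. indicator {0<..<t} s * heat_kernel \<theta> (t - s) (x - y) * \<sigma> (u s y \<omega>)) Z"
    and eq: "AE \<omega> in M. u t x \<omega> = heat_conv \<theta> u0 t x + Z \<omega>"
    by (rule mild_solutionE[OF mild t])
  have Zm[measurable]: "Z \<in> borel_measurable M" using Z by (simp add: has_walsh_integral_def)
  note G = heat_square_integral_spacetime[OF F, of "L\<^sup>2" t \<theta> x, simplified]
  have "second_moment Z \<le> (\<integral>\<^sup>+z. (case z of (s, y) \<Rightarrow> ennreal (L\<^sup>2) * (heat_sq \<theta> t x s y * F s y)) \<partial>spacetime)"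
  proof (rule walsh_second_moment[OF Z G(1)])
    fix s y :: real assume s: "s > 0"
    show "second_moment (\<lambda>\<omega>. indicator {0<..<t} s * heat_kernel \<theta> (t - s) (x - y) * \<sigma> (u s y \<omega>)) \<le>
       (case (s, y) of (s, y) \<Rightarrow> ennreal (L\<^sup>2) * (heat_sq \<theta> t x s y * F s y))"
      unfolding prod.case by (rule second_moment_integrand_le[OF \<sigma> predictable_section[OF pu s]]) (simp add: le)
  qed
  then have J: "second_moment Z \<le> ennreal (L\<^sup>2) * heat_square_integral \<theta> t x F" unfolding G(2) .
  have "second_moment (u t x) = second_moment (\<lambda>\<omega>. heat_conv \<theta> u0 t x + Z \<omega>)"
    using eq by (intro nn_integral_cong_AE) auto
  also have "\<dots> \<le> (\<integral>\<^sup>+\<omega>. ennreal (2 * (heat_conv \<theta> u0 t x)\<^sup>2) + 2 * ennreal ((Z \<omega>)\<^sup>2) \<partial>M)"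
  proof (rule nn_integral_mono)
    fix \<omega>
    have "(a + b)\<^sup>2 \<le> 2 * a\<^sup>2 + 2 * b\<^sup>2" for a b :: real
      using square_sum_eps[of 1 "a + b" 0 b] by simp
    from this[of "heat_conv \<theta> u0 t x" "Z \<omega>"]
    have "ennreal ((heat_conv \<theta> u0 t x + Z \<omega>)\<^sup>2) \<le> ennreal (2 * (heat_conv \<theta> u0 t x)\<^sup>2 + 2 * (Z \<omega>)\<^sup>2)"
      by (rule ennreal_leI)
    also have "\<dots> = ennreal (2 * (heat_conv \<theta> u0 t x)\<^sup>2) + 2 * ennreal ((Z \<omega>)\<^sup>2)"
      by (simp add: ennreal_mult)
    finally show "ennreal ((heat_conv \<theta> u0 t x + Z \<omega>)\<^sup>2) \<le> ennreal (2 * (heat_conv \<theta> u0 t x)\<^sup>2) + 2 * ennreal ((Z \<omega>)\<^sup>2)" .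
  qed
  also have "\<dots> = ennreal (2 * (heat_conv \<theta> u0 t x)\<^sup>2) + 2 * second_moment Z"
    by (simp add: nn_integral_add nn_integral_cmult emeasure_space_1)
  also have "\<dots> \<le> ennreal (2 * (heat_conv \<theta> u0 t x)\<^sup>2) + 2 * (ennreal (L\<^sup>2) * heat_square_integral \<theta> t x F)"
    by (intro add_left_mono mult_left_mono J) simp
  also have "\<dots> = ennreal (2 * (heat_conv \<theta> u0 t x)\<^sup>2) + ennreal (2 * L\<^sup>2) * heat_square_integral \<theta> t x F"
    by (simp add: ennreal_mult mult.assoc)
  finally show ?thesis .
qed

text \<open>Adding the deterministic \<open>heat_conv\<close> is a 1-Lipschitz map, so there is
  neither an initial term nor the factor 2 of \<open>second_moment_step\<close>.\<close>

lemma cond_dist_step: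
  assumes mild: "mild_solution M \<xi> \<theta> \<sigma> u0 u"
    and \<sigma>: "\<sigma> \<in> borel_measurable borel" "\<And>x y. \<bar>\<sigma> x - \<sigma> y\<bar> \<le> L * \<bar>x - y\<bar>" "\<sigma> 0 = 0"
    and F: "case_prod F \<in> borel_measurable borel" and t: "t > 0" and B: "B \<in> sets borel"
    and le: "\<And>s y. 0 < s \<Longrightarrow> s < t \<Longrightarrow> y \<in> B \<Longrightarrow> cond_dist (UNIV \<times> B) (u s y) \<le> F s y"
      "\<And>s y. 0 < s \<Longrightarrow> s < t \<Longrightarrow> y \<notin> B \<Longrightarrow> second_moment (u s y) \<le> F s y"
  shows "cond_dist (UNIV \<times> B) (u t x) \<le> ennreal (L\<^sup>2) * heat_square_integral \<theta> t x F"
proof -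
  from mild have pu: "predictable M \<xi> u" by (simp add: mild_solution_def)
  obtain Z where
    Z: "has_walsh_integral M \<xi> (\<lambda>s y \<omega>. indicator {0<..<t} s * heat_kernel \<theta> (t - s) (x - y) * \<sigma> (u s y \<omega>)) Z"
    and eq: "AE \<omega> in M. u t x \<omega> = heat_conv \<theta> u0 t x + Z \<omega>"
    by (rule mild_solutionE[OF mild t])
  have Zm[measurable]: "Z \<in> borel_measurable M" using Z by (simp add: has_walsh_integral_def)
  note G = heat_square_integral_spacetime[OF F, of "L\<^sup>2" t \<theta> x, simplified]
  have lip: "cond_dist R (\<lambda>\<omega>. c * \<sigma> (X \<omega>)) \<le> ennreal (c\<^sup>2) * (ennreal (L\<^sup>2) * cond_dist R X)"
    if "X \<in> borel_measurable M" for X :: "'a \<Rightarrow> real" and R c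
  proof -
    have "(\<lambda>x. c * \<sigma> x) \<in> borel_measurable borel" using \<sigma>(1) by measurable
    moreover have "\<bar>c * \<sigma> x - c * \<sigma> y\<bar> \<le> (\<bar>c\<bar> * L) * \<bar>x - y\<bar>" for x y
      using mult_left_mono[OF \<sigma>(2)[of x y], of "\<bar>c\<bar>"] by (simp add: abs_mult[symmetric] right_diff_distrib mult.assoc)
    ultimately have "cond_dist R (\<lambda>\<omega>. c * \<sigma> (X \<omega>)) \<le> ennreal ((\<bar>c\<bar> * L)\<^sup>2) * cond_dist R X"
      by (rule cond_dist_lipschitz[OF _ _ that])
    then show ?thesis by (simp add: power_mult_distrib ennreal_mult mult.assoc)
  qed
  have "cond_dist (UNIV \<times> B) Z \<le> (\<integral>\<^sup>+z. (case z of (s, y) \<Rightarrow> ennreal (L\<^sup>2) * (heat_sq \<theta> t x s y * F s y)) \<partial>spacetime)"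
  proof (rule walsh_cond_dist[OF Z B G(1)])
    fix s y :: real assume s: "s > 0" and y: "y \<in> B"
    let ?k = "heat_kernel \<theta> (t - s) (x - y)"
    show "cond_dist (UNIV \<times> B) (\<lambda>\<omega>. indicator {0<..<t} s * ?k * \<sigma> (u s y \<omega>)) \<le>
       (case (s, y) of (s, y) \<Rightarrow> ennreal (L\<^sup>2) * (heat_sq \<theta> t x s y * F s y))"
    proof (cases "s < t")
      case True
      have "cond_dist (UNIV \<times> B) (\<lambda>\<omega>. ?k * \<sigma> (u s y \<omega>)) \<le> ennreal (?k\<^sup>2) * (ennreal (L\<^sup>2) * cond_dist (UNIV \<times> B) (u s y))"
        by (rule lip[OF predictable_section[OF pu s]])
      also have "\<dots> \<le> ennreal (?k\<^sup>2) * (ennreal (L\<^sup>2) * F s y)"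
        by (intro mult_left_mono le s True y) auto
      finally show ?thesis using True s by (simp add: mult_ac)
    next
      case False
      then show ?thesis using cond_dist_le_second_moment[of "UNIV \<times> B" "\<lambda>_. 0"] by simp
    qed
  next
    fix s y :: real assume s: "s > 0" and y: "y \<notin> B"
    show "second_moment (\<lambda>\<omega>. indicator {0<..<t} s * heat_kernel \<theta> (t - s) (x - y) * \<sigma> (u s y \<omega>)) \<le>
       (case (s, y) of (s, y) \<Rightarrow> ennreal (L\<^sup>2) * (heat_sq \<theta> t x s y * F s y))"
      unfolding prod.case by (rule second_moment_integrand_le[OF \<sigma> predictable_section[OF pu s]]) (simp add: le y)
  qed
  then have J: "cond_dist (UNIV \<times> B) Z \<le> ennreal (L\<^sup>2) * heat_square_integral \<theta> t x F" unfolding G(2) .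
  have "cond_dist (UNIV \<times> B) (u t x) = cond_dist (UNIV \<times> B) (\<lambda>\<omega>. heat_conv \<theta> u0 t x + Z \<omega>)"
    by (rule cond_dist_cong_AE[OF eq])
  also have "\<dots> \<le> ennreal (1\<^sup>2) * cond_dist (UNIV \<times> B) Z"
    by (rule cond_dist_lipschitz[where f="\<lambda>x. heat_conv \<theta> u0 t _ + x"]) (use Zm in auto)
  finally show ?thesis using J by simp
qed

end

section \<open>Gaussian bounds for the initial data and the contraction constants\<close>

lemma heat_conv_square_le:
  assumes \<theta>: "\<theta> > 0" and t: "t > 0" and f: "integrable lborel f" and f0: "AE x in lborel. f x \<ge> 0"
  shows "ennreal ((heat_conv \<theta> f t x)\<^sup>2) \<le> ennreal (1 / (2 * pi * \<theta> * t)) * (gauss_avg \<theta> f t x)\<^sup>2"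
proof -
  have [measurable]: "f \<in> borel_measurable borel" using borel_measurable_integrable[OF f] by simp
  let ?c = "1 / sqrt (2 * pi * \<theta> * t)"
  have c: "?c \<ge> 0" "?c\<^sup>2 = 1 / (2 * pi * \<theta> * t)" using \<theta> t by (simp_all add: power_divide)
  have "ennreal \<bar>heat_conv \<theta> f t x\<bar> \<le> (\<integral>\<^sup>+y. ennreal \<bar>heat_kernel \<theta> t (x - y) * f y\<bar> \<partial>lborel)"
  \<comment> \<open>Without integrability the Bochner integral takes its default value 0, and the
    bound is trivial.\<close>
  proof (cases "integrable lborel (\<lambda>y. heat_kernel \<theta> t (x - y) * f y)")
    case True
    then show ?thesis unfolding heat_conv_def using integral_norm_bound_ennreal[OF True] by simp
  qed (simp add: heat_conv_def not_integrable_integral_eq)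
  also have "\<dots> = (\<integral>\<^sup>+y. ennreal ?c * (ennreal (f y) * ennreal (exp (- (x - y)\<^sup>2 / (2 * \<theta> * t)))) \<partial>lborel)"
  proof (rule nn_integral_cong_AE)
    show "AE y in lborel. ennreal \<bar>heat_kernel \<theta> t (x - y) * f y\<bar> = ennreal ?c * (ennreal (f y) * ennreal (exp (- (x - y)\<^sup>2 / (2 * \<theta> * t))))"
      using f0
    proof eventually_elim
      case (elim y)
      then have "\<bar>heat_kernel \<theta> t (x - y) * f y\<bar> = ?c * (f y * exp (- (x - y)\<^sup>2 / (2 * \<theta> * t)))"
        using \<theta> t by (simp add: heat_kernel_def)
      then show ?case using c elim by (simp only: ennreal_mult mult_nonneg_nonneg exp_ge_zero)
    qed
  qed
  also have "\<dots> = ennreal ?c * gauss_avg \<theta> f t x" unfolding gauss_avg_def by (rule nn_integral_cmult) measurable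
  finally have "(ennreal \<bar>heat_conv \<theta> f t x\<bar>)\<^sup>2 \<le> (ennreal ?c * gauss_avg \<theta> f t x)\<^sup>2" by (rule power_mono) simp
  moreover have "(ennreal \<bar>heat_conv \<theta> f t x\<bar>)\<^sup>2 = ennreal ((heat_conv \<theta> f t x)\<^sup>2)"
    by (simp add: ennreal_power)
  moreover have "(ennreal ?c * gauss_avg \<theta> f t x)\<^sup>2 = ennreal (?c\<^sup>2) * (gauss_avg \<theta> f t x)\<^sup>2"
    using c by (simp only: power_mult_distrib ennreal_power)
  ultimately show ?thesis using c by simp
qed

lemma gauss_avg_mono:
  assumes "0 < \<kappa>" "\<kappa> \<le> \<kappa>'" "t > 0"
  shows "gauss_avg \<kappa> f t x \<le> gauss_avg \<kappa>' f t x"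
  unfolding gauss_avg_def
proof (intro nn_integral_mono mult_left_mono ennreal_leI)
  fix a
  have "(x - a)\<^sup>2 / (2 * \<kappa>' * t) \<le> (x - a)\<^sup>2 / (2 * \<kappa> * t)"
    using assms by (intro divide_left_mono mult_right_mono mult_left_mono mult_pos_pos) auto
  then show "exp (- (x - a)\<^sup>2 / (2 * \<kappa> * t)) \<le> exp (- (x - a)\<^sup>2 / (2 * \<kappa>' * t))" by simp
qed simp

text \<open>(x - a)^2 / (2 theta t) is the sum of (x - a)^2 / (4 theta t) and the exponent of the
  average with 2 theta. The first half is at least delta^2 / (4 theta t) wherever \<open>f\<close>
  contributes; the second keeps the decay in \<open>x\<close>.\<close>

lemma gauss_avg_far:
  assumes \<theta>: "\<theta> > 0" and t: "t > 0" and f[measurable]: "f \<in> borel_measurable borel"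
    and far: "AE a in lborel. f a = 0 \<or> \<delta> \<le> \<bar>x - a\<bar>" and \<delta>: "\<delta> \<ge> 0"
  shows "gauss_avg \<theta> f t x \<le> ennreal (exp (- \<delta>\<^sup>2 / (4 * \<theta> * t))) * gauss_avg (2 * \<theta>) f t x"
proof -
  have "gauss_avg \<theta> f t x \<le> (\<integral>\<^sup>+a. ennreal (exp (- \<delta>\<^sup>2 / (4 * \<theta> * t))) * (ennreal (f a) * ennreal (exp (- (x - a)\<^sup>2 / (2 * (2 * \<theta>) * t)))) \<partial>lborel)"
    unfolding gauss_avg_def
  proof (rule nn_integral_mono_AE)
    show "AE a in lborel. ennreal (f a) * ennreal (exp (- (x - a)\<^sup>2 / (2 * \<theta> * t)))
        \<le> ennreal (exp (- \<delta>\<^sup>2 / (4 * \<theta> * t))) * (ennreal (f a) * ennreal (exp (- (x - a)\<^sup>2 / (2 * (2 * \<theta>) * t))))"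
      using far
    proof eventually_elim
      case (elim a)
      show ?case
      proof (cases "f a = 0")
        case False
        then have "\<delta>\<^sup>2 \<le> \<bar>x - a\<bar>\<^sup>2" using elim \<delta> by (intro power_mono) auto
        then have le: "\<delta>\<^sup>2 / (4 * \<theta> * t) \<le> (x - a)\<^sup>2 / (4 * \<theta> * t)" using \<theta> t by (intro divide_right_mono) auto
        have half: "z / (2 * \<theta> * t) = z / (4 * \<theta> * t) + z / (2 * (2 * \<theta>) * t)" for z
          using \<theta> t by (simp add: field_simps)
        have "exp (- (x - a)\<^sup>2 / (2 * \<theta> * t)) \<le> exp (- \<delta>\<^sup>2 / (4 * \<theta> * t)) * exp (- (x - a)\<^sup>2 / (2 * (2 * \<theta>) * t))"
          using le half[of "(x - a)\<^sup>2"] by (simp add: exp_add[symmetric])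
        then have "ennreal (exp (- (x - a)\<^sup>2 / (2 * \<theta> * t))) \<le> ennreal (exp (- \<delta>\<^sup>2 / (4 * \<theta> * t))) * ennreal (exp (- (x - a)\<^sup>2 / (2 * (2 * \<theta>) * t)))"
          by (simp only: ennreal_mult[symmetric] exp_ge_zero ennreal_leI)
        from mult_left_mono[OF this, of "ennreal (f a)"] show ?thesis by (simp only: mult.left_commute zero_le)
      qed simp
    qed
  qed
  also have "\<dots> = ennreal (exp (- \<delta>\<^sup>2 / (4 * \<theta> * t))) * gauss_avg (2 * \<theta>) f t x"
    unfolding gauss_avg_def by (rule nn_integral_cmult) measurable
  finally show ?thesis .
qed

text \<open>6 sqrt 2 is the worst constant: sqrt (kappa / theta) is at most sqrt 2 up to kappa = 2
  theta, and the pure exponential weight asks for 3. The factor 2 L^2 is the coefficient in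
  \<open>second_moment_step\<close>.\<close>

lemma heat_square_contraction:
  assumes \<theta>: "\<theta> > 0" and \<beta>: "\<beta> > 0" and t: "t > 0"
    and small: "2 * L\<^sup>2 * (6 * sqrt 2 / (sqrt (4 * pi * \<theta>) * sqrt \<beta>)) \<le> 1 / 2"
  shows "f \<in> borel_measurable borel \<Longrightarrow> \<theta> \<le> \<kappa> \<Longrightarrow> \<kappa> \<le> 2 * \<theta> \<Longrightarrow>
      ennreal (2 * L\<^sup>2) * heat_square_integral \<theta> t x (gauss_weight \<beta> \<kappa> f) \<le> ennreal (1 / 2) * gauss_weight \<beta> \<kappa> f t x"
    "ennreal (2 * L\<^sup>2) * heat_square_integral \<theta> t x (\<lambda>s y. ennreal (exp (\<beta> * s))) \<le> ennreal (1 / 2) * ennreal (exp (\<beta> * t))"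
proof -
  have le: "ennreal (2 * L\<^sup>2) * ennreal (c / (sqrt (4 * pi * \<theta>) * sqrt \<beta>)) \<le> ennreal (1 / 2)"
    if "0 \<le> c" "c \<le> 6 * sqrt 2" for c
  proof -
    have "2 * L\<^sup>2 * (c / (sqrt (4 * pi * \<theta>) * sqrt \<beta>)) \<le> 2 * L\<^sup>2 * (6 * sqrt 2 / (sqrt (4 * pi * \<theta>) * sqrt \<beta>))"
      using that \<theta> \<beta> by (intro mult_left_mono divide_right_mono) auto
    then have "2 * L\<^sup>2 * (c / (sqrt (4 * pi * \<theta>) * sqrt \<beta>)) \<le> 1 / 2" using small by linarith
    then show ?thesis by (subst ennreal_mult'[symmetric]) (simp_all only: ennreal_leI zero_le_power2 mult_nonneg_nonneg zero_le_numeral)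
  qed
  {
    assume f: "f \<in> borel_measurable borel" and \<kappa>: "\<theta> \<le> \<kappa>" "\<kappa> \<le> 2 * \<theta>"
    have "\<kappa> / \<theta> \<le> 2" using \<theta> \<kappa> by (simp add: field_simps)
    then have "ennreal (2 * L\<^sup>2) * ennreal (6 * sqrt (\<kappa> / \<theta>) / (sqrt (4 * pi * \<theta>) * sqrt \<beta>)) \<le> ennreal (1 / 2)"
      using \<theta> \<kappa> by (intro le) auto
    from mult_right_mono[OF this zero_le, of "gauss_weight \<beta> \<kappa> f t x"]
      mult_left_mono[OF heat_square_integral_gauss_weight[OF \<theta> \<kappa>(1) \<beta> t f, of x] zero_le, of "ennreal (2 * L\<^sup>2)"]
    show "ennreal (2 * L\<^sup>2) * heat_square_integral \<theta> t x (gauss_weight \<beta> \<kappa> f) \<le> ennreal (1 / 2) * gauss_weight \<beta> \<kappa> f t x"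
      unfolding mult.assoc[symmetric] by (rule order_trans[rotated])
  }
  have "3 \<le> 6 * sqrt (2::real)" using real_sqrt_ge_1_iff[of 2] by linarith
  then have "ennreal (2 * L\<^sup>2) * ennreal (3 / (sqrt (4 * pi * \<theta>) * sqrt \<beta>)) \<le> ennreal (1 / 2)" by (intro le) auto
  from mult_right_mono[OF this zero_le, of "ennreal (exp (\<beta> * t))"]
    mult_left_mono[OF heat_square_integral_exp[OF \<theta> \<beta> t, of x] zero_le, of "ennreal (2 * L\<^sup>2)"]
  show "ennreal (2 * L\<^sup>2) * heat_square_integral \<theta> t x (\<lambda>s y. ennreal (exp (\<beta> * s))) \<le> ennreal (1 / 2) * ennreal (exp (\<beta> * t))"
    unfolding mult.assoc[symmetric] by (rule order_trans[rotated])
qed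

text \<open>The last assumption makes the Volterra operator of the moment bounds a contraction by 1/2 with
  respect to the weights \<open>exp (\<beta> t)\<close> and \<open>gauss_weight\<close>.\<close>
locale mild_solution_bound = noise M \<xi> for M :: "'a measure" and \<xi> +
  fixes \<theta> L \<beta> :: real and \<sigma> u0 :: "real \<Rightarrow> real" and u :: "real \<Rightarrow> real \<Rightarrow> 'a \<Rightarrow> real"
  assumes \<theta>: "\<theta> > 0" and mild: "mild_solution M \<xi> \<theta> \<sigma> u0 u"
    and \<sigma>: "\<sigma> \<in> borel_measurable borel" "\<And>x y. \<bar>\<sigma> x - \<sigma> y\<bar> \<le> L * \<bar>x - y\<bar>" "\<sigma> 0 = 0"
    and u0: "integrable lborel u0" "AE x in lborel. u0 x \<ge> 0"
    and \<beta>: "\<beta> > 0" and small: "2 * L\<^sup>2 * (6 * sqrt 2 / (sqrt (4 * pi * \<theta>) * sqrt \<beta>)) \<le> 1 / 2"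
begin

lemma predictable_solution: "predictable M \<xi> u"
  using mild by (simp add: mild_solution_def)

lemma u0_borel: "u0 \<in> borel_measurable borel"
  using borel_measurable_integrable[OF u0(1)] by simp

lemma second_moment_finite:
  assumes "T > 0"
  obtains B where "B \<ge> 0" "\<And>s y. 0 < s \<Longrightarrow> s \<le> T \<Longrightarrow> second_moment (u s y) \<le> ennreal B"
proof -
  let ?S = "SUP t\<in>{0<..T}. SUP x. second_moment (u t x)"
  have "?S < \<infinity>" using mild assms by (simp add: mild_solution_def)
  then obtain B where B: "B \<ge> 0" "?S = ennreal B" by (cases ?S) auto
  have "second_moment (u s y) \<le> ennreal B" if "0 < s" "s \<le> T" for s y
  proof -
    have "second_moment (u s y) \<le> (SUP x. second_moment (u s x))" by (rule SUP_upper) simp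
    also have "\<dots> \<le> ?S" by (rule SUP_upper) (use that in simp)
    finally show ?thesis using B by simp
  qed
  with B(1) that show ?thesis by blast
qed

text \<open>Half of the constant 2 / (pi theta) pays for the initial term, by
  \<open>heat_conv_square_le\<close>; the contraction by 1/2 leaves the other half for the Volterra
  term.\<close>

lemma second_moment_bound:
  assumes t: "t > 0"
  shows "second_moment (u t x) \<le> ennreal (2 / (pi * \<theta>)) * gauss_weight \<beta> \<theta> u0 t x"
proof -
  define C where "C = ennreal (2 / (pi * \<theta>))"
  define G where "G = (\<lambda>s y. C * gauss_weight \<beta> \<theta> u0 s y)"
  have Wm: "case_prod (gauss_weight \<beta> \<theta> u0) \<in> borel_measurable borel" by (rule gauss_weight_measurable[OF u0_borel])
  have Gm: "case_prod G \<in> borel_measurable borel"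
    using Wm unfolding G_def case_prod_borel_measurable by (rule measurable_compose) simp
  obtain B where B: "B \<ge> 0" "\<And>s y. 0 < s \<Longrightarrow> s \<le> t \<Longrightarrow> second_moment (u s y) \<le> ennreal B"
    using second_moment_finite[OF t] by blast
  have "second_moment (u t x) \<le> G t x"
  proof (rule heat_square_comparison[where n="\<lambda>s y. second_moment (u s y)" and T=t and B=B and \<beta>=\<beta>
        and S="\<lambda>s y. ennreal (2 * (heat_conv \<theta> u0 s y)\<^sup>2)" and k="ennreal (2 * L\<^sup>2)" and \<theta>=\<theta>])
    fix F :: "real \<Rightarrow> real \<Rightarrow> ennreal" and r x assume "case_prod F \<in> borel_measurable borel" "0 < r" "r \<le> t"
      "\<And>s y. 0 < s \<Longrightarrow> s < r \<Longrightarrow> second_moment (u s y) \<le> F s y"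
    then show "second_moment (u r x) \<le> ennreal (2 * (heat_conv \<theta> u0 r x)\<^sup>2) + ennreal (2 * L\<^sup>2) * heat_square_integral \<theta> r x F"
      by (intro second_moment_step[OF mild \<sigma>])
  next
    fix r x assume r: "0 < r" "r \<le> t"
    let ?W = "gauss_weight \<beta> \<theta> u0 r x"
    have "ennreal (2 * (heat_conv \<theta> u0 r x)\<^sup>2) \<le> ennreal 2 * (ennreal (1 / (2 * pi * \<theta> * r)) * (gauss_avg \<theta> u0 r x)\<^sup>2)"
      using mult_left_mono[OF heat_conv_square_le[OF \<theta> r(1) u0, of x], of "ennreal 2"] by (simp add: ennreal_mult)
    also have "\<dots> = ennreal (2 * (1 / (2 * pi * \<theta> * r))) * (gauss_avg \<theta> u0 r x)\<^sup>2"
      using \<theta> r by (subst ennreal_mult) (simp_all add: mult.assoc)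
    also have "\<dots> \<le> ennreal (1 / (pi * \<theta>) * (exp (\<beta> * r) / r)) * (gauss_avg \<theta> u0 r x)\<^sup>2"
    proof (intro mult_right_mono ennreal_leI)
      have "1 \<le> exp (\<beta> * r)" using \<beta> r by simp
      then have "1 / (pi * \<theta> * r) \<le> exp (\<beta> * r) / (pi * \<theta> * r)" using \<theta> r by (intro divide_right_mono) auto
      then show "2 * (1 / (2 * pi * \<theta> * r)) \<le> 1 / (pi * \<theta>) * (exp (\<beta> * r) / r)" by simp
    qed simp
    also have "\<dots> = ennreal (1 / (pi * \<theta>)) * ?W"
      using \<theta> r unfolding gauss_weight_def by (subst ennreal_mult) (simp_all add: mult.assoc)
    finally have 1: "ennreal (2 * (heat_conv \<theta> u0 r x)\<^sup>2) \<le> ennreal (1 / (pi * \<theta>)) * ?W" .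
    have "ennreal (2 * L\<^sup>2) * heat_square_integral \<theta> r x G = C * (ennreal (2 * L\<^sup>2) * heat_square_integral \<theta> r x (gauss_weight \<beta> \<theta> u0))"
      unfolding G_def heat_square_integral_cmult[OF Wm] by (simp add: mult_ac)
    also have "\<dots> \<le> C * (ennreal (1 / 2) * ?W)"
      using \<theta> by (intro mult_left_mono heat_square_contraction(1)[OF \<theta> \<beta> r(1) small u0_borel]) auto
    also have "\<dots> = ennreal (1 / (pi * \<theta>)) * ?W"
    proof -
      have "C * ennreal (1 / 2) = ennreal (2 / (pi * \<theta>) * (1 / 2))"
        unfolding C_def using \<theta> by (intro ennreal_mult[symmetric]) auto
      then show ?thesis by (simp only: mult.assoc[symmetric]) simp
    qed
    finally have 2: "ennreal (2 * L\<^sup>2) * heat_square_integral \<theta> r x G \<le> ennreal (1 / (pi * \<theta>)) * ?W" .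
    have "ennreal (1 / (pi * \<theta>)) * ?W + ennreal (1 / (pi * \<theta>)) * ?W = G r x"
      using \<theta> unfolding G_def C_def by (simp add: distrib_right[symmetric] ennreal_plus[symmetric] del: ennreal_plus)
    with add_mono[OF 1 2]
    show "ennreal (2 * (heat_conv \<theta> u0 r x)\<^sup>2) + ennreal (2 * L\<^sup>2) * heat_square_integral \<theta> r x G \<le> G r x" by simp
  next
    fix r x assume "0 < r" "r \<le> t"
    then show "ennreal (2 * L\<^sup>2) * heat_square_integral \<theta> r x (\<lambda>s y. ennreal (exp (\<beta> * s))) \<le> ennreal (1 / 2) * ennreal (exp (\<beta> * r))"
      by (intro heat_square_contraction(2)[OF \<theta> \<beta> _ small])
  qed (use B \<beta> Gm t in auto)
  then show ?thesis by (simp add: G_def C_def)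
qed

lemma gauss_weight_mono:
  assumes "0 < \<kappa>" "\<kappa> \<le> \<kappa>'" "t > 0"
  shows "gauss_weight \<beta> \<kappa> f t x \<le> gauss_weight \<beta> \<kappa>' f t x"
  unfolding gauss_weight_def by (intro mult_left_mono power_mono gauss_avg_mono assms) auto

text \<open>The comparison function \<open>G\<close> carries the square of the factor of
  \<open>gauss_avg_far\<close>, taken at the final time. Off \<open>A\<close> it dominates the
  second moment, which thus becomes the source of the inequality for the distance. A constant
  multiple of a supersolution stays one, so the small factor survives the iteration.\<close>

lemma cond_dist_bound:
  assumes t: "t > 0" and A: "A \<in> sets borel" and \<delta>: "\<delta> \<ge> 0"
    and far: "\<And>y. y \<notin> A \<Longrightarrow> AE a in lborel. u0 a = 0 \<or> \<delta> \<le> \<bar>y - a\<bar>"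
  shows "cond_dist (UNIV \<times> A) (u t x) \<le> ennreal (exp (- \<delta>\<^sup>2 / (2 * \<theta> * t)) * (2 / (pi * \<theta>))) * gauss_weight \<beta> (2 * \<theta>) u0 t x"
proof -
  define e where "e = exp (- \<delta>\<^sup>2 / (2 * \<theta> * t))"
  define C where "C = ennreal (e * (2 / (pi * \<theta>)))"
  define G where "G = (\<lambda>s y. C * gauss_weight \<beta> (2 * \<theta>) u0 s y)"
  have Wm: "case_prod (gauss_weight \<beta> (2 * \<theta>) u0) \<in> borel_measurable borel" by (rule gauss_weight_measurable[OF u0_borel])
  have Gm: "case_prod G \<in> borel_measurable borel"
    using Wm unfolding G_def case_prod_borel_measurable by (rule measurable_compose) simp
  obtain B where B: "B \<ge> 0" "\<And>s y. 0 < s \<Longrightarrow> s \<le> t \<Longrightarrow> second_moment (u s y) \<le> ennreal B"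
    using second_moment_finite[OF t] by blast
  \<comment> \<open>The Gaussian factor at an earlier time \<open>s\<close> is smaller than at
    \<open>t\<close>, so the one at \<open>t\<close> serves all of them.\<close>
  have off: "second_moment (u s y) \<le> G s y" if s: "0 < s" "s \<le> t" and y: "y \<notin> A" for s y
  proof -
    have "(gauss_avg \<theta> u0 s y)\<^sup>2 \<le> (ennreal (exp (- \<delta>\<^sup>2 / (4 * \<theta> * s))) * gauss_avg (2 * \<theta>) u0 s y)\<^sup>2"
      by (intro power_mono gauss_avg_far[OF \<theta> s(1) u0_borel far[OF y] \<delta>]) simp
    also have "\<dots> = ennreal ((exp (- \<delta>\<^sup>2 / (4 * \<theta> * s)))\<^sup>2) * (gauss_avg (2 * \<theta>) u0 s y)\<^sup>2"
      by (simp only: power_mult_distrib ennreal_power exp_ge_zero)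
    also have "\<dots> \<le> ennreal e * (gauss_avg (2 * \<theta>) u0 s y)\<^sup>2"
    proof (intro mult_right_mono ennreal_leI)
      have "(exp (- \<delta>\<^sup>2 / (4 * \<theta> * s)))\<^sup>2 = exp (- \<delta>\<^sup>2 / (2 * \<theta> * s))"
        by (simp add: exp_double[symmetric])
      moreover have "\<delta>\<^sup>2 / (2 * \<theta> * t) \<le> \<delta>\<^sup>2 / (2 * \<theta> * s)"
        using \<theta> s by (intro divide_left_mono mult_left_mono mult_pos_pos) auto
      ultimately show "(exp (- \<delta>\<^sup>2 / (4 * \<theta> * s)))\<^sup>2 \<le> e" by (simp add: e_def)
    qed simp
    finally have far2: "(gauss_avg \<theta> u0 s y)\<^sup>2 \<le> ennreal e * (gauss_avg (2 * \<theta>) u0 s y)\<^sup>2" .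
    have "second_moment (u s y) \<le> ennreal (2 / (pi * \<theta>)) * (ennreal (exp (\<beta> * s) / s) * (gauss_avg \<theta> u0 s y)\<^sup>2)"
      using second_moment_bound[OF s(1), of y] by (simp add: gauss_weight_def)
    also have "\<dots> \<le> ennreal (2 / (pi * \<theta>)) * (ennreal (exp (\<beta> * s) / s) * (ennreal e * (gauss_avg (2 * \<theta>) u0 s y)\<^sup>2))"
      by (intro mult_left_mono far2) auto
    also have "\<dots> = G s y"
    proof -
      have "C = ennreal e * ennreal (2 / (pi * \<theta>))"
        unfolding C_def using \<theta> by (intro ennreal_mult) (auto simp: e_def)
      then show ?thesis unfolding G_def gauss_weight_def by (simp only: mult_ac)
    qed
    finally show ?thesis .
  qed
  have L2: "ennreal (L\<^sup>2) * z + ennreal (L\<^sup>2) * z = ennreal (2 * L\<^sup>2) * z" for z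
    by (simp add: distrib_right[symmetric] ennreal_plus[symmetric] del: ennreal_plus)
  have "cond_dist (UNIV \<times> A) (u t x) \<le> G t x"
  proof (rule heat_square_comparison[where n="\<lambda>s y. cond_dist (UNIV \<times> A) (u s y)" and T=t and B=B and \<beta>=\<beta>
        and S="\<lambda>s y. ennreal (L\<^sup>2) * heat_square_integral \<theta> s y G" and k="ennreal (L\<^sup>2)" and \<theta>=\<theta>])
    fix F :: "real \<Rightarrow> real \<Rightarrow> ennreal" and r x assume F: "case_prod F \<in> borel_measurable borel" "0 < r" "r \<le> t"
      "\<And>s y. 0 < s \<Longrightarrow> s < r \<Longrightarrow> cond_dist (UNIV \<times> A) (u s y) \<le> F s y"
    \<comment> \<open>The sum is a common measurable majorant for both cases of
      \<open>cond_dist_step\<close>. Counting both functions everywhere costs L^2 twice, which the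
      coefficient 2 L^2 in \<open>small\<close> covers.\<close>
    have GF: "case_prod (\<lambda>s y. G s y + F s y) \<in> borel_measurable borel"
      using Gm F(1) unfolding case_prod_borel_measurable by (rule borel_measurable_add)
    have "cond_dist (UNIV \<times> A) (u r x) \<le> ennreal (L\<^sup>2) * heat_square_integral \<theta> r x (\<lambda>s y. G s y + F s y)"
    proof (rule cond_dist_step[OF mild \<sigma> GF F(2) A])
      fix s y assume "0 < s" "s < r" "y \<in> A"
      then show "cond_dist (UNIV \<times> A) (u s y) \<le> G s y + F s y" using F(4)[of s y] by (simp add: add_increasing)
    next
      fix s y assume "0 < s" "s < r" "y \<notin> A"
      then show "second_moment (u s y) \<le> G s y + F s y" using off[of s y] F(3) by (simp add: add_increasing2)
    qed
    then show "cond_dist (UNIV \<times> A) (u r x) \<le> ennreal (L\<^sup>2) * heat_square_integral \<theta> r x G + ennreal (L\<^sup>2) * heat_square_integral \<theta> r x F"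
      by (simp only: heat_square_integral_add[OF Gm F(1)] distrib_left)
  next
    fix r x assume r: "0 < r" "r \<le> t"
    let ?W = "gauss_weight \<beta> (2 * \<theta>) u0 r x"
    have "ennreal (2 * L\<^sup>2) * heat_square_integral \<theta> r x G = C * (ennreal (2 * L\<^sup>2) * heat_square_integral \<theta> r x (gauss_weight \<beta> (2 * \<theta>) u0))"
      unfolding G_def heat_square_integral_cmult[OF Wm] by (simp add: mult_ac)
    also have "\<dots> \<le> C * (ennreal (1 / 2) * ?W)"
      using \<theta> by (intro mult_left_mono heat_square_contraction(1)[OF \<theta> \<beta> r(1) small u0_borel]) auto
    also have "\<dots> \<le> C * (1 * ?W)"
      using ennreal_leI[of "1/2" 1] by (intro mult_left_mono mult_right_mono) auto
    finally show "ennreal (L\<^sup>2) * heat_square_integral \<theta> r x G + ennreal (L\<^sup>2) * heat_square_integral \<theta> r x G \<le> G r x"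
      unfolding L2 by (simp add: G_def)
  next
    fix r x assume r: "0 < r" "r \<le> t"
    have "ennreal (L\<^sup>2) * z \<le> ennreal (2 * L\<^sup>2) * z" for z by (intro mult_right_mono ennreal_leI) auto
    then show "ennreal (L\<^sup>2) * heat_square_integral \<theta> r x (\<lambda>s y. ennreal (exp (\<beta> * s))) \<le> ennreal (1 / 2) * ennreal (exp (\<beta> * r))"
      using heat_square_contraction(2)[OF \<theta> \<beta> r(1) small, of x] by (rule order_trans)
  qed (use B \<beta> Gm t in \<open>auto intro: order_trans[OF cond_dist_le_second_moment]\<close>)
  then show ?thesis by (simp add: G_def C_def e_def)
qed

end

section \<open>Covariance of the total masses\<close>

text \<open>Weighted arithmetic-geometric inequality for the centred \<open>P\<close> and for
  \<open>Q\<close>; the free weight \<open>l\<close> takes the place of the square roots of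
  Cauchy-Schwarz.\<close>

lemma (in prob_space) covariance_weighted_le:
  fixes P Q :: "'a \<Rightarrow> real"
  assumes [measurable]: "P \<in> borel_measurable M" "Q \<in> borel_measurable M"
    and P: "integrable M (\<lambda>\<omega>. (P \<omega>)\<^sup>2)" and Q: "integrable M (\<lambda>\<omega>. (Q \<omega>)\<^sup>2)" and l: "l > 0"
  shows "integrable M (\<lambda>\<omega>. P \<omega> * Q \<omega>)"
    "expectation (\<lambda>\<omega>. P \<omega> * Q \<omega>) - expectation P * expectation Q
      \<le> (l * expectation (\<lambda>\<omega>. (P \<omega>)\<^sup>2) + expectation (\<lambda>\<omega>. (Q \<omega>)\<^sup>2) / l) / 2"
proof -
  have iP: "integrable M P" and iQ: "integrable M Q"
    using square_integrable_imp_integrable[OF _ P] square_integrable_imp_integrable[OF _ Q] by auto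
  show iPQ: "integrable M (\<lambda>\<omega>. P \<omega> * Q \<omega>)"
  proof (rule Bochner_Integration.integrable_bound)
    show "integrable M (\<lambda>\<omega>. (P \<omega>)\<^sup>2 + (Q \<omega>)\<^sup>2)" using P Q by simp
    show "AE \<omega> in M. norm (P \<omega> * Q \<omega>) \<le> norm ((P \<omega>)\<^sup>2 + (Q \<omega>)\<^sup>2)"
      by (auto intro!: AE_I2 abs_mult_le_squares)
  qed simp
  define c where "c = expectation P"
  have expand: "(P \<omega> - c)\<^sup>2 = (P \<omega>)\<^sup>2 - 2 * c * P \<omega> + c\<^sup>2" for \<omega>
    by (simp add: power2_eq_square algebra_simps)
  have i2: "integrable M (\<lambda>\<omega>. (P \<omega> - c)\<^sup>2)" unfolding expand using P iP by simp
  have "expectation (\<lambda>\<omega>. (P \<omega> - c)\<^sup>2) = expectation (\<lambda>\<omega>. (P \<omega>)\<^sup>2) - c\<^sup>2"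
    unfolding expand using P iP by (simp add: c_def prob_space power2_eq_square)
  then have var: "expectation (\<lambda>\<omega>. (P \<omega> - c)\<^sup>2) \<le> expectation (\<lambda>\<omega>. (P \<omega>)\<^sup>2)" by simp
  have "expectation (\<lambda>\<omega>. P \<omega> * Q \<omega>) - expectation P * expectation Q = expectation (\<lambda>\<omega>. P \<omega> * Q \<omega> - c * Q \<omega>)"
    using iPQ iQ by (simp add: c_def)
  also have "\<dots> \<le> expectation (\<lambda>\<omega>. (l / 2) * (P \<omega> - c)\<^sup>2 + (1 / (2 * l)) * (Q \<omega>)\<^sup>2)"
  proof (rule integral_mono)
    fix \<omega>
    have "0 \<le> (l * (P \<omega> - c) - Q \<omega>)\<^sup>2 / (2 * l)" using l by simp
    also have "\<dots> = (l / 2) * (P \<omega> - c)\<^sup>2 + (1 / (2 * l)) * (Q \<omega>)\<^sup>2 - (P \<omega> * Q \<omega> - c * Q \<omega>)"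
      using l by (simp add: field_simps power2_eq_square)
    finally show "P \<omega> * Q \<omega> - c * Q \<omega> \<le> (l / 2) * (P \<omega> - c)\<^sup>2 + (1 / (2 * l)) * (Q \<omega>)\<^sup>2" by simp
  qed (use i2 Q iPQ iQ in auto)
  also have "\<dots> = (l / 2) * expectation (\<lambda>\<omega>. (P \<omega> - c)\<^sup>2) + (1 / (2 * l)) * expectation (\<lambda>\<omega>. (Q \<omega>)\<^sup>2)"
    using i2 Q by simp
  also have "\<dots> \<le> (l / 2) * expectation (\<lambda>\<omega>. (P \<omega>)\<^sup>2) + (1 / (2 * l)) * expectation (\<lambda>\<omega>. (Q \<omega>)\<^sup>2)"
    using var l by (intro add_right_mono mult_left_mono) auto
  also have "\<dots> = (l * expectation (\<lambda>\<omega>. (P \<omega>)\<^sup>2) + expectation (\<lambda>\<omega>. (Q \<omega>)\<^sup>2) / l) / 2"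
    by (simp add: add_divide_distrib)
  finally show "expectation (\<lambda>\<omega>. P \<omega> * Q \<omega>) - expectation P * expectation Q
      \<le> (l * expectation (\<lambda>\<omega>. (P \<omega>)\<^sup>2) + expectation (\<lambda>\<omega>. (Q \<omega>)\<^sup>2) / l) / 2" .
qed

lemma (in prob_space) second_moment_leD:
  fixes X :: "'a \<Rightarrow> real"
  assumes [measurable]: "X \<in> borel_measurable M" and le: "second_moment X \<le> ennreal c" and c: "c \<ge> 0"
  shows "integrable M (\<lambda>\<omega>. (X \<omega>)\<^sup>2)" "(LINT \<omega>|M. (X \<omega>)\<^sup>2) \<le> c"
proof -
  show i: "integrable M (\<lambda>\<omega>. (X \<omega>)\<^sup>2)"
    using le by (intro integrableI_nonneg) (auto intro: le_less_trans)
  show "(LINT \<omega>|M. (X \<omega>)\<^sup>2) \<le> c"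
    using le c nn_integral_eq_integral[OF i] by simp
qed

lemma (in prob_space) nn_integral_abs_le:
  fixes X :: "'a \<Rightarrow> real"
  assumes [measurable]: "X \<in> borel_measurable M" and le: "second_moment X \<le> ennreal (c\<^sup>2)" and c: "c \<ge> 0"
  shows "(\<integral>\<^sup>+\<omega>. ennreal \<bar>X \<omega>\<bar> \<partial>M) \<le> ennreal c"
proof -
  note i2 = second_moment_leD[OF assms(1) le zero_le_power2]
  have i1: "integrable M X" using square_integrable_imp_integrable[OF assms(1) i2(1)] .
  have v: "0 \<le> variance (\<lambda>\<omega>. \<bar>X \<omega>\<bar>)" by (rule variance_positive)
  have "variance (\<lambda>\<omega>. \<bar>X \<omega>\<bar>) = expectation (\<lambda>\<omega>. \<bar>X \<omega>\<bar>\<^sup>2) - (expectation (\<lambda>\<omega>. \<bar>X \<omega>\<bar>))\<^sup>2"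
    using i1 i2 by (intro variance_eq) auto
  then have "(expectation (\<lambda>\<omega>. \<bar>X \<omega>\<bar>))\<^sup>2 \<le> c\<^sup>2" using v i2(2) by simp
  then have "expectation (\<lambda>\<omega>. \<bar>X \<omega>\<bar>) \<le> c" using c by (rule power2_le_imp_le)
  then show ?thesis using i1 by (subst nn_integral_eq_integral) (auto intro: ennreal_leI)
qed

context noise begin

text \<open>Near-minimisers \<open>Z\<close> and \<open>W\<close> of the two distances are
  independent. In |X| |Y| = P |Y| + Z Q + Z W, with \<open>P\<close> and \<open>Q\<close> the
  approximation errors, the covariance thus comes from the first two terms: at most 3/2 and 4 times
  \<epsilon> a b, rounded up to 6. Nothing is subtracted in the conclusion, so that it can be
  integrated over space in \<open>ennreal\<close>.\<close>

lemma covariance_abs_le: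
  fixes X Y :: "'a \<Rightarrow> real"
  assumes R: "R \<inter> R' = {}" and [measurable]: "X \<in> borel_measurable M" "Y \<in> borel_measurable M"
    and a: "a \<ge> 0" and b: "b \<ge> 0" and \<epsilon>: "0 < \<epsilon>" "\<epsilon> \<le> 1"
    and X2: "second_moment X \<le> ennreal (a\<^sup>2)" and dX: "cond_dist R X \<le> ennreal (\<epsilon>\<^sup>2 * a\<^sup>2)"
    and Y2: "second_moment Y \<le> ennreal (b\<^sup>2)" and dY: "cond_dist R' Y \<le> ennreal (\<epsilon>\<^sup>2 * b\<^sup>2)"
  shows "(\<integral>\<^sup>+\<omega>. ennreal \<bar>X \<omega>\<bar> * ennreal \<bar>Y \<omega>\<bar> \<partial>M) \<le>
    (\<integral>\<^sup>+\<omega>. ennreal \<bar>X \<omega>\<bar> \<partial>M) * (\<integral>\<^sup>+\<omega>. ennreal \<bar>Y \<omega>\<bar> \<partial>M) + ennreal (6 * \<epsilon>) * (ennreal a * ennreal b)"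
proof (cases "a = 0 \<or> b = 0")
  \<comment> \<open>A vanishing bound forces a vanishing variable. The case is split off because the
    strict inequality and the weights below need \<open>a\<close> and \<open>b\<close>
    positive.\<close>
  case True
  have z: "AE \<omega> in M. V \<omega> = 0" if "second_moment V = 0" "V \<in> borel_measurable M" for V :: "'a \<Rightarrow> real"
  proof -
    have "AE \<omega> in M. ennreal ((V \<omega>)\<^sup>2) = 0" using that by (subst (asm) nn_integral_0_iff_AE) auto
    then show ?thesis by eventually_elim (simp add: ennreal_eq_0_iff)
  qed
  have "(AE \<omega> in M. X \<omega> = 0) \<or> (AE \<omega> in M. Y \<omega> = 0)" using True X2 Y2 z[of X] z[of Y] by auto
  then have "AE \<omega> in M. ennreal \<bar>X \<omega>\<bar> * ennreal \<bar>Y \<omega>\<bar> = 0"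
    by (elim disjE) (auto elim!: eventually_mono)
  then have "(\<integral>\<^sup>+\<omega>. ennreal \<bar>X \<omega>\<bar> * ennreal \<bar>Y \<omega>\<bar> \<partial>M) = 0" by (subst nn_integral_0_iff_AE) auto
  then show ?thesis by simp
next
  case False
  then have a: "a > 0" and b: "b > 0" using a b by auto
  \<comment> \<open>The factor 2 makes the bound exceed the infimum strictly, which yields an actual
    competitor. The absolute value is 1-Lipschitz, so it does not increase the distance.\<close>
  have approx: "\<exists>Z. Z \<in> borel_measurable (alg S) \<and> (second_moment (\<lambda>\<omega>. \<bar>V \<omega>\<bar> - Z \<omega>)) \<le> ennreal (2 * \<epsilon>\<^sup>2 * c\<^sup>2)"
    if V: "V \<in> borel_measurable M" and c: "c > 0" and d: "cond_dist S V \<le> ennreal (\<epsilon>\<^sup>2 * c\<^sup>2)" for V S c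
  proof -
    have "cond_dist S (\<lambda>\<omega>. \<bar>V \<omega>\<bar>) \<le> ennreal (1\<^sup>2) * cond_dist S V"
      by (rule cond_dist_lipschitz[OF _ _ V]) (auto simp: abs_triangle_ineq3)
    also have "\<dots> \<le> ennreal (\<epsilon>\<^sup>2 * c\<^sup>2)" using d by simp
    also have "\<dots> < ennreal (2 * \<epsilon>\<^sup>2 * c\<^sup>2)" using \<epsilon> c by (intro ennreal_lessI) auto
    finally show ?thesis unfolding cond_dist_def INF_less_iff by (auto intro: less_imp_le)
  qed
  obtain Z where Z: "Z \<in> borel_measurable (alg R)" "second_moment (\<lambda>\<omega>. \<bar>X \<omega>\<bar> - Z \<omega>) \<le> ennreal (2 * \<epsilon>\<^sup>2 * a\<^sup>2)"
    using approx[OF _ a dX] by auto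
  obtain W where W: "W \<in> borel_measurable (alg R')" "second_moment (\<lambda>\<omega>. \<bar>Y \<omega>\<bar> - W \<omega>) \<le> ennreal (2 * \<epsilon>\<^sup>2 * b\<^sup>2)"
    using approx[OF _ b dY] by auto
  note [measurable] = alg_measurableD[OF Z(1)] alg_measurableD[OF W(1)]
  define P where "P = (\<lambda>\<omega>. \<bar>X \<omega>\<bar> - Z \<omega>)"
  define Q where "Q = (\<lambda>\<omega>. \<bar>Y \<omega>\<bar> - W \<omega>)"
  have Pm[measurable]: "P \<in> borel_measurable M" "Q \<in> borel_measurable M" unfolding P_def Q_def by auto
  have P: "integrable M (\<lambda>\<omega>. (P \<omega>)\<^sup>2)" "expectation (\<lambda>\<omega>. (P \<omega>)\<^sup>2) \<le> 2 * \<epsilon>\<^sup>2 * a\<^sup>2"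
    using second_moment_leD[OF Pm(1), of "2 * \<epsilon>\<^sup>2 * a\<^sup>2"] Z(2) by (auto simp: P_def)
  have Q: "integrable M (\<lambda>\<omega>. (Q \<omega>)\<^sup>2)" "expectation (\<lambda>\<omega>. (Q \<omega>)\<^sup>2) \<le> 2 * \<epsilon>\<^sup>2 * b\<^sup>2"
    using second_moment_leD[OF Pm(2), of "2 * \<epsilon>\<^sup>2 * b\<^sup>2"] W(2) by (auto simp: Q_def)
  have X: "integrable M (\<lambda>\<omega>. \<bar>X \<omega>\<bar>\<^sup>2)" "expectation (\<lambda>\<omega>. \<bar>X \<omega>\<bar>\<^sup>2) \<le> a\<^sup>2"
    using second_moment_leD[of X "a\<^sup>2"] X2 by auto
  have Y: "integrable M (\<lambda>\<omega>. \<bar>Y \<omega>\<bar>\<^sup>2)" "expectation (\<lambda>\<omega>. \<bar>Y \<omega>\<bar>\<^sup>2) \<le> b\<^sup>2"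
    using second_moment_leD[of Y "b\<^sup>2"] Y2 by auto
  \<comment> \<open>6 = 2 + 2 * 2, by the triangle inequality with \<open>P\<close> and
    \<open>\<epsilon> \<le> 1\<close>.\<close>
  have Z2: "integrable M (\<lambda>\<omega>. (Z \<omega>)\<^sup>2)" "expectation (\<lambda>\<omega>. (Z \<omega>)\<^sup>2) \<le> 6 * a\<^sup>2"
  proof -
    have le: "(Z \<omega>)\<^sup>2 \<le> 2 * \<bar>X \<omega>\<bar>\<^sup>2 + 2 * (P \<omega>)\<^sup>2" for \<omega>
      using square_sum_eps[of 1 "Z \<omega>" 0 "\<bar>X \<omega>\<bar>"] by (simp add: P_def power2_commute)
    have i: "integrable M (\<lambda>\<omega>. 2 * \<bar>X \<omega>\<bar>\<^sup>2 + 2 * (P \<omega>)\<^sup>2)" using X P by simp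
    show iZ: "integrable M (\<lambda>\<omega>. (Z \<omega>)\<^sup>2)"
      by (rule Bochner_Integration.integrable_bound[OF i]) (use le in auto)
    have "expectation (\<lambda>\<omega>. (Z \<omega>)\<^sup>2) \<le> expectation (\<lambda>\<omega>. 2 * \<bar>X \<omega>\<bar>\<^sup>2 + 2 * (P \<omega>)\<^sup>2)"
      by (rule integral_mono[OF iZ i le])
    also have "\<dots> = 2 * expectation (\<lambda>\<omega>. \<bar>X \<omega>\<bar>\<^sup>2) + 2 * expectation (\<lambda>\<omega>. (P \<omega>)\<^sup>2)"
      using X P by simp
    also have "\<dots> \<le> 2 * a\<^sup>2 + 2 * (2 * \<epsilon>\<^sup>2 * a\<^sup>2)" using X P by linarith
    also have "\<dots> \<le> 6 * a\<^sup>2"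
    proof -
      have "\<epsilon>\<^sup>2 * a\<^sup>2 \<le> 1 * a\<^sup>2" using \<epsilon> by (intro mult_right_mono) (auto simp: power_le_one)
      then show ?thesis by simp
    qed
    finally show "expectation (\<lambda>\<omega>. (Z \<omega>)\<^sup>2) \<le> 6 * a\<^sup>2" .
  qed
  have W2: "integrable M (\<lambda>\<omega>. (W \<omega>)\<^sup>2)"
  proof (rule Bochner_Integration.integrable_bound)
    show "integrable M (\<lambda>\<omega>. 2 * \<bar>Y \<omega>\<bar>\<^sup>2 + 2 * (Q \<omega>)\<^sup>2)" using Y Q by simp
    have "(W \<omega>)\<^sup>2 \<le> 2 * \<bar>Y \<omega>\<bar>\<^sup>2 + 2 * (Q \<omega>)\<^sup>2" for \<omega>
      using square_sum_eps[of 1 "W \<omega>" 0 "\<bar>Y \<omega>\<bar>"] by (simp add: Q_def power2_commute)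
    then show "AE \<omega> in M. norm ((W \<omega>)\<^sup>2) \<le> norm (2 * \<bar>Y \<omega>\<bar>\<^sup>2 + 2 * (Q \<omega>)\<^sup>2)" by auto
  qed simp
  have sq1: "integrable M V" if "integrable M (\<lambda>\<omega>. (V \<omega>)\<^sup>2)" "V \<in> borel_measurable M" for V :: "'a \<Rightarrow> real"
    using square_integrable_imp_integrable[OF that(2,1)] .
  \<comment> \<open>The weights balance the moment bounds: \<open>p\<close> those of
    \<open>P\<close> and |Y|, \<open>q\<close> those of \<open>Z\<close> and \<open>Q\<close>, so
    that every term becomes a multiple of \<epsilon> a b.\<close>
  define p where "p = b / (a * \<epsilon>)"
  define q where "q = \<epsilon> * b / a"
  have l: "p > 0" "q > 0" using a b \<epsilon> by (auto simp: p_def q_def)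
  have aX: "(\<lambda>\<omega>. \<bar>X \<omega>\<bar>) \<in> borel_measurable M" and aY: "(\<lambda>\<omega>. \<bar>Y \<omega>\<bar>) \<in> borel_measurable M" by auto
  note c1 = covariance_weighted_le[OF Pm(1) aY P(1) Y(1) l(1)]
  note c2 = covariance_weighted_le[OF _ Pm(2) Z2(1) Q(1) l(2)]
  have c2': "integrable M (\<lambda>\<omega>. Z \<omega> * Q \<omega>)" using c2(1) by simp
  note i1 = sq1[OF P(1) Pm(1)] sq1[OF Y(1) aY] sq1[OF X(1) aX] sq1[OF Q(1) Pm(2)]
  have iZ: "integrable M Z" "integrable M W" using sq1[OF Z2(1)] sq1[OF W2] by auto
  note c3 = alg_indep[OF R Z(1) iZ(1) W(1) iZ(2)]
  have "expectation (\<lambda>\<omega>. P \<omega> * \<bar>Y \<omega>\<bar>) - expectation P * expectation (\<lambda>\<omega>. \<bar>Y \<omega>\<bar>) \<le> 3 / 2 * (\<epsilon> * a * b)"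
  proof -
    have "p * expectation (\<lambda>\<omega>. (P \<omega>)\<^sup>2) \<le> p * (2 * \<epsilon>\<^sup>2 * a\<^sup>2)"
      using P l by (intro mult_left_mono) auto
    moreover have "p * (2 * \<epsilon>\<^sup>2 * a\<^sup>2) = 2 * (\<epsilon> * a * b)" using a \<epsilon> by (simp add: p_def power2_eq_square)
    moreover have "expectation (\<lambda>\<omega>. \<bar>Y \<omega>\<bar>\<^sup>2) / p \<le> b\<^sup>2 / p"
      using Y l by (intro divide_right_mono) auto
    moreover have "b\<^sup>2 / p = \<epsilon> * a * b" using b by (simp add: p_def power2_eq_square)
    ultimately have "(p * expectation (\<lambda>\<omega>. (P \<omega>)\<^sup>2) + expectation (\<lambda>\<omega>. \<bar>Y \<omega>\<bar>\<^sup>2) / p) / 2 \<le> (2 * (\<epsilon> * a * b) + \<epsilon> * a * b) / 2"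
      by (intro divide_right_mono add_mono) (simp_all only: zero_le_numeral)
    from order_trans[OF c1(2) this] show ?thesis by simp
  qed
  moreover have "expectation (\<lambda>\<omega>. Z \<omega> * Q \<omega>) - expectation Z * expectation Q \<le> 4 * (\<epsilon> * a * b)"
  proof -
    have "q * expectation (\<lambda>\<omega>. (Z \<omega>)\<^sup>2) \<le> q * (6 * a\<^sup>2)"
      using Z2 l by (intro mult_left_mono) auto
    moreover have "q * (6 * a\<^sup>2) = 6 * (\<epsilon> * a * b)" using a by (simp add: q_def power2_eq_square)
    moreover have "expectation (\<lambda>\<omega>. (Q \<omega>)\<^sup>2) / q \<le> 2 * \<epsilon>\<^sup>2 * b\<^sup>2 / q"
      using Q l by (intro divide_right_mono) auto
    moreover have "2 * \<epsilon>\<^sup>2 * b\<^sup>2 / q = 2 * (\<epsilon> * a * b)" using b \<epsilon> by (simp add: q_def power2_eq_square)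
    ultimately have "(q * expectation (\<lambda>\<omega>. (Z \<omega>)\<^sup>2) + expectation (\<lambda>\<omega>. (Q \<omega>)\<^sup>2) / q) / 2 \<le> (6 * (\<epsilon> * a * b) + 2 * (\<epsilon> * a * b)) / 2"
      by (intro divide_right_mono add_mono) (simp_all only: zero_le_numeral)
    moreover have "expectation (\<lambda>\<omega>. Z \<omega> * Q \<omega>) - expectation Z * expectation Q
      \<le> (q * expectation (\<lambda>\<omega>. (Z \<omega>)\<^sup>2) + expectation (\<lambda>\<omega>. (Q \<omega>)\<^sup>2) / q) / 2" using c2(2) by simp
    ultimately have "expectation (\<lambda>\<omega>. Z \<omega> * Q \<omega>) - expectation Z * expectation Q \<le> (6 * (\<epsilon> * a * b) + 2 * (\<epsilon> * a * b)) / 2"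
      by (rule order_trans[rotated])
    then show ?thesis by simp
  qed
  moreover have "\<bar>X \<omega>\<bar> * \<bar>Y \<omega>\<bar> = P \<omega> * \<bar>Y \<omega>\<bar> + Z \<omega> * Q \<omega> + Z \<omega> * W \<omega>" for \<omega>
    by (simp add: P_def Q_def algebra_simps)
  then have e1: "expectation (\<lambda>\<omega>. \<bar>X \<omega>\<bar> * \<bar>Y \<omega>\<bar>) = expectation (\<lambda>\<omega>. P \<omega> * \<bar>Y \<omega>\<bar>) + expectation (\<lambda>\<omega>. Z \<omega> * Q \<omega>) + expectation Z * expectation W"
    using c1(1) c2' c3 by simp
  moreover have "expectation (\<lambda>\<omega>. \<bar>X \<omega>\<bar>) = expectation P + expectation Z"
    using i1 iZ by (simp add: P_def)
  moreover have "expectation (\<lambda>\<omega>. \<bar>Y \<omega>\<bar>) = expectation Q + expectation W"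
    using i1 iZ by (simp add: Q_def)
  moreover have "0 \<le> \<epsilon> * a * b" using \<epsilon> a b by simp
  ultimately have main: "expectation (\<lambda>\<omega>. \<bar>X \<omega>\<bar> * \<bar>Y \<omega>\<bar>) \<le> expectation (\<lambda>\<omega>. \<bar>X \<omega>\<bar>) * expectation (\<lambda>\<omega>. \<bar>Y \<omega>\<bar>) + 6 * \<epsilon> * (a * b)"
    by (simp add: algebra_simps)
  have iXY: "integrable M (\<lambda>\<omega>. \<bar>X \<omega>\<bar> * \<bar>Y \<omega>\<bar>)"
    using covariance_weighted_le(1)[OF aX aY X(1) Y(1), of 1] by simp
  have "(\<integral>\<^sup>+\<omega>. ennreal \<bar>X \<omega>\<bar> * ennreal \<bar>Y \<omega>\<bar> \<partial>M) = ennreal (expectation (\<lambda>\<omega>. \<bar>X \<omega>\<bar> * \<bar>Y \<omega>\<bar>))"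
    unfolding ennreal_mult[symmetric, OF abs_ge_zero abs_ge_zero] by (rule nn_integral_eq_integral[OF iXY]) simp
  also have "\<dots> \<le> ennreal (expectation (\<lambda>\<omega>. \<bar>X \<omega>\<bar>) * expectation (\<lambda>\<omega>. \<bar>Y \<omega>\<bar>) + 6 * \<epsilon> * (a * b))"
    by (rule ennreal_leI[OF main])
  also have "\<dots> = ennreal (expectation (\<lambda>\<omega>. \<bar>X \<omega>\<bar>)) * ennreal (expectation (\<lambda>\<omega>. \<bar>Y \<omega>\<bar>)) + ennreal (6 * \<epsilon>) * (ennreal a * ennreal b)"
    using a b \<epsilon> by (simp add: ennreal_mult)
  finally show ?thesis using i1 by (simp add: nn_integral_eq_integral)
qed

end

text \<open>The support is the complement of a union of possibly uncountably many open sets.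
  Lindelof's theorem extracts a countable subfamily with the same union, so the exceptional sets add
  up to a null set.\<close>

lemma AE_zero_or_ess_support: "AE x in lborel. f x = 0 \<or> x \<in> ess_support f"
proof -
  define \<U> where "\<U> = {U :: real set. open U \<and> (AE x in lborel. x \<in> U \<longrightarrow> f x = 0)}"
  obtain \<V> where V: "\<V> \<subseteq> \<U>" "countable \<V>" "\<Union>\<V> = \<Union>\<U>"
    using Lindelof[of \<U>] by (auto simp: \<U>_def)
  have "AE x in lborel. \<forall>U\<in>\<V>. x \<in> U \<longrightarrow> f x = 0"
    using V by (subst AE_ball_countable) (auto simp: \<U>_def)
  then show ?thesis
    by eventually_elim (use V(3) in \<open>auto simp: ess_support_def \<U>_def[symmetric]\<close>)
qed

text \<open>Any Lipschitz constant \<open>C\<close> bounds the difference quotients, so that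
  \<open>Sup\<close> is a genuine supremum and not an unspecified value.\<close>

lemma lip_const_bound:
  assumes C: "C-lipschitz_on UNIV \<sigma>"
  shows "\<bar>\<sigma> x - \<sigma> y\<bar> \<le> lip_const \<sigma> * \<bar>x - y\<bar>"
proof -
  let ?S = "{\<bar>(\<sigma> a - \<sigma> b) / (a - b)\<bar> | a b. a < b}"
  have le: "\<bar>\<sigma> a - \<sigma> b\<bar> \<le> C * \<bar>a - b\<bar>" for a b
    using lipschitz_onD[OF C, of a b] by (simp add: dist_real_def)
  have "bdd_above ?S"
  proof (rule bdd_aboveI[of _ C])
    fix z assume "z \<in> ?S"
    then obtain a b where "z = \<bar>(\<sigma> a - \<sigma> b) / (a - b)\<bar>" "a < b" by auto
    then show "z \<le> C" using le[of a b] by (simp add: abs_divide pos_divide_le_eq)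
  qed
  then have *: "\<bar>\<sigma> a - \<sigma> b\<bar> \<le> lip_const \<sigma> * \<bar>a - b\<bar>" if "a < b" for a b
  proof -
    have "\<bar>(\<sigma> a - \<sigma> b) / (a - b)\<bar> \<in> ?S" using that by blast
    then have "\<bar>(\<sigma> a - \<sigma> b) / (a - b)\<bar> \<le> lip_const \<sigma>"
      unfolding lip_const_def using \<open>bdd_above ?S\<close> by (rule cSup_upper)
    then show ?thesis using that by (simp add: abs_divide pos_divide_le_eq)
  qed
  show ?thesis
    using *[of x y] *[of y x] by (cases x y rule: linorder_cases) (auto simp: abs_minus_commute)
qed

section \<open>The total mass as a random variable and its moments\<close>

context noise begin

lemma predictable_measurable_space:
  assumes "predictable M \<xi> \<Phi>" "t > 0"
  shows "(\<lambda>z. \<Phi> t (fst z) (snd z)) \<in> borel_measurable (lborel \<Otimes>\<^sub>M M)"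
proof -
  have 1: "(\<lambda>x. (t, x)) \<in> lborel \<rightarrow>\<^sub>M (spacetime :: (real \<times> real) measure)"
  proof -
    have "(\<lambda>x. (t, x)) \<in> borel \<rightarrow>\<^sub>M (borel \<Otimes>\<^sub>M borel :: (real \<times> real) measure)" by measurable
    then have "(\<lambda>x. (t, x)) \<in> lborel \<rightarrow>\<^sub>M (lborel :: (real \<times> real) measure)" by (simp add: borel_prod)
    then show ?thesis unfolding spacetime_def using assms(2) by (intro measurable_restrict_space2) auto
  qed
  have "(\<lambda>z. ((t, fst z), snd z)) \<in> lborel \<Otimes>\<^sub>M M \<rightarrow>\<^sub>M spacetime \<Otimes>\<^sub>M M"
    by (intro measurable_Pair measurable_compose[OF measurable_fst 1] measurable_snd)
  from measurable_compose[OF this predictable_measurable[OF assms(1)]] show ?thesis by simp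
qed

end

context mild_solution_bound begin

text \<open>Its square is the common bound for the second moment and, before the small factor, for
  the distance; using 2 theta in both lets one function serve. The average enters to the first
  power, so the spatial integral is linear in the initial mass.\<close>

definition amplitude :: "real \<Rightarrow> real \<Rightarrow> real" where
  "amplitude t x = sqrt (2 / (pi * \<theta>) * (exp (\<beta> * t) / t)) * enn2real (gauss_avg (2 * \<theta>) u0 t x)"

lemma amplitude_nonneg: "t > 0 \<Longrightarrow> amplitude t x \<ge> 0"
  using \<theta> by (simp add: amplitude_def)

lemma amplitude_measurable: "amplitude t \<in> borel_measurable borel"
  using gauss_avg_measurable[OF u0_borel, of "\<lambda>_. t" borel "\<lambda>x. x" "2 * \<theta>"]
  unfolding amplitude_def by measurable

lemma nn_integral_u0: "(\<integral>\<^sup>+a. ennreal (u0 a) \<partial>lborel) = ennreal (l1_norm u0)"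
proof -
  have "(\<integral>\<^sup>+a. ennreal (u0 a) \<partial>lborel) = (\<integral>\<^sup>+a. ennreal \<bar>u0 a\<bar> \<partial>lborel)"
    using u0(2) by (intro nn_integral_cong_AE) auto
  also have "\<dots> = ennreal (l1_norm u0)"
    unfolding l1_norm_def using u0(1) by (intro nn_integral_eq_integral) auto
  finally show ?thesis .
qed

lemma gauss_avg_finite: 
  assumes "t > 0"
  shows "ennreal (enn2real (gauss_avg (2 * \<theta>) u0 t x)) = gauss_avg (2 * \<theta>) u0 t x"
proof -
  have "gauss_avg (2 * \<theta>) u0 t x \<le> (\<integral>\<^sup>+a. ennreal (u0 a) \<partial>lborel)"
    unfolding gauss_avg_def
  proof (rule nn_integral_mono)
    fix a
    have "exp (- (x - a)\<^sup>2 / (2 * (2 * \<theta>) * t)) \<le> 1" using \<theta> assms by simp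
    then have "ennreal (exp (- (x - a)\<^sup>2 / (2 * (2 * \<theta>) * t))) \<le> 1" using ennreal_leI by fastforce
    from mult_left_mono[OF this, of "ennreal (u0 a)"]
    show "ennreal (u0 a) * ennreal (exp (- (x - a)\<^sup>2 / (2 * (2 * \<theta>) * t))) \<le> ennreal (u0 a)" by simp
  qed
  then have "gauss_avg (2 * \<theta>) u0 t x < \<top>" unfolding nn_integral_u0 by (rule le_less_trans) simp
  then show ?thesis by simp
qed

lemma amplitude_square:
  assumes "t > 0"
  shows "ennreal ((amplitude t x)\<^sup>2) = ennreal (2 / (pi * \<theta>)) * gauss_weight \<beta> (2 * \<theta>) u0 t x"
proof -
  have "(amplitude t x)\<^sup>2 = (2 / (pi * \<theta>) * (exp (\<beta> * t) / t)) * (enn2real (gauss_avg (2 * \<theta>) u0 t x))\<^sup>2"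
    using \<theta> assms by (simp add: amplitude_def power_mult_distrib)
  then have "ennreal ((amplitude t x)\<^sup>2) = (ennreal (2 / (pi * \<theta>)) * ennreal (exp (\<beta> * t) / t)) * (ennreal (enn2real (gauss_avg (2 * \<theta>) u0 t x)))\<^sup>2"
    using \<theta> assms by (simp only: ennreal_mult'[symmetric] ennreal_power enn2real_nonneg) (simp add: ennreal_mult'[symmetric])
  then show ?thesis by (simp only: gauss_avg_finite[OF assms] gauss_weight_def mult.assoc)
qed

lemma second_moment_amplitude:
  assumes "t > 0"
  shows "second_moment (u t x) \<le> ennreal ((amplitude t x)\<^sup>2)"
proof -
  have "second_moment (u t x) \<le> ennreal (2 / (pi * \<theta>)) * gauss_weight \<beta> \<theta> u0 t x"
    by (rule second_moment_bound[OF assms])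
  also have "\<dots> \<le> ennreal (2 / (pi * \<theta>)) * gauss_weight \<beta> (2 * \<theta>) u0 t x"
    using \<theta> assms by (intro mult_left_mono gauss_weight_mono) auto
  finally show ?thesis unfolding amplitude_square[OF assms] .
qed

lemma cond_dist_amplitude:
  assumes t: "t > 0" and A: "A \<in> sets borel" and \<delta>: "\<delta> \<ge> 0"
    and far: "\<And>y. y \<notin> A \<Longrightarrow> AE a in lborel. u0 a = 0 \<or> \<delta> \<le> \<bar>y - a\<bar>"
  shows "cond_dist (UNIV \<times> A) (u t x) \<le> ennreal ((exp (- \<delta>\<^sup>2 / (4 * \<theta> * t)))\<^sup>2 * (amplitude t x)\<^sup>2)"
proof -
  have e: "(exp (- \<delta>\<^sup>2 / (4 * \<theta> * t)))\<^sup>2 = exp (- \<delta>\<^sup>2 / (2 * \<theta> * t))"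
    by (simp add: exp_double[symmetric])
  have "ennreal (exp (- \<delta>\<^sup>2 / (2 * \<theta> * t)) * (2 / (pi * \<theta>))) * gauss_weight \<beta> (2 * \<theta>) u0 t x
     = ennreal (exp (- \<delta>\<^sup>2 / (2 * \<theta> * t))) * ennreal ((amplitude t x)\<^sup>2)"
    unfolding amplitude_square[OF t] using \<theta> by (subst ennreal_mult) (auto simp: mult.assoc)
  also have "\<dots> = ennreal (exp (- \<delta>\<^sup>2 / (2 * \<theta> * t)) * (amplitude t x)\<^sup>2)" by (intro ennreal_mult[symmetric]) auto
  finally show ?thesis using cond_dist_bound[OF t A \<delta> far, of x] unfolding e by simp
qed

text \<open>The factor 1 / sqrt t of the amplitude cancels the spread sqrt (4 pi theta t) of the
  Gaussian; under the root, 8 is 2 / (pi theta) times 4 pi theta.\<close>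

lemma amplitude_integral:
  assumes t: "t > 0"
  shows "(\<integral>\<^sup>+x. ennreal (amplitude t x) \<partial>lborel) = ennreal (sqrt (8 * exp (\<beta> * t)) * l1_norm u0)"
proof -
  note [measurable] = u0_borel
  let ?K = "sqrt (2 / (pi * \<theta>) * (exp (\<beta> * t) / t))"
  have K: "?K \<ge> 0" using \<theta> t by simp
  have A: "2 * (2 * \<theta>) * t > 0" using \<theta> t by simp
  have [measurable]: "(\<lambda>x. gauss_avg (2 * \<theta>) u0 t x) \<in> borel_measurable borel"
    by (rule gauss_avg_measurable) auto
  have "(\<integral>\<^sup>+x. ennreal (amplitude t x) \<partial>lborel) = (\<integral>\<^sup>+x. ennreal ?K * gauss_avg (2 * \<theta>) u0 t x \<partial>lborel)"
    unfolding amplitude_def using K by (simp only: ennreal_mult enn2real_nonneg gauss_avg_finite[OF t])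
  also have "\<dots> = ennreal ?K * (\<integral>\<^sup>+x. gauss_avg (2 * \<theta>) u0 t x \<partial>lborel)" by (rule nn_integral_cmult) simp
  also have "(\<integral>\<^sup>+x. gauss_avg (2 * \<theta>) u0 t x \<partial>lborel)
     = (\<integral>\<^sup>+a. \<integral>\<^sup>+x. ennreal (u0 a) * ennreal (exp (- (x - a)\<^sup>2 / (2 * (2 * \<theta>) * t))) \<partial>lborel \<partial>lborel)"
    unfolding gauss_avg_def by (rule lborel_pair.Fubini') (simp add: split_beta')
  also have "\<dots> = (\<integral>\<^sup>+a. ennreal (u0 a) * ennreal (sqrt (pi * (2 * (2 * \<theta>) * t))) \<partial>lborel)"
    by (subst nn_integral_cmult) (simp_all only: nn_integral_gaussian[OF A], simp)
  also have "\<dots> = ennreal (l1_norm u0) * ennreal (sqrt (pi * (2 * (2 * \<theta>) * t)))"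
    by (simp add: nn_integral_multc nn_integral_u0)
  also have "ennreal ?K * \<dots> = ennreal (?K * sqrt (pi * (2 * (2 * \<theta>) * t)) * l1_norm u0)"
  proof -
    have "l1_norm u0 \<ge> 0" by (simp add: l1_norm_def)
    then show ?thesis using K A by (simp add: ennreal_mult mult_ac)
  qed
  also have "?K * sqrt (pi * (2 * (2 * \<theta>) * t)) = sqrt (2 / (pi * \<theta>) * (exp (\<beta> * t) / t) * (pi * (2 * (2 * \<theta>) * t)))"
    by (simp only: real_sqrt_mult)
  also have "2 / (pi * \<theta>) * (exp (\<beta> * t) / t) * (pi * (2 * (2 * \<theta>) * t)) = 8 * exp (\<beta> * t)"
    using \<theta> t by (simp add: field_simps)
  finally show ?thesis .
qed

definition abs_mass :: "real \<Rightarrow> 'a \<Rightarrow> ennreal" where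
  "abs_mass t \<omega> = (\<integral>\<^sup>+x. ennreal \<bar>u t x \<omega>\<bar> \<partial>lborel)"

lemma abs_solution_measurable:
  assumes "t > 0"
  shows "(\<lambda>z. ennreal \<bar>u t (fst z) (snd z)\<bar>) \<in> borel_measurable (lborel \<Otimes>\<^sub>M M)"
  using predictable_measurable_space[OF predictable_solution assms] by measurable

lemma abs_solution_sections:
  assumes "t > 0"
  shows "\<omega> \<in> space M \<Longrightarrow> (\<lambda>x. ennreal \<bar>u t x \<omega>\<bar>) \<in> borel_measurable lborel"
    "\<omega> \<in> space M \<Longrightarrow> (\<lambda>x. u t x \<omega>) \<in> borel_measurable lborel"
    "u t x \<in> borel_measurable M"
  using measurable_compose[OF measurable_Pair2'[of \<omega> M lborel] abs_solution_measurable[OF assms]]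
    measurable_compose[OF measurable_Pair2'[of \<omega> M lborel] predictable_measurable_space[OF predictable_solution assms]]
    predictable_section[OF predictable_solution assms, of x]
  by auto

lemma abs_mass_measurable:
  assumes "t > 0"
  shows "abs_mass t \<in> borel_measurable M"
proof -
  have "(\<lambda>z. ennreal \<bar>u t (snd z) (fst z)\<bar>) \<in> borel_measurable (M \<Otimes>\<^sub>M lborel)"
    using measurable_compose[OF measurable_pair_swap' abs_solution_measurable[OF assms]] by (simp add: split_beta')
  then show ?thesis unfolding abs_mass_def
    by (intro lborel.borel_measurable_nn_integral) (simp add: split_beta')
qed

text \<open>Where the mass is infinite both sides are 0: the Bochner integral by convention, and
  \<open>enn2real\<close> by its value at infinity.\<close>

lemma l1_norm_abs_mass:
  assumes "t > 0" "\<omega> \<in> space M"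
  shows "l1_norm (\<lambda>x. u t x \<omega>) = enn2real (abs_mass t \<omega>)"
  unfolding l1_norm_def abs_mass_def
  using abs_solution_sections(2)[OF assms] by (intro integral_eq_nn_integral) auto

lemma abs_mass_integral:
  assumes "t > 0"
  shows "(\<integral>\<^sup>+\<omega>. abs_mass t \<omega> \<partial>M) = (\<integral>\<^sup>+x. (\<integral>\<^sup>+\<omega>. ennreal \<bar>u t x \<omega>\<bar> \<partial>M) \<partial>lborel)"
    "(\<integral>\<^sup>+\<omega>. abs_mass t \<omega> \<partial>M) \<le> ennreal (sqrt (8 * exp (\<beta> * t)) * l1_norm u0)"
proof -
  interpret P: pair_sigma_finite lborel M by (intro pair_sigma_finite.intro sigma_finite_measure_axioms lborel.sigma_finite_measure_axioms)
  show eq: "(\<integral>\<^sup>+\<omega>. abs_mass t \<omega> \<partial>M) = (\<integral>\<^sup>+x. (\<integral>\<^sup>+\<omega>. ennreal \<bar>u t x \<omega>\<bar> \<partial>M) \<partial>lborel)"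
    unfolding abs_mass_def using abs_solution_measurable[OF assms] by (intro P.Fubini') (simp add: split_beta')
  have "\<dots> \<le> (\<integral>\<^sup>+x. ennreal (amplitude t x) \<partial>lborel)"
    by (intro nn_integral_mono nn_integral_abs_le abs_solution_sections(3)[OF assms] second_moment_amplitude assms amplitude_nonneg)
  then show "(\<integral>\<^sup>+\<omega>. abs_mass t \<omega> \<partial>M) \<le> ennreal (sqrt (8 * exp (\<beta> * t)) * l1_norm u0)"
    unfolding eq amplitude_integral[OF assms] .
qed

end

text \<open>Finite means make \<open>U\<close> and \<open>V\<close> finite almost everywhere, so
  that passing to reals loses nothing; the assumed bound also supplies the integrability of the
  product.\<close>

lemma (in prob_space) covariance_enn2real_le:
  assumes U: "U \<in> borel_measurable M" "(\<integral>\<^sup>+\<omega>. U \<omega> \<partial>M) < \<top>" and V: "V \<in> borel_measurable M" "(\<integral>\<^sup>+\<omega>. V \<omega> \<partial>M) < \<top>"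
    and le: "(\<integral>\<^sup>+\<omega>. U \<omega> * V \<omega> \<partial>M) \<le> (\<integral>\<^sup>+\<omega>. U \<omega> \<partial>M) * (\<integral>\<^sup>+\<omega>. V \<omega> \<partial>M) + ennreal c" and c: "c \<ge> 0"
    and pq: "p > 0" "q > 0"
  shows "covariance M (\<lambda>\<omega>. enn2real (U \<omega>) / p) (\<lambda>\<omega>. enn2real (V \<omega>) / q) \<le> c / (p * q)"
proof -
  note [measurable] = U(1) V(1)
  define f where "f = (\<lambda>\<omega>. enn2real (U \<omega>))"
  define g where "g = (\<lambda>\<omega>. enn2real (V \<omega>))"
  have [measurable]: "f \<in> borel_measurable M" "g \<in> borel_measurable M" unfolding f_def g_def by auto
  have fg0: "f \<omega> \<ge> 0" "g \<omega> \<ge> 0" for \<omega> by (simp_all add: f_def g_def)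
  have "AE \<omega> in M. U \<omega> \<noteq> \<infinity>" "AE \<omega> in M. V \<omega> \<noteq> \<infinity>"
    using U V by (intro nn_integral_PInf_AE; simp)+
  then have aeU: "AE \<omega> in M. ennreal (f \<omega>) = U \<omega>" and aeV: "AE \<omega> in M. ennreal (g \<omega>) = V \<omega>"
    by (eventually_elim, simp add: f_def g_def less_top)+
  have eU: "(\<integral>\<^sup>+\<omega>. ennreal (f \<omega>) \<partial>M) = (\<integral>\<^sup>+\<omega>. U \<omega> \<partial>M)" using aeU by (intro nn_integral_cong_AE)
  have eV: "(\<integral>\<^sup>+\<omega>. ennreal (g \<omega>) \<partial>M) = (\<integral>\<^sup>+\<omega>. V \<omega> \<partial>M)" using aeV by (intro nn_integral_cong_AE)
  have eUV: "(\<integral>\<^sup>+\<omega>. ennreal (f \<omega> * g \<omega>) \<partial>M) = (\<integral>\<^sup>+\<omega>. U \<omega> * V \<omega> \<partial>M)"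
  proof (rule nn_integral_cong_AE)
    show "AE \<omega> in M. ennreal (f \<omega> * g \<omega>) = U \<omega> * V \<omega>"
      using aeU aeV by eventually_elim (simp add: ennreal_mult fg0)
  qed
  have iF: "integrable M f" using eU U(2) fg0 by (intro integrableI_nonneg) auto
  have iG: "integrable M g" using eV V(2) fg0 by (intro integrableI_nonneg) auto
  have "(\<integral>\<^sup>+\<omega>. U \<omega> * V \<omega> \<partial>M) < \<top>"
    using U(2) V(2) by (intro le_less_trans[OF le]) (simp add: ennreal_mult_less_top)
  then have iFG: "integrable M (\<lambda>\<omega>. f \<omega> * g \<omega>)" using eUV fg0 by (intro integrableI_nonneg) auto
  have nn: "0 \<le> expectation f" "0 \<le> expectation g" using fg0 by (simp_all add: Bochner_Integration.integral_nonneg)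
  have "ennreal (expectation (\<lambda>\<omega>. f \<omega> * g \<omega>)) \<le> ennreal (expectation f) * ennreal (expectation g) + ennreal c"
    using le unfolding eU[symmetric] eV[symmetric] eUV[symmetric]
    using nn_integral_eq_integral[OF iF] nn_integral_eq_integral[OF iG] nn_integral_eq_integral[OF iFG] fg0 by simp
  also have "\<dots> = ennreal (expectation f * expectation g + c)"
    using nn c by (simp add: ennreal_mult)
  finally have main: "expectation (\<lambda>\<omega>. f \<omega> * g \<omega>) \<le> expectation f * expectation g + c"
    using nn c by (subst (asm) ennreal_le_iff) auto
  have expand: "(f \<omega> / p - expectation (\<lambda>\<omega>. f \<omega> / p)) * (g \<omega> / q - expectation (\<lambda>\<omega>. g \<omega> / q))
     = (f \<omega> * g \<omega> - expectation g * f \<omega> - expectation f * g \<omega> + expectation f * expectation g) / (p * q)" for \<omega>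
    using pq by (simp add: field_simps)
  have "covariance M (\<lambda>\<omega>. f \<omega> / p) (\<lambda>\<omega>. g \<omega> / q) = (expectation (\<lambda>\<omega>. f \<omega> * g \<omega>) - expectation f * expectation g) / (p * q)"
    unfolding covariance_def expand using iF iG iFG by (simp add: prob_space)
  also have "\<dots> \<le> c / (p * q)" using main pq by (intro divide_right_mono) auto
  finally show ?thesis by (simp add: f_def g_def)
qed

text \<open>Tonelli turns the bound of \<open>covariance_abs_le\<close> for pairs of points into one
  for the masses. 48 is 6 times 8, the 8 coming from the two amplitude integrals, sqrt (8 e^(beta
  t)) each; the initial masses cancel after normalisation.\<close>

lemma mass_covariance_le:
  fixes M :: "'a measure"
  assumes U: "mild_solution_bound M \<xi> \<theta> L \<beta> \<sigma>1 u0 u" and V: "mild_solution_bound M \<xi> \<theta> L \<beta> \<sigma>2 v0 v"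
    and t: "t > 0" and mass: "l1_norm u0 > 0" "l1_norm v0 > 0"
    and AB: "A \<in> sets borel" "B \<in> sets borel" "A \<inter> B = {}" and \<delta>: "\<delta> \<ge> 0"
    and farA: "\<And>y. y \<notin> A \<Longrightarrow> AE a in lborel. u0 a = 0 \<or> \<delta> \<le> \<bar>y - a\<bar>"
    and farB: "\<And>y. y \<notin> B \<Longrightarrow> AE a in lborel. v0 a = 0 \<or> \<delta> \<le> \<bar>y - a\<bar>"
  shows "covariance M (\<lambda>\<omega>. l1_norm (\<lambda>x. u t x \<omega>) / l1_norm u0) (\<lambda>\<omega>. l1_norm (\<lambda>x. v t x \<omega>) / l1_norm v0)
     \<le> 48 * exp (- \<delta>\<^sup>2 / (4 * \<theta> * t)) * exp (\<beta> * t)"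
proof -
  interpret U: mild_solution_bound M \<xi> \<theta> L \<beta> \<sigma>1 u0 u by fact
  interpret V: mild_solution_bound M \<xi> \<theta> L \<beta> \<sigma>2 v0 v by fact
  define \<epsilon> where "\<epsilon> = exp (- \<delta>\<^sup>2 / (4 * \<theta> * t))"
  have \<epsilon>: "0 < \<epsilon>" "\<epsilon> \<le> 1" using U.\<theta> t by (simp_all add: \<epsilon>_def)
  let ?a = "U.amplitude t" and ?b = "V.amplitude t"
  let ?f = "\<lambda>x \<omega>. ennreal \<bar>u t x \<omega>\<bar>" and ?g = "\<lambda>y \<omega>. ennreal \<bar>v t y \<omega>\<bar>"
  define Ia Ib where "Ia = sqrt (8 * exp (\<beta> * t)) * l1_norm u0" and "Ib = sqrt (8 * exp (\<beta> * t)) * l1_norm v0"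
  have I0: "Ia \<ge> 0" "Ib \<ge> 0" using mass by (simp_all add: Ia_def Ib_def)
  have disj: "(UNIV \<times> A) \<inter> (UNIV \<times> B) = ({} :: (real \<times> real) set)" using AB(3) by auto
  have pt: "(\<integral>\<^sup>+\<omega>. ?f x \<omega> * ?g y \<omega> \<partial>M) \<le> (\<integral>\<^sup>+\<omega>. ?f x \<omega> \<partial>M) * (\<integral>\<^sup>+\<omega>. ?g y \<omega> \<partial>M) + ennreal (6 * \<epsilon>) * (ennreal (?a x) * ennreal (?b y))" for x y
    using U.cond_dist_amplitude[OF t AB(1) \<delta> farA, of x] V.cond_dist_amplitude[OF t AB(2) \<delta> farB, of y]
    by (intro U.covariance_abs_le[OF disj] U.abs_solution_sections(3) V.abs_solution_sections(3) t U.amplitude_nonneg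
        V.amplitude_nonneg \<epsilon> U.second_moment_amplitude V.second_moment_amplitude) (simp_all add: \<epsilon>_def)
  note fm = U.abs_solution_measurable[OF t] and gm = V.abs_solution_measurable[OF t]
  interpret P: pair_sigma_finite lborel M
    by (intro pair_sigma_finite.intro U.sigma_finite_measure_axioms lborel.sigma_finite_measure_axioms)
  have gs: "?g y \<in> borel_measurable M" "?f y \<in> borel_measurable M" for y
    using V.abs_solution_sections(3)[OF t, of y] U.abs_solution_sections(3)[OF t, of y] by auto
  have am: "(\<lambda>x. ennreal (?a x)) \<in> borel_measurable lborel" "(\<lambda>x. ennreal (?b x)) \<in> borel_measurable lborel"
    using U.amplitude_measurable V.amplitude_measurable by auto
  have hm: "(\<lambda>x. \<integral>\<^sup>+\<omega>. ?f x \<omega> \<partial>M) \<in> borel_measurable lborel" "(\<lambda>y. \<integral>\<^sup>+\<omega>. ?g y \<omega> \<partial>M) \<in> borel_measurable lborel"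
    using U.borel_measurable_nn_integral_fst[OF fm] U.borel_measurable_nn_integral_fst[OF gm] by simp_all
  have "(\<integral>\<^sup>+\<omega>. U.abs_mass t \<omega> * V.abs_mass t \<omega> \<partial>M) = (\<integral>\<^sup>+\<omega>. (\<integral>\<^sup>+x. ?f x \<omega> * V.abs_mass t \<omega> \<partial>lborel) \<partial>M)"
    unfolding U.abs_mass_def by (intro nn_integral_cong nn_integral_multc[symmetric] U.abs_solution_sections(1)[OF t])
  also have "\<dots> = (\<integral>\<^sup>+x. (\<integral>\<^sup>+\<omega>. ?f x \<omega> * V.abs_mass t \<omega> \<partial>M) \<partial>lborel)"
  proof (rule P.Fubini')
    show "(\<lambda>(x, \<omega>). ?f x \<omega> * V.abs_mass t \<omega>) \<in> borel_measurable (lborel \<Otimes>\<^sub>M M)"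
      unfolding split_beta'
      by (rule borel_measurable_times_ennreal[OF fm measurable_compose[OF measurable_snd V.abs_mass_measurable[OF t]]])
  qed
  also have "\<dots> \<le> (\<integral>\<^sup>+x. (\<integral>\<^sup>+\<omega>. ?f x \<omega> \<partial>M) * (\<integral>\<^sup>+\<omega>. V.abs_mass t \<omega> \<partial>M) + ennreal (6 * \<epsilon>) * (ennreal (?a x) * ennreal Ib) \<partial>lborel)"
  proof (rule nn_integral_mono)
    fix x
    have "(\<integral>\<^sup>+\<omega>. ?f x \<omega> * V.abs_mass t \<omega> \<partial>M) = (\<integral>\<^sup>+\<omega>. (\<integral>\<^sup>+y. ?f x \<omega> * ?g y \<omega> \<partial>lborel) \<partial>M)"
      unfolding V.abs_mass_def by (intro nn_integral_cong nn_integral_cmult[symmetric] V.abs_solution_sections(1)[OF t])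
    also have "\<dots> = (\<integral>\<^sup>+y. (\<integral>\<^sup>+\<omega>. ?f x \<omega> * ?g y \<omega> \<partial>M) \<partial>lborel)"
    proof (rule P.Fubini')
      show "(\<lambda>(y, \<omega>). ?f x \<omega> * ?g y \<omega>) \<in> borel_measurable (lborel \<Otimes>\<^sub>M M)"
        unfolding split_beta'
        by (rule borel_measurable_times_ennreal[OF measurable_compose[OF measurable_snd gs(2)] gm])
    qed
    also have "\<dots> \<le> (\<integral>\<^sup>+y. (\<integral>\<^sup>+\<omega>. ?f x \<omega> \<partial>M) * (\<integral>\<^sup>+\<omega>. ?g y \<omega> \<partial>M) + ennreal (6 * \<epsilon>) * (ennreal (?a x) * ennreal (?b y)) \<partial>lborel)"
      by (intro nn_integral_mono pt)
    also have "\<dots> = (\<integral>\<^sup>+\<omega>. ?f x \<omega> \<partial>M) * (\<integral>\<^sup>+y. (\<integral>\<^sup>+\<omega>. ?g y \<omega> \<partial>M) \<partial>lborel) + ennreal (6 * \<epsilon>) * (ennreal (?a x) * (\<integral>\<^sup>+y. ennreal (?b y) \<partial>lborel))"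
      using am(2) hm(2) by (simp add: nn_integral_add nn_integral_cmult)
    also have "\<dots> = (\<integral>\<^sup>+\<omega>. ?f x \<omega> \<partial>M) * (\<integral>\<^sup>+\<omega>. V.abs_mass t \<omega> \<partial>M) + ennreal (6 * \<epsilon>) * (ennreal (?a x) * ennreal Ib)"
      by (simp only: V.abs_mass_integral(1)[OF t] V.amplitude_integral[OF t] Ib_def)
    finally show "(\<integral>\<^sup>+\<omega>. ?f x \<omega> * V.abs_mass t \<omega> \<partial>M) \<le> (\<integral>\<^sup>+\<omega>. ?f x \<omega> \<partial>M) * (\<integral>\<^sup>+\<omega>. V.abs_mass t \<omega> \<partial>M) + ennreal (6 * \<epsilon>) * (ennreal (?a x) * ennreal Ib)" .
  qed
  also have "\<dots> = (\<integral>\<^sup>+x. (\<integral>\<^sup>+\<omega>. ?f x \<omega> \<partial>M) \<partial>lborel) * (\<integral>\<^sup>+\<omega>. V.abs_mass t \<omega> \<partial>M) + ennreal (6 * \<epsilon>) * ((\<integral>\<^sup>+x. ennreal (?a x) \<partial>lborel) * ennreal Ib)"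
    using am(1) hm(1) by (simp add: nn_integral_add nn_integral_cmult nn_integral_multc)
  also have "\<dots> = (\<integral>\<^sup>+\<omega>. U.abs_mass t \<omega> \<partial>M) * (\<integral>\<^sup>+\<omega>. V.abs_mass t \<omega> \<partial>M) + ennreal (6 * \<epsilon> * (Ia * Ib))"
  proof -
    have "ennreal (6 * \<epsilon>) * (ennreal Ia * ennreal Ib) = ennreal (6 * \<epsilon> * (Ia * Ib))"
      using I0 \<epsilon> by (simp add: ennreal_mult)
    then show ?thesis by (simp only: U.abs_mass_integral(1)[OF t] U.amplitude_integral[OF t] Ia_def)
  qed
  finally have le: "(\<integral>\<^sup>+\<omega>. U.abs_mass t \<omega> * V.abs_mass t \<omega> \<partial>M) \<le> (\<integral>\<^sup>+\<omega>. U.abs_mass t \<omega> \<partial>M) * (\<integral>\<^sup>+\<omega>. V.abs_mass t \<omega> \<partial>M) + ennreal (6 * \<epsilon> * (Ia * Ib))" .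
  have fin: "(\<integral>\<^sup>+\<omega>. U.abs_mass t \<omega> \<partial>M) < \<top>" "(\<integral>\<^sup>+\<omega>. V.abs_mass t \<omega> \<partial>M) < \<top>"
    using le_less_trans[OF U.abs_mass_integral(2)[OF t]] le_less_trans[OF V.abs_mass_integral(2)[OF t]] by auto
  have "covariance M (\<lambda>\<omega>. l1_norm (\<lambda>x. u t x \<omega>) / l1_norm u0) (\<lambda>\<omega>. l1_norm (\<lambda>x. v t x \<omega>) / l1_norm v0)
     = covariance M (\<lambda>\<omega>. enn2real (U.abs_mass t \<omega>) / l1_norm u0) (\<lambda>\<omega>. enn2real (V.abs_mass t \<omega>) / l1_norm v0)"
    unfolding covariance_def
    by (simp add: U.l1_norm_abs_mass[OF t] V.l1_norm_abs_mass[OF t] cong: Bochner_Integration.integral_cong)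
  also have "\<dots> \<le> 6 * \<epsilon> * (Ia * Ib) / (l1_norm u0 * l1_norm v0)"
    using I0 \<epsilon> by (intro U.covariance_enn2real_le[OF U.abs_mass_measurable[OF t] fin(1) V.abs_mass_measurable[OF t] fin(2) le] mass) auto
  also have "\<dots> = 6 * \<epsilon> * (sqrt (8 * exp (\<beta> * t)) * sqrt (8 * exp (\<beta> * t)))"
    using mass by (simp add: Ia_def Ib_def)
  also have "sqrt (8 * exp (\<beta> * t)) * sqrt (8 * exp (\<beta> * t)) = 8 * exp (\<beta> * t)" by (simp only: real_sqrt_mult_self) simp
  finally show ?thesis by (simp add: \<epsilon>_def)
qed

theorem corollary1p2:
  fixes \<theta> L1 L2 :: real
  assumes "\<theta> > 0"
  shows "\<exists>\<eta> \<gamma>. 0 < \<eta> \<and> \<eta> < 1 \<and> 0 < \<gamma> \<and>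
    (\<forall>(M :: 'a measure) (\<xi> :: (real \<times> real \<Rightarrow> real) \<Rightarrow> 'a \<Rightarrow> real)
       (\<sigma>1 :: real \<Rightarrow> real) (\<sigma>2 :: real \<Rightarrow> real) (u0 :: real \<Rightarrow> real) (v0 :: real \<Rightarrow> real)
       (u :: real \<Rightarrow> real \<Rightarrow> 'a \<Rightarrow> real) (v :: real \<Rightarrow> real \<Rightarrow> 'a \<Rightarrow> real).
       prob_space M \<and> white_noise M \<xi> \<and>
       (\<exists>C. C-lipschitz_on UNIV \<sigma>1) \<and> (\<exists>C. C-lipschitz_on UNIV \<sigma>2) \<and>
       lip_const \<sigma>1 = L1 \<and> lip_const \<sigma>2 = L2 \<and>
       (\<forall>x. \<sigma>1 x \<ge> 0) \<and> (\<forall>x. \<sigma>2 x \<ge> 0) \<and> \<sigma>1 0 = 0 \<and> \<sigma>2 0 = 0 \<and>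
       integrable lborel u0 \<and> ess_bounded u0 \<and> (AE x in lborel. u0 x \<ge> 0) \<and>
       integrable lborel v0 \<and> ess_bounded v0 \<and> (AE x in lborel. v0 x \<ge> 0) \<and>
       min (l1_norm u0) (l1_norm v0) > 0 \<and>
       mild_solution M \<xi> \<theta> \<sigma>1 u0 u \<and> mild_solution M \<xi> \<theta> \<sigma>2 v0 v
       \<longrightarrow> (\<forall>t. 0 < t \<and> t < \<eta> * setdist (ess_support u0) (ess_support v0) \<longrightarrow>
              covariance M (\<lambda>\<omega>. l1_norm (\<lambda>x. u t x \<omega>) / l1_norm u0)
                           (\<lambda>\<omega>. l1_norm (\<lambda>x. v t x \<omega>) / l1_norm v0)
                \<le> inverse \<eta> * exp (- \<gamma> * t)))"
proof -
  note \<theta> = assms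
  define L where "L = max L1 L2"
  \<comment> \<open>Here \<open>\<kappa>\<close> is chosen so that kappa / (2 sqrt beta) is the
    contraction constant. The 1 in \<open>\<beta>\<close> keeps it positive even when
    \<open>L\<close> is 0.\<close>
  define \<kappa> where "\<kappa> = 24 * sqrt 2 * L\<^sup>2 / sqrt (4 * pi * \<theta>)"
  define \<beta> where "\<beta> = \<kappa>\<^sup>2 + 1"
  \<comment> \<open>The first entry lets \<open>inverse \<eta>\<close> absorb the factor 48. The
    second is the largest value with 16 theta (beta + 1) eta^2 \<le> 1, where the 1 beside beta
    becomes the decay rate.\<close>
  define \<eta> where "\<eta> = min (1 / 48) (1 / (4 * sqrt (\<theta> * (\<beta> + 1))))"
  have \<kappa>0: "\<kappa> \<ge> 0" using \<theta> by (simp add: \<kappa>_def)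
  have \<beta>: "\<beta> > 0" by (simp add: \<beta>_def add_nonneg_pos)
  have "\<kappa> \<le> sqrt \<beta>" unfolding \<beta>_def by (rule real_le_rsqrt) simp
  then have "\<kappa> / sqrt \<beta> \<le> 1" using \<beta> by (simp add: field_simps)
  moreover have "2 * L\<^sup>2 * (6 * sqrt 2 / (sqrt (4 * pi * \<theta>) * sqrt \<beta>)) = (\<kappa> / sqrt \<beta>) / 2"
    by (simp add: \<kappa>_def mult_ac)
  ultimately have small: "2 * L\<^sup>2 * (6 * sqrt 2 / (sqrt (4 * pi * \<theta>) * sqrt \<beta>)) \<le> 1 / 2" by simp
  have \<eta>0: "\<eta> > 0" using \<theta> \<beta> by (simp add: \<eta>_def)
  have \<eta>2: "16 * \<theta> * (\<beta> + 1) * \<eta>\<^sup>2 \<le> 1"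
  proof -
    have "\<eta>\<^sup>2 \<le> (1 / (4 * sqrt (\<theta> * (\<beta> + 1))))\<^sup>2" using \<eta>0 by (intro power_mono) (auto simp: \<eta>_def)
    also have "\<dots> = 1 / (16 * (\<theta> * (\<beta> + 1)))" using \<theta> \<beta> by (simp add: power_divide power_mult_distrib)
    finally have "16 * (\<theta> * (\<beta> + 1)) * \<eta>\<^sup>2 \<le> 16 * (\<theta> * (\<beta> + 1)) * (1 / (16 * (\<theta> * (\<beta> + 1))))"
      using \<theta> \<beta> by (intro mult_left_mono) auto
    then show ?thesis using \<theta> \<beta> by (simp add: mult_ac)
  qed
  have main: "covariance M (\<lambda>\<omega>. l1_norm (\<lambda>x. u t x \<omega>) / l1_norm u0) (\<lambda>\<omega>. l1_norm (\<lambda>x. v t x \<omega>) / l1_norm v0)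
       \<le> inverse \<eta> * exp (- 1 * t)"
    if "prob_space M" "white_noise M \<xi>" and lip: "\<exists>C. C-lipschitz_on UNIV \<sigma>1" "\<exists>C. C-lipschitz_on UNIV \<sigma>2"
      "lip_const \<sigma>1 = L1" "lip_const \<sigma>2 = L2" and z: "\<sigma>1 0 = 0" "\<sigma>2 0 = 0"
      and u0: "integrable lborel u0" "AE x in lborel. u0 x \<ge> 0" and v0: "integrable lborel v0" "AE x in lborel. v0 x \<ge> 0"
      and mass: "min (l1_norm u0) (l1_norm v0) > 0"
      and mild: "mild_solution M \<xi> \<theta> \<sigma>1 u0 u" "mild_solution M \<xi> \<theta> \<sigma>2 v0 v"
      and t: "0 < t" "t < \<eta> * setdist (ess_support u0) (ess_support v0)"
    for M :: "'a measure" and \<xi> \<sigma>1 \<sigma>2 u0 v0 u v t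
  proof -
    have N: "noise M \<xi>" using that by (simp add: noise_def noise_axioms_def)
    have \<sigma>: "\<sigma> \<in> borel_measurable borel" "\<bar>\<sigma> x - \<sigma> y\<bar> \<le> L * \<bar>x - y\<bar>"
      if lip\<sigma>: "\<exists>C. C-lipschitz_on UNIV \<sigma>" "lip_const \<sigma> \<le> L" for \<sigma> :: "real \<Rightarrow> real" and x y
    proof -
      obtain C where C: "C-lipschitz_on UNIV \<sigma>" using lip\<sigma> by auto
      show "\<sigma> \<in> borel_measurable borel"
        using lipschitz_on_continuous_on[OF C] by (rule borel_measurable_continuous_onI)
      have "\<bar>\<sigma> x - \<sigma> y\<bar> \<le> lip_const \<sigma> * \<bar>x - y\<bar>" by (rule lip_const_bound[OF C])
      also have "\<dots> \<le> L * \<bar>x - y\<bar>" using lip\<sigma> by (intro mult_right_mono) auto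
      finally show "\<bar>\<sigma> x - \<sigma> y\<bar> \<le> L * \<bar>x - y\<bar>" .
    qed
    have U: "mild_solution_bound M \<xi> \<theta> L \<beta> \<sigma>1 u0 u"
      by (intro mild_solution_bound.intro N mild_solution_bound_axioms.intro \<theta> mild \<sigma> z u0 \<beta> small lip) (simp add: lip L_def)+
    have V: "mild_solution_bound M \<xi> \<theta> L \<beta> \<sigma>2 v0 v"
      by (intro mild_solution_bound.intro N mild_solution_bound_axioms.intro \<theta> mild \<sigma> z v0 \<beta> small lip) (simp add: lip L_def)+
    define d where "d = setdist (ess_support u0) (ess_support v0)"
    \<comment> \<open>The existence of an admissible time forces a positive gap between the
      supports.\<close>
    have "0 < \<eta> * d" using t by (simp add: d_def)
    then have d: "d > 0" using \<eta>0 by (simp add: zero_less_mult_iff)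
    define N where "N = (\<lambda>S. \<Union>a\<in>S. ball a (d / 2) :: real set)"
    have Nb: "N S \<in> sets borel" for S unfolding N_def by (intro borel_open open_UN) auto
    have disj: "N (ess_support u0) \<inter> N (ess_support v0) = {}"
    proof (rule ccontr)
      assume "N (ess_support u0) \<inter> N (ess_support v0) \<noteq> {}"
      then obtain y a b where ab: "a \<in> ess_support u0" "b \<in> ess_support v0" "dist a y < d / 2" "dist b y < d / 2"
        by (auto simp: N_def)
      have "d \<le> dist a b" unfolding d_def by (rule setdist_le_dist[OF ab(1,2)])
      also have "\<dots> \<le> dist a y + dist b y" by (rule dist_triangle2)
      finally show False using ab by simp
    qed
    have far: "AE a in lborel. f a = 0 \<or> d / 2 \<le> \<bar>y - a\<bar>" if "y \<notin> N (ess_support f)" for y f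
      using AE_zero_or_ess_support[of f]
    proof eventually_elim
      case (elim a)
      then show ?case using that by (auto simp: N_def dist_real_def abs_minus_commute not_less)
    qed
    have "covariance M (\<lambda>\<omega>. l1_norm (\<lambda>x. u t x \<omega>) / l1_norm u0) (\<lambda>\<omega>. l1_norm (\<lambda>x. v t x \<omega>) / l1_norm v0)
       \<le> 48 * exp (- (d / 2)\<^sup>2 / (4 * \<theta> * t)) * exp (\<beta> * t)"
      using mass d by (intro mass_covariance_le[OF U V t(1) _ _ Nb Nb disj _ far far]) auto
    also have "\<dots> = 48 * exp (\<beta> * t - d\<^sup>2 / (16 * \<theta> * t))"
    proof -
      have "- (d / 2)\<^sup>2 / (4 * \<theta> * t) + \<beta> * t = \<beta> * t - d\<^sup>2 / (16 * \<theta> * t)" by (simp add: power_divide)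
      then show ?thesis by (simp only: mult.assoc exp_add[symmetric])
    qed
    \<comment> \<open>Since t < eta d, the choice of eta makes d^2 / (16 theta t) at least (beta +
      1) t: the part beta t compensates the moment growth, and the remaining t is the decay with
      gamma = 1.\<close>
    also have "\<dots> \<le> 48 * exp (- 1 * t)"
    proof -
      have "t\<^sup>2 \<le> (\<eta> * d)\<^sup>2" using t by (intro power_mono) (auto simp: d_def)
      then have "16 * \<theta> * (\<beta> + 1) * t\<^sup>2 \<le> (16 * \<theta> * (\<beta> + 1)) * (\<eta> * d)\<^sup>2"
        using \<theta> \<beta> by (intro mult_left_mono) auto
      also have "\<dots> = (16 * \<theta> * (\<beta> + 1) * \<eta>\<^sup>2) * d\<^sup>2" by (simp add: power_mult_distrib mult_ac)
      also have "\<dots> \<le> 1 * d\<^sup>2" using \<eta>2 by (intro mult_right_mono) auto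
      finally have "(\<beta> + 1) * t \<le> d\<^sup>2 / (16 * \<theta> * t)"
        using \<theta> t by (simp add: field_simps power2_eq_square)
      then show ?thesis by (simp add: algebra_simps)
    qed
    also have "\<dots> \<le> inverse \<eta> * exp (- 1 * t)"
    proof (rule mult_right_mono)
      have "\<eta> \<le> 1 / 48" by (simp add: \<eta>_def)
      then show "48 \<le> inverse \<eta>" using \<eta>0 by (simp add: field_simps)
    qed simp
    finally show ?thesis .
  qed
  show ?thesis
  proof (rule exI[of _ \<eta>], rule exI[of _ "1::real"], intro conjI allI impI)
    show "\<eta> < 1" by (simp add: \<eta>_def min_less_iff_disj)
    fix M :: "'a measure" and \<xi> \<sigma>1 \<sigma>2 u0 v0 u v t
    assume H: "prob_space M \<and> white_noise M \<xi> \<and>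
       (\<exists>C. C-lipschitz_on UNIV \<sigma>1) \<and> (\<exists>C. C-lipschitz_on UNIV \<sigma>2) \<and>
       lip_const \<sigma>1 = L1 \<and> lip_const \<sigma>2 = L2 \<and>
       (\<forall>x. \<sigma>1 x \<ge> 0) \<and> (\<forall>x. \<sigma>2 x \<ge> 0) \<and> \<sigma>1 0 = 0 \<and> \<sigma>2 0 = 0 \<and>
       integrable lborel u0 \<and> ess_bounded u0 \<and> (AE x in lborel. u0 x \<ge> 0) \<and>
       integrable lborel v0 \<and> ess_bounded v0 \<and> (AE x in lborel. v0 x \<ge> 0) \<and>
       min (l1_norm u0) (l1_norm v0) > 0 \<and>
       mild_solution M \<xi> \<theta> \<sigma>1 u0 u \<and> mild_solution M \<xi> \<theta> \<sigma>2 v0 v"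
      and T: "0 < t \<and> t < \<eta> * setdist (ess_support u0) (ess_support v0)"
    show "covariance M (\<lambda>\<omega>. l1_norm (\<lambda>x. u t x \<omega>) / l1_norm u0) (\<lambda>\<omega>. l1_norm (\<lambda>x. v t x \<omega>) / l1_norm v0)
       \<le> inverse \<eta> * exp (- 1 * t)"
      by (rule main[of M \<xi> \<sigma>1 \<sigma>2 u0 v0 u v t]) (simp_all only: H T)
  qed (use \<eta>0 in auto)
qed

end
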